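(* Let $f$ and $g$ be operator monotone functions such that $(f,g)$ is a monotonic pair. Let $\rho$ be a density operator and let $A, B$ be observables (self-adjoint operators). Then $$I_{\rho,(f,g)}(A)\, I_{\rho,(f,g)}(B) \geq \left| \mathrm{Re}\left\{ \mathrm{Corr}_{\rho,(f,g)}(A,B)\right\}\right|^2.$$
   Context: Operators act on a Hilbert space, and the traces that appear are assumed to be finite (in particular this covers matrices). A density operator is a positive operator with unit trace. Two real functions $f, g$ on a domain $D\subset\mathbb{R}$ form a monotonic pair $(f,g)$ if $(f(a)-f(b))(g(a)-g(b))\geq 0$ for all $a,b\in D$; here $D$ contains the spectrum of $\rho$, so that $f(\rho), g(\rho)$ are defined by functional calculus. Write $[X,Y] = XY - YX$. For a density operator $\rho$ and an observable (self-adjoint operator) $H$, with $H_0 = H - \mathrm{Tr}[\rho H] I$, the $(f,g)$-skew information is $$I_{\rho,(f,g)}(H) = \frac{1}{2}\mathrm{Tr}\left[\left(i[f(\rho),H_0]\right)\left(i[g(\rho),H_0]\right)\right].$$ For arbitrary operators $X, Y$, the $(f,g)$-correlation measure is $$\mathrm{Corr}_{\rho,(f,g)}(X,Y) = \mathrm{Tr}[f(\rho)g(\rho)X^*Y] - \mathrm{Tr}[f(\rho)X^*g(\rho)Y].$$ *)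

theory Defs
  imports
    "HOL-Analysis.Analysis"
    "HOL-Computational_Algebra.Polynomial"
    "HOL-Library.Complex_Order"
    "Jordan_Normal_Form.Schur_Decomposition"
begin

section \<open>Complex Hilbert spaces\<close>

text \<open>The inner product is conjugate-linear in the first and linear in the second argument.
  Completeness comes from the superclass \<^class>\<open>banach\<close>.\<close>

class complex_hilbert_space = banach +
  fixes scaleC :: "complex \<Rightarrow> 'a \<Rightarrow> 'a" (infixr \<open>*\<^sub>C\<close> 75)
    and cinner :: "'a \<Rightarrow> 'a \<Rightarrow> complex"
  assumes scaleC_add_right: "a *\<^sub>C (x + y) = a *\<^sub>C x + a *\<^sub>C y"
    and scaleC_add_left: "(a + b) *\<^sub>C x = a *\<^sub>C x + b *\<^sub>C x"
    and scaleC_scaleC: "a *\<^sub>C (b *\<^sub>C x) = (a * b) *\<^sub>C x"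
    and scaleR_scaleC: "r *\<^sub>R x = complex_of_real r *\<^sub>C x"
    and cinner_commute: "cinner x y = cnj (cinner y x)"
    and cinner_add_right: "cinner x (y + z) = cinner x y + cinner x z"
    and cinner_scaleC_right: "cinner x (a *\<^sub>C y) = a * cinner x y"
    and cinner_ge_zero: "0 \<le> Re (cinner x x)"
    and norm_eq_sqrt_cinner: "norm x = sqrt (Re (cinner x x))"

instantiation complex :: complex_hilbert_space
begin

definition scaleC_complex :: "complex \<Rightarrow> complex \<Rightarrow> complex"
  where "scaleC_complex a x = a * x"

definition cinner_complex :: "complex \<Rightarrow> complex \<Rightarrow> complex"
  where "cinner_complex x y = cnj x * y"

instance
  by standard
    (auto simp: scaleC_complex_def cinner_complex_def algebra_simps scaleR_conv_of_real
      cmod_def power2_eq_square)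

end

text \<open>A basis is a maximal orthonormal set; it may have any cardinality.\<close>

definition is_onb :: "'a::complex_hilbert_space set \<Rightarrow> bool"
  where "is_onb E \<longleftrightarrow>
    (\<forall>e\<in>E. norm e = 1) \<and>
    (\<forall>e\<in>E. \<forall>e'\<in>E. e \<noteq> e' \<longrightarrow> cinner e e' = 0) \<and>
    (\<forall>x. (\<forall>e\<in>E. cinner e x = 0) \<longrightarrow> x = 0)"

section \<open>Bounded operators\<close>

definition bounded_clinear :: "('a::complex_hilbert_space \<Rightarrow> 'a) \<Rightarrow> bool"
  where "bounded_clinear T \<longleftrightarrow> bounded_linear T \<and> (\<forall>c x. T (c *\<^sub>C x) = c *\<^sub>C T x)"

definition op_adjoint :: "('a::complex_hilbert_space \<Rightarrow> 'a) \<Rightarrow> 'a \<Rightarrow> 'a"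
  where "op_adjoint T =
    (THE S. bounded_clinear S \<and> (\<forall>x y. cinner (S x) y = cinner x (T y)))"

definition self_adjoint :: "('a::complex_hilbert_space \<Rightarrow> 'a) \<Rightarrow> bool"
  where "self_adjoint T \<longleftrightarrow>
    bounded_clinear T \<and> (\<forall>x y. cinner (T x) y = cinner x (T y))"

text \<open>Here and below, \<^term>\<open>z \<le> w\<close> for complex numbers is the order of
  \<^theory>\<open>HOL-Library.Complex_Order\<close>: \<open>Re z \<le> Re w\<close> and \<open>Im z = Im w\<close>.
  So a nonnegative complex number is in particular real.\<close>

definition positive_op :: "('a::complex_hilbert_space \<Rightarrow> 'a) \<Rightarrow> bool"
  where "positive_op T \<longleftrightarrow> bounded_clinear T \<and> (\<forall>x. 0 \<le> cinner x (T x))"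

definition commutator ::
    "('a::complex_hilbert_space \<Rightarrow> 'a) \<Rightarrow> ('a \<Rightarrow> 'a) \<Rightarrow> 'a \<Rightarrow> 'a"
  where "commutator X Y = (\<lambda>v. X (Y v) - Y (X v))"

section \<open>Trace\<close>

definition hilbert_schmidt :: "('a::complex_hilbert_space \<Rightarrow> 'a) \<Rightarrow> bool"
  where "hilbert_schmidt T \<longleftrightarrow>
    bounded_clinear T \<and> (\<exists>E. is_onb E \<and> (\<lambda>e. (norm (T e))\<^sup>2) summable_on E)"

text \<open>The trace class is the set of products of two Hilbert-Schmidt operators.\<close>

definition trace_class :: "('a::complex_hilbert_space \<Rightarrow> 'a) \<Rightarrow> bool"
  where "trace_class T \<longleftrightarrow>
    (\<exists>R S. hilbert_schmidt R \<and> hilbert_schmidt S \<and> T = R \<circ> S)"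

text \<open>For trace class operators the sum converges absolutely and does not depend on the basis;
  on other operators the value is meaningless.\<close>

definition op_trace :: "('a::complex_hilbert_space \<Rightarrow> 'a) \<Rightarrow> complex"
  where "op_trace T = (\<Sum>\<^sub>\<infinity>e\<in>(SOME E. is_onb E). cinner e (T e))"

definition density_operator :: "('a::complex_hilbert_space \<Rightarrow> 'a) \<Rightarrow> bool"
  where "density_operator \<rho> \<longleftrightarrow>
    positive_op \<rho> \<and> trace_class \<rho> \<and> op_trace \<rho> = 1"

section \<open>Spectrum and functional calculus\<close>

definition op_spectrum :: "('a::complex_hilbert_space \<Rightarrow> 'a) \<Rightarrow> complex set"
  where "op_spectrum T =
    {z. \<not> (\<exists>S. bounded_clinear S \<and>
            (\<forall>x. S (T x - z *\<^sub>C x) = x) \<and> (\<forall>x. T (S x) - z *\<^sub>C S x = x))}"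

definition poly_op :: "real poly \<Rightarrow> ('a::complex_hilbert_space \<Rightarrow> 'a) \<Rightarrow> 'a \<Rightarrow> 'a"
  where "poly_op p T = (\<lambda>x. \<Sum>i\<le>degree p. coeff p i *\<^sub>R (T ^^ i) x)"

text \<open>Continuous functional calculus of a self-adjoint \<open>T\<close>: \<open>f(T)\<close> is the limit in operator
  norm of \<open>p\<^sub>n(T)\<close> for real polynomials \<open>p\<^sub>n\<close> converging to \<open>f\<close> uniformly on the spectrum.\<close>

definition fun_calc :: "(real \<Rightarrow> real) \<Rightarrow> ('a::complex_hilbert_space \<Rightarrow> 'a) \<Rightarrow> 'a \<Rightarrow> 'a"
  where "fun_calc f T =
    (THE S. bounded_clinear S \<and>
      (\<exists>p :: nat \<Rightarrow> real poly.
        uniform_limit {t. complex_of_real t \<in> op_spectrum T} (\<lambda>n t. poly (p n) t) f sequentially \<and>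
        (\<lambda>n. onorm (\<lambda>x. poly_op (p n) T x - S x)) \<longlonglongrightarrow> 0))"

section \<open>Monotonic pairs and operator monotone functions\<close>

definition monotonic_pair :: "real set \<Rightarrow> (real \<Rightarrow> real) \<Rightarrow> (real \<Rightarrow> real) \<Rightarrow> bool"
  where "monotonic_pair D f g \<longleftrightarrow>
    (\<forall>a\<in>D. \<forall>b\<in>D. (f a - f b) * (g a - g b) \<ge> 0)"

text \<open>Every Hermitian matrix has the form \<open>M = U diag(d) U\<^sup>*\<close> with \<open>U\<close> unitary and \<open>d\<close> real;
  its spectrum is the set of the \<open>d i\<close>, and \<open>f(M) = U diag(f \<circ> d) U\<^sup>*\<close>.\<close>

definition unitary_mat :: "nat \<Rightarrow> complex mat \<Rightarrow> bool"
  where "unitary_mat n U \<longleftrightarrow> U \<in> carrier_mat n n \<and> mat_adjoint U * U = 1\<^sub>m n"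

definition spectral_mat :: "nat \<Rightarrow> complex mat \<Rightarrow> (nat \<Rightarrow> real) \<Rightarrow> complex mat"
  where "spectral_mat n U d = U * mat_diag n (\<lambda>i. complex_of_real (d i)) * mat_adjoint U"

definition loewner_le :: "nat \<Rightarrow> complex mat \<Rightarrow> complex mat \<Rightarrow> bool"
  where "loewner_le n M N \<longleftrightarrow>
    (\<forall>v\<in>carrier_vec n. 0 \<le> ((N - M) *\<^sub>v v) \<bullet>c v)"

text \<open>Operator monotonicity is monotonicity for Hermitian matrices of every order. Continuity is
  automatic in the interior of an interval; it is required on all of \<open>D\<close> because \<open>f(T)\<close> is defined
  by continuous functional calculus.\<close>

definition operator_monotone_on :: "real set \<Rightarrow> (real \<Rightarrow> real) \<Rightarrow> bool"
  where "operator_monotone_on D f \<longleftrightarrow>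
    continuous_on D f \<and>
    (\<forall>n U V a b.
      unitary_mat n U \<and> unitary_mat n V \<and> (\<forall>i<n. a i \<in> D \<and> b i \<in> D) \<and>
      loewner_le n (spectral_mat n U a) (spectral_mat n V b) \<longrightarrow>
      loewner_le n (spectral_mat n U (f \<circ> a)) (spectral_mat n V (f \<circ> b)))"

section \<open>Skew information and correlation measure\<close>

text \<open>The operators under the traces have their own names so that finiteness of exactly these
  traces can be stated as trace class hypotheses; \<open>Tr[\<rho> H]\<close> is always finite since \<open>\<rho>\<close> is trace
  class. The skew information is complex-valued, as the trace is.\<close>

definition centered ::
    "('a::complex_hilbert_space \<Rightarrow> 'a) \<Rightarrow> ('a \<Rightarrow> 'a) \<Rightarrow> 'a \<Rightarrow> 'a"
  where "centered \<rho> H = (\<lambda>x. H x - op_trace (\<rho> \<circ> H) *\<^sub>C x)"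

definition skew_op ::
    "(real \<Rightarrow> real) \<Rightarrow> (real \<Rightarrow> real) \<Rightarrow> ('a::complex_hilbert_space \<Rightarrow> 'a) \<Rightarrow> ('a \<Rightarrow> 'a) \<Rightarrow> 'a \<Rightarrow> 'a"
  where "skew_op f g \<rho> H =
    (\<lambda>x. \<i> *\<^sub>C commutator (fun_calc f \<rho>) (centered \<rho> H) x) \<circ>
    (\<lambda>x. \<i> *\<^sub>C commutator (fun_calc g \<rho>) (centered \<rho> H) x)"

definition skew_information ::
    "(real \<Rightarrow> real) \<Rightarrow> (real \<Rightarrow> real) \<Rightarrow> ('a::complex_hilbert_space \<Rightarrow> 'a) \<Rightarrow> ('a \<Rightarrow> 'a) \<Rightarrow> complex"
  where "skew_information f g \<rho> H = 1 / 2 * op_trace (skew_op f g \<rho> H)"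

definition corr_op1 ::
    "(real \<Rightarrow> real) \<Rightarrow> (real \<Rightarrow> real) \<Rightarrow> ('a::complex_hilbert_space \<Rightarrow> 'a) \<Rightarrow>
      ('a \<Rightarrow> 'a) \<Rightarrow> ('a \<Rightarrow> 'a) \<Rightarrow> 'a \<Rightarrow> 'a"
  where "corr_op1 f g \<rho> X Y = fun_calc f \<rho> \<circ> fun_calc g \<rho> \<circ> op_adjoint X \<circ> Y"

definition corr_op2 ::
    "(real \<Rightarrow> real) \<Rightarrow> (real \<Rightarrow> real) \<Rightarrow> ('a::complex_hilbert_space \<Rightarrow> 'a) \<Rightarrow>
      ('a \<Rightarrow> 'a) \<Rightarrow> ('a \<Rightarrow> 'a) \<Rightarrow> 'a \<Rightarrow> 'a"
  where "corr_op2 f g \<rho> X Y = fun_calc f \<rho> \<circ> op_adjoint X \<circ> fun_calc g \<rho> \<circ> Y"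

definition correlation ::
    "(real \<Rightarrow> real) \<Rightarrow> (real \<Rightarrow> real) \<Rightarrow> ('a::complex_hilbert_space \<Rightarrow> 'a) \<Rightarrow>
      ('a \<Rightarrow> 'a) \<Rightarrow> ('a \<Rightarrow> 'a) \<Rightarrow> complex"
  where "correlation f g \<rho> X Y =
    op_trace (corr_op1 f g \<rho> X Y) - op_trace (corr_op2 f g \<rho> X Y)"

end

theory Submission
  imports Defs
begin

text \<open>In an orthonormal eigenbasis of \<open>\<rho>\<close>, with \<open>\<phi>\<close> and \<open>\<gamma>\<close> the eigenvalues of \<open>f(\<rho>)\<close> and \<open>g(\<rho>)\<close>,
  the skew information of \<open>H\<close> is half the sum of
  \<open>(\<phi> e - \<phi> e') (\<gamma> e - \<gamma> e') \<bar>\<langle>e, H e'\<rangle>\<bar>\<^sup>2\<close>, with nonnegative weights since \<open>(f, g)\<close> is a monotonic pair.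
  The real part of the correlation is formally half the sum of the same weights against
  \<open>\<langle>e, A e'\<rangle> \<langle>e', B e\<rangle>\<close>, and the theorem is the Cauchy-Schwarz inequality for these weights.

  In infinite dimensions the symmetrization behind the formula for the correlation is a rearrangement
  of a conditionally convergent double sum. It is justified by truncating \<open>\<phi>\<close> at levels above its
  infimum \<open>f0\<close>, which leaves finitely many terms because \<open>f\<close> is increasing and the eigenvalues of
  \<open>\<rho>\<close> tend to \<open>0\<close>. If \<open>f0\<close> is nonzero, replacing \<open>\<phi>\<close> by \<open>\<phi> - f0\<close> must not change the real part of
  the trace; this holds because \<open>[g(\<rho>), A] B\<close> is then itself of trace class and, as a
  product of a skew-adjoint and a self-adjoint operator, has purely imaginary trace.\<close>

section \<open>Inner product geometry\<close>

text \<open>Besides \<rho>, only the composite operators under the four traces are assumed to be of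
  trace class; \<open>f(\<rho>)\<close>, \<open>g(\<rho>)\<close>, \<open>A\<close>,
  \<open>B\<close> and the commutators are merely bounded, so no trace may be split or cycled
  freely. The skew informations are the well-behaved part: their matrix terms are nonnegative, so an
  iterated sum is already a double sum, and Cauchy-Schwarz then makes the double sum for the
  correlation absolutely convergent. The trace of the correlation itself gives only an iterated sum:
  \<open>\<phi> e\<close> times a row whose entries are
  \<open>(\<gamma> e - \<gamma> e') * c e e'\<close> with \<open>c\<close> symmetric. Swapping
  \<open>e\<close> and \<open>e'\<close> and averaging turns \<open>\<phi> e\<close> into
  \<open>(\<phi> e - \<phi> e') / 2\<close>. For an infinite eigenbasis \<open>f0\<close> is
  \<open>f 0\<close>: the eigenvalues accumulate at \<open>0\<close>, so \<open>0\<close> is in the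
  closed spectrum and hence in \<open>D\<close>. If \<open>f0\<close> is nonzero,
  \<open>f(\<rho>)\<close> stays away from zero outside a finite-dimensional subspace and can be
  divided out of \<open>f(\<rho>) [g(\<rho>), A] B\<close>; this is where the trace class property
  of \<open>[g(\<rho>), A] B\<close> comes from.\<close>

lemma scaleC_one [simp]: "1 *\<^sub>C (x::'a::complex_hilbert_space) = x"
  using scaleR_scaleC[of 1 x] by simp

lemma scaleC_zero_left [simp]: "0 *\<^sub>C (x::'a::complex_hilbert_space) = 0"
  using scaleR_scaleC[of 0 x] by simp

lemma scaleC_zero_right [simp]: "a *\<^sub>C (0::'a::complex_hilbert_space) = 0"
  using scaleC_add_right[of a 0 0] by simp

lemma scaleC_scaleR: "a *\<^sub>C (r *\<^sub>R (x::'a::complex_hilbert_space)) = r *\<^sub>R (a *\<^sub>C x)"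
  by (simp add: scaleR_scaleC scaleC_scaleC mult.commute)

lemma scaleR_left_scaleC: "(r *\<^sub>R a) *\<^sub>C (x::'a::complex_hilbert_space) = r *\<^sub>R (a *\<^sub>C x)"
  by (simp add: scaleR_scaleC[of _ "_ :: 'a"] scaleC_scaleC scaleR_conv_of_real)

lemma cinner_add_left:
  "cinner (x + y) z = cinner x z + cinner y (z::'a::complex_hilbert_space)"
  using cinner_commute cinner_add_right by (metis complex_cnj_add)

lemma cinner_scaleC_left:
  "cinner (a *\<^sub>C x) y = cnj a * cinner x (y::'a::complex_hilbert_space)"
  using cinner_commute cinner_scaleC_right by (metis complex_cnj_mult)

lemma Im_cinner_self [simp]: "Im (cinner x (x::'a::complex_hilbert_space)) = 0"
  using arg_cong[OF cinner_commute[of x x], of Im] by simp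

lemma Re_cinner_self: "Re (cinner x x) = (norm (x::'a::complex_hilbert_space))\<^sup>2"
  by (simp add: norm_eq_sqrt_cinner cinner_ge_zero)

lemma cinner_self: "cinner x x = complex_of_real ((norm (x::'a::complex_hilbert_space))\<^sup>2)"
  by (simp add: complex_eq_iff Re_cinner_self)

text \<open>The norm inherited from \<open>banach\<close> is homogeneous for real scalars; complex
  homogeneity has to be read off from the inner product.\<close>

lemma norm_scaleC [simp]: "norm (a *\<^sub>C (x::'a::complex_hilbert_space)) = cmod a * norm x"
proof -
  have "(norm (a *\<^sub>C x))\<^sup>2 = Re (cnj a * a * cinner x x)"
    by (simp only: Re_cinner_self[symmetric] cinner_scaleC_left cinner_scaleC_right mult.assoc
        mult.left_commute)
  also have "\<dots> = (cmod a)\<^sup>2 * (norm x)\<^sup>2"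
    by (simp add: cinner_self mult.commute[of "cnj a"] complex_mult_cnj cmod_power2 del: of_real_power)
  finally show ?thesis
    by (metis norm_ge_zero power_mult_distrib power2_eq_iff_nonneg mult_nonneg_nonneg)
qed

lemma cinner_minus_right:
  "cinner x (- y) = - cinner x (y::'a::complex_hilbert_space)"
  using cinner_scaleC_right[of x "-1" y] scaleR_scaleC[of "-1" y] by simp

lemma norm_add_sq:
  "(norm (x + y))\<^sup>2 = (norm x)\<^sup>2 + (norm y)\<^sup>2 + 2 * Re (cinner x (y::'a::complex_hilbert_space))"
proof -
  have "Re (cinner y x) = Re (cinner x y)"
    using cinner_commute[of y x] by simp
  then show ?thesis
    by (simp add: Re_cinner_self[symmetric] cinner_add_left cinner_add_right)
qed

lemma norm_diff_sq:
  "(norm (x - y))\<^sup>2 = (norm x)\<^sup>2 + (norm y)\<^sup>2 - 2 * Re (cinner x (y::'a::complex_hilbert_space))"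
  using norm_add_sq[of x "- y"] by (simp add: cinner_minus_right)

lemma cinner_Cauchy_Schwarz:
  "cmod (cinner x y) \<le> norm x * norm (y::'a::complex_hilbert_space)"
proof (cases "y = 0")
  case True
  then show ?thesis
    using cinner_scaleC_right[of x 0 0] by simp
next
  case False
  then have ny: "norm y > 0" by simp
  \<comment> \<open>With this coefficient, \<open>?t\<close> times \<open>y\<close> is the
    orthogonal projection of \<open>x\<close> onto the line of \<open>y\<close>.\<close>
  let ?t = "cinner y x / of_real ((norm y)\<^sup>2)"
  have "0 \<le> (norm (x - ?t *\<^sub>C y))\<^sup>2" by simp
  also have "\<dots> = (norm x)\<^sup>2 + (cmod (cinner x y) / norm y)\<^sup>2 - 2 * Re (?t * cinner x y)"
    unfolding norm_diff_sq using ny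
    by (simp add: cinner_scaleC_right norm_divide norm_mult cinner_commute[of y x] power2_eq_square
        field_simps del: of_real_mult)
  also have "?t * cinner x y = of_real ((cmod (cinner x y) / norm y)\<^sup>2)"
    by (simp add: cinner_commute[of y x] power_divide complex_norm_square mult.commute
        del: of_real_power)
  finally have "(cmod (cinner x y) / norm y)\<^sup>2 \<le> (norm x)\<^sup>2" by simp
  then have "cmod (cinner x y) / norm y \<le> norm x"
    by (rule power2_le_imp_le) simp
  then show ?thesis
    using ny by (simp add: field_simps)
qed

lemma bounded_bilinear_cinner:
  "bounded_bilinear (cinner :: 'a::complex_hilbert_space \<Rightarrow> 'a \<Rightarrow> complex)"
  by standard
    (auto simp: cinner_add_left cinner_add_right scaleR_scaleC[of _ "_ :: 'a"] cinner_scaleC_left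
      cinner_scaleC_right scaleR_conv_of_real intro!: exI[of _ 1] cinner_Cauchy_Schwarz)

interpretation cinner: bounded_bilinear
  "cinner :: 'a::complex_hilbert_space \<Rightarrow> 'a \<Rightarrow> complex"
  by (rule bounded_bilinear_cinner)

lemma bounded_bilinear_scaleC:
  "bounded_bilinear (scaleC :: complex \<Rightarrow> 'a::complex_hilbert_space \<Rightarrow> 'a)"
  by standard
    (auto simp: scaleC_add_right scaleC_add_left scaleC_scaleR scaleR_left_scaleC
      intro!: exI[of _ 1])

interpretation scaleC: bounded_bilinear
  "scaleC :: complex \<Rightarrow> 'a::complex_hilbert_space \<Rightarrow> 'a"
  by (rule bounded_bilinear_scaleC)

lemma cmod_cinner_commute: "cmod (cinner x y) = cmod (cinner y (x::'a::complex_hilbert_space))"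
  using cinner_commute[of x y] by simp

lemma cinner_eq_zero_commute:
  "cinner x y = 0 \<longleftrightarrow> cinner y (x::'a::complex_hilbert_space) = 0"
  using cinner_commute[of x y] by auto

lemma cinner_ext_right:
  assumes "\<And>z. cinner z x = cinner z (y::'a::complex_hilbert_space)"
  shows "x = y"
proof -
  have "cinner (x - y) (x - y) = 0"
    using assms[of "x - y"] by (simp add: cinner.diff_right)
  then show ?thesis by (simp add: cinner_self)
qed

section \<open>Infinite sums\<close>

text \<open>Cauchy criterion for unordered sums: the sums over two finite sets containing
  \<open>F0\<close> differ by sums over sets that avoid \<open>F0\<close>, hence by at most
  \<open>2 * e / 3\<close>. The index set may be uncountable, so completeness enters through Cauchy
  filters, not sequences.\<close>

lemma summable_on_vanishing_tails:
  fixes f :: "'b \<Rightarrow> 'a::banach"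
  assumes "\<And>\<epsilon>. \<epsilon> > 0 \<Longrightarrow>
    \<exists>F0. finite F0 \<and> F0 \<subseteq> A \<and> (\<forall>F. finite F \<and> F \<subseteq> A - F0 \<longrightarrow> norm (sum f F) \<le> \<epsilon>)"
  shows "f summable_on A"
proof -
  have "\<exists>P. eventually P (finite_subsets_at_top A) \<and>
      (\<forall>F F'. P F \<and> P F' \<longrightarrow> dist (sum f F) (sum f F') < e)" if "e > 0" for e
  proof -
    have "e / 3 > 0" using that by simp
    from assms[OF this] obtain F0 where F0: "finite F0" "F0 \<subseteq> A"
        "\<forall>F. finite F \<and> F \<subseteq> A - F0 \<longrightarrow> norm (sum f F) \<le> e / 3"
      by blast
    let ?P = "\<lambda>F. finite F \<and> F0 \<subseteq> F \<and> F \<subseteq> A"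
    have "eventually ?P (finite_subsets_at_top A)"
      unfolding eventually_finite_subsets_at_top using F0(1,2) by blast
    moreover have "dist (sum f F) (sum f F') < e" if F: "?P F" and F': "?P F'" for F F'
    proof -
      have "sum f F - sum f F' = sum f (F - F') - sum f (F' - F)"
        using F F' sum.Int_Diff[of F f F'] sum.Int_Diff[of F' f F]
        by (simp add: Int_commute)
      then have "dist (sum f F) (sum f F') \<le> norm (sum f (F - F')) + norm (sum f (F' - F))"
        by (simp add: dist_norm norm_triangle_ineq4)
      also have "\<dots> \<le> e / 3 + e / 3"
        using F F' by (intro add_mono F0(3)[rule_format]) auto
      also have "\<dots> < e" using \<open>e > 0\<close> by simp
      finally show ?thesis .
    qed
    ultimately show ?thesis
      by (intro exI[of _ ?P] conjI allI impI) simp_all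
  qed
  then have "cauchy_filter (filtermap (sum f) (finite_subsets_at_top A))"
    by (simp add: cauchy_filter_metric_filtermap)
  then have "convergent_filter (filtermap (sum f) (finite_subsets_at_top A))"
    by (rule cauchy_filter_convergent)
  then show ?thesis
    by (simp add: convergent_filter_iff summable_on_def has_sum_def filterlim_def)
qed

text \<open>Once \<open>F0\<close> carries all but \<epsilon> of the total, a disjoint finite set
  can add no more than \<epsilon>, since the sum over the union is still bounded by the
  total.\<close>

lemma nonneg_summable_vanishing_tails:
  fixes f :: "'b \<Rightarrow> real"
  assumes f: "f summable_on A" and pos: "\<And>x. x \<in> A \<Longrightarrow> f x \<ge> 0" and "\<epsilon> > 0"
  shows "\<exists>F0. finite F0 \<and> F0 \<subseteq> A \<and> (\<forall>F. finite F \<and> F \<subseteq> A - F0 \<longrightarrow> sum f F \<le> \<epsilon>)"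
proof -
  obtain F0 where F0: "finite F0" "F0 \<subseteq> A" "dist (sum f F0) (infsum f A) \<le> \<epsilon>"
    using infsum_finite_approximation[OF f \<open>\<epsilon> > 0\<close>] by auto
  have "sum f F \<le> \<epsilon>" if F: "finite F" "F \<subseteq> A - F0" for F
  proof -
    have "sum f F0 + sum f F = sum f (F0 \<union> F)"
      using F0 F by (subst sum.union_disjoint) auto
    also have "\<dots> \<le> infsum f A"
      using F0 F f pos by (intro finite_sum_le_infsum) auto
    finally show ?thesis using F0(3) by (simp add: dist_real_def)
  qed
  with F0(1,2) show ?thesis by blast
qed

lemma summable_imp_finite_ge:
  fixes f :: "'b \<Rightarrow> real"
  assumes f: "f summable_on A" and pos: "\<And>x. x \<in> A \<Longrightarrow> f x \<ge> 0" and "\<epsilon> > 0"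
  shows "finite {x\<in>A. f x \<ge> \<epsilon>}"
proof -
  from nonneg_summable_vanishing_tails[OF f pos half_gt_zero[OF \<open>\<epsilon> > 0\<close>]]
  obtain F0 where F0: "finite F0" "F0 \<subseteq> A"
      "\<forall>F. finite F \<and> F \<subseteq> A - F0 \<longrightarrow> sum f F \<le> \<epsilon> / 2"
    by blast
  have "{x\<in>A. f x \<ge> \<epsilon>} \<subseteq> F0"
  proof
    fix x assume x: "x \<in> {x\<in>A. f x \<ge> \<epsilon>}"
    show "x \<in> F0"
    proof (rule ccontr)
      assume "x \<notin> F0"
      then have "f x \<le> \<epsilon> / 2" using F0(3)[rule_format, of "{x}"] x by auto
      with x \<open>\<epsilon> > 0\<close> show False by auto
    qed
  qed
  then show ?thesis using F0(1) finite_subset by blast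
qed

text \<open>Dominated convergence for unordered sums. The Weierstrass test makes the finite partial
  sums converge uniformly in \<open>i\<close>, so the limit along \<open>F\<close> and the limit
  over finite subsets may be exchanged.\<close>

lemma tendsto_infsum_dominated:
  fixes f :: "'i \<Rightarrow> 'b \<Rightarrow> 'c::banach"
  assumes le: "\<And>i x. x \<in> A \<Longrightarrow> norm (f i x) \<le> M x" and M: "M summable_on A"
    and lim: "\<And>x. x \<in> A \<Longrightarrow> ((\<lambda>i. f i x) \<longlongrightarrow> g x) F"
  shows "((\<lambda>i. \<Sum>\<^sub>\<infinity>x\<in>A. f i x) \<longlongrightarrow> (\<Sum>\<^sub>\<infinity>x\<in>A. g x)) F"
proof (cases "F = bot")
  case False
  have gM: "norm (g x) \<le> M x" if "x \<in> A" for x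
  proof (rule tendsto_upperbound[OF tendsto_norm[OF lim[OF that]]])
    show "\<forall>\<^sub>F i in F. norm (f i x) \<le> M x" using le[OF that] by simp
  qed (rule False)
  have "g summable_on A"
    by (rule abs_summable_summable, rule Infinite_Sum.abs_summable_on_comparison_test'[OF M gM])
  then have L1: "(sum g \<longlongrightarrow> infsum g A) (finite_subsets_at_top A)"
    by (simp add: infsum_tendsto)
  have L2: "uniform_limit UNIV (\<lambda>X i. \<Sum>x\<in>X. f i x) (\<lambda>i. \<Sum>\<^sub>\<infinity>x\<in>A. f i x)
      (finite_subsets_at_top A)"
    by (rule Weierstrass_m_test_general[OF le M])
  have L3: "\<forall>\<^sub>F X in finite_subsets_at_top A. ((\<lambda>i. \<Sum>x\<in>X. f i x) \<longlongrightarrow> sum g X) F"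
    by (intro eventually_finite_subsets_at_top_weakI tendsto_sum) (use lim in auto)
  show ?thesis
    by (rule swap_uniform_limit'[OF L3 L1 L2]) auto
qed simp

section \<open>Orthonormal expansions\<close>

definition orthonormal :: "'a::complex_hilbert_space set \<Rightarrow> bool"
  where "orthonormal E \<longleftrightarrow>
    (\<forall>e\<in>E. norm e = 1) \<and> (\<forall>e\<in>E. \<forall>e'\<in>E. e \<noteq> e' \<longrightarrow> cinner e e' = 0)"

lemma is_onb_iff:
  "is_onb E \<longleftrightarrow> orthonormal E \<and> (\<forall>x. (\<forall>e\<in>E. cinner e x = 0) \<longrightarrow> x = 0)"
  by (simp add: is_onb_def orthonormal_def)

lemma onb_orthonormal: "is_onb E \<Longrightarrow> orthonormal E"
  by (simp add: is_onb_iff)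

lemma onb_norm: "is_onb E \<Longrightarrow> e \<in> E \<Longrightarrow> norm e = 1"
  by (simp add: is_onb_def)

lemma cinner_orthonormal:
  assumes "orthonormal E" "e \<in> E" "e' \<in> E"
  shows "cinner e e' = (if e = e' then 1 else 0)"
  using assms by (auto simp: orthonormal_def cinner_self)

lemma cinner_sum_orthonormal:
  assumes E: "orthonormal E" and F: "finite F" "F \<subseteq> E" and e: "e \<in> E"
  shows "cinner e (\<Sum>e'\<in>F. c e' *\<^sub>C e') = (if e \<in> F then c e else 0)"
proof -
  have "cinner e (\<Sum>e'\<in>F. c e' *\<^sub>C e') = (\<Sum>e'\<in>F. if e = e' then c e' else 0)"
    unfolding cinner.sum_right using F e
    by (intro sum.cong) (auto simp: cinner_scaleC_right cinner_orthonormal[OF E])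
  then show ?thesis using F by simp
qed

lemma norm_sum_orthonormal:
  assumes E: "orthonormal E" and F: "finite F" "F \<subseteq> E"
  shows "(norm (\<Sum>e\<in>F. c e *\<^sub>C e))\<^sup>2 = (\<Sum>e\<in>F. (cmod (c e))\<^sup>2)"
proof -
  have "cinner (\<Sum>e\<in>F. c e *\<^sub>C e) (\<Sum>e\<in>F. c e *\<^sub>C e) = (\<Sum>e\<in>F. cnj (c e) * c e)"
    using F by (subst cinner.sum_left)
      (auto simp: cinner_scaleC_left cinner_sum_orthonormal[OF E F] intro!: sum.cong)
  also have "\<dots> = of_real (\<Sum>e\<in>F. (cmod (c e))\<^sup>2)"
    by (simp add: complex_norm_square mult.commute del: of_real_power)
  finally show ?thesis
    by (simp add: cinner_self del: of_real_power of_real_sum)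
qed

lemma Bessel_finite:
  assumes E: "orthonormal E" and F: "finite F" "F \<subseteq> E"
  shows "(\<Sum>e\<in>F. (cmod (cinner e x))\<^sup>2) \<le> (norm x)\<^sup>2"
proof -
  let ?s = "\<Sum>e\<in>F. cinner e x *\<^sub>C e"
  have "cinner x ?s = (\<Sum>e\<in>F. of_real ((cmod (cinner e x))\<^sup>2))"
    unfolding cinner.sum_right cinner_scaleC_right
    by (intro sum.cong refl) (simp add: complex_norm_square cinner_commute[of x] del: of_real_power)
  then have "Re (cinner x ?s) = (\<Sum>e\<in>F. (cmod (cinner e x))\<^sup>2)"
    by (simp del: of_real_power)
  moreover have "0 \<le> (norm (x - ?s))\<^sup>2" by simp
  ultimately show ?thesis
    unfolding norm_diff_sq norm_sum_orthonormal[OF E F] by simp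
qed

text \<open>By Pythagoras the squared norm of a finite partial sum is the sum of the squared moduli
  of its coefficients, so small tails of the coefficients are small tails of the series.\<close>

lemma Riesz_Fischer:
  assumes E: "orthonormal E" and c: "(\<lambda>e. (cmod (c e))\<^sup>2) summable_on E"
  shows "(\<lambda>e. c e *\<^sub>C e) summable_on E"
proof (rule summable_on_vanishing_tails)
  fix \<epsilon> :: real assume \<epsilon>: "\<epsilon> > 0"
  then have "\<epsilon>\<^sup>2 > 0" by simp
  from nonneg_summable_vanishing_tails[OF c _ this]
  obtain F0 where F0: "finite F0" "F0 \<subseteq> E"
      "\<forall>F. finite F \<and> F \<subseteq> E - F0 \<longrightarrow> (\<Sum>e\<in>F. (cmod (c e))\<^sup>2) \<le> \<epsilon>\<^sup>2"
    by auto
  have "norm (\<Sum>e\<in>F. c e *\<^sub>C e) \<le> \<epsilon>" if "finite F \<and> F \<subseteq> E - F0" for F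
  proof (rule power2_le_imp_le)
    show "(norm (\<Sum>e\<in>F. c e *\<^sub>C e))\<^sup>2 \<le> \<epsilon>\<^sup>2"
      using that F0(3) by (subst norm_sum_orthonormal[OF E]) auto
  qed (use \<epsilon> in simp)
  then show "\<exists>F0. finite F0 \<and> F0 \<subseteq> E \<and>
      (\<forall>F. finite F \<and> F \<subseteq> E - F0 \<longrightarrow> norm (\<Sum>e\<in>F. c e *\<^sub>C e) \<le> \<epsilon>)"
    using F0(1,2) by blast
qed

lemma cinner_has_sum_orthonormal:
  assumes E: "orthonormal E" and x: "((\<lambda>e. c e *\<^sub>C e) has_sum x) E" and e: "e \<in> E"
  shows "cinner e x = c e"
proof -
  have "((\<lambda>e'. cinner e (c e' *\<^sub>C e')) has_sum cinner e x) E"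
    by (rule has_sum_bounded_linear[OF cinner.bounded_linear_right x])
  moreover have "((\<lambda>e'. cinner e (c e' *\<^sub>C e')) has_sum c e) E"
    by (rule has_sum_finite_neutralI[of "{e}"])
      (use e in \<open>auto simp: cinner_scaleC_right cinner_orthonormal[OF E]\<close>)
  ultimately show ?thesis by (rule has_sum_unique)
qed

lemma Bessel_summable:
  assumes E: "orthonormal E"
  shows "(\<lambda>e. (cmod (cinner e x))\<^sup>2) summable_on E"
proof (rule nonneg_bdd_above_summable_on)
  show "bdd_above (sum (\<lambda>e. (cmod (cinner e x))\<^sup>2) ` {F. F \<subseteq> E \<and> finite F})"
    using Bessel_finite[OF E] by (auto intro!: bdd_aboveI[of _ "(norm x)\<^sup>2"])
qed simp

lemma onb_ext:
  assumes "is_onb E" and "\<And>e. e \<in> E \<Longrightarrow> cinner e x = cinner e y"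
  shows "x = y"
proof -
  have "\<forall>e\<in>E. cinner e (x - y) = 0"
    by (simp add: cinner.diff_right assms(2))
  then have "x - y = 0"
    using assms(1) unfolding is_onb_iff by blast
  then show ?thesis by simp
qed

text \<open>The series converges by Bessel and Riesz-Fischer; its limit has the same coefficients as
  \<open>x\<close>, and maximality of \<open>E\<close> leaves no room for a difference.\<close>

lemma onb_expansion:
  assumes E: "is_onb E"
  shows "((\<lambda>e. cinner e x *\<^sub>C e) has_sum x) E"
proof -
  note oE = onb_orthonormal[OF E]
  obtain y where y: "((\<lambda>e. cinner e x *\<^sub>C e) has_sum y) E"
    using Riesz_Fischer[OF oE Bessel_summable[OF oE]] by (auto simp: summable_on_def)
  have "y = x"
    by (rule onb_ext[OF E]) (rule cinner_has_sum_orthonormal[OF oE y])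
  with y show ?thesis by simp
qed

lemma Parseval:
  assumes E: "is_onb E"
  shows "((\<lambda>e. cinner x e * cinner e y) has_sum cinner x y) E"
  using has_sum_bounded_linear[OF cinner.bounded_linear_right onb_expansion[OF E, of y], of x]
  by (simp add: cinner_scaleC_right mult.commute)

lemma Parseval_norm:
  assumes E: "is_onb E"
  shows "((\<lambda>e. (cmod (cinner e x))\<^sup>2) has_sum (norm x)\<^sup>2) E"
proof -
  have "((\<lambda>e. Re (cinner x e * cinner e x)) has_sum Re (cinner x x)) E"
    by (rule has_sum_Re[OF Parseval[OF E]])
  moreover have "Re (cinner x e * cinner e x) = (cmod (cinner e x))\<^sup>2" for e
    by (subst cinner_commute) (simp only: mult.commute[of "cnj _"] complex_norm_square[symmetric] Re_complex_of_real)
  ultimately show ?thesis by (simp add: Re_cinner_self)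
qed

section \<open>Bounded operators and adjoints\<close>

lemma bounded_clinearI:
  assumes "\<And>x y. T (x + y) = T x + T y" and "\<And>c x. T (c *\<^sub>C x) = c *\<^sub>C T x"
    and "\<And>x. norm (T x) \<le> norm x * K"
  shows "bounded_clinear (T :: 'a::complex_hilbert_space \<Rightarrow> 'a)"
  unfolding bounded_clinear_def using assms
  by (auto intro!: bounded_linear_intro[of _ K] simp: scaleR_scaleC)

lemma bounded_clinear_bounded_linear: "bounded_clinear T \<Longrightarrow> bounded_linear T"
  by (simp add: bounded_clinear_def)

lemma bounded_clinear_scaleC: "bounded_clinear T \<Longrightarrow> T (c *\<^sub>C x) = c *\<^sub>C T x"
  by (simp add: bounded_clinear_def)

lemma bounded_clinear_bound:
  assumes "bounded_clinear T"
  obtains K where "K > 0" "\<forall>x. norm (T x) \<le> K * norm x"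
  using bounded_linear.pos_bounded[OF bounded_clinear_bounded_linear[OF assms]]
  by (metis mult.commute)

lemma bounded_clinear_add: "bounded_clinear T \<Longrightarrow> T (x + y) = T x + T y"
  by (simp add: bounded_clinear_def linear_simps)

lemma bounded_clinear_diff: "bounded_clinear T \<Longrightarrow> T (x - y) = T x - T y"
  by (simp add: bounded_clinear_def linear_simps)

lemma bounded_clinear_zero: "bounded_clinear T \<Longrightarrow> T 0 = 0"
  by (simp add: bounded_clinear_def linear_simps)

lemma bounded_clinear_comp:
  assumes "bounded_clinear S" "bounded_clinear T"
  shows "bounded_clinear (\<lambda>x. S (T x))"
  using assms by (auto simp: bounded_clinear_def intro: bounded_linear_compose)

lemma bounded_clinear_plus:
  assumes "bounded_clinear S" "bounded_clinear T"
  shows "bounded_clinear (\<lambda>x. S x + T x)"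
  using assms by (auto simp: bounded_clinear_def scaleC_add_right intro: bounded_linear_add)

lemma bounded_clinear_minus:
  assumes "bounded_clinear S" "bounded_clinear T"
  shows "bounded_clinear (\<lambda>x. S x - T x)"
  using assms by (auto simp: bounded_clinear_def scaleC.diff_right intro: bounded_linear_sub)

lemma bounded_clinear_scale:
  assumes "bounded_clinear T"
  shows "bounded_clinear (\<lambda>x. c *\<^sub>C T x)"
  using assms bounded_linear_compose[OF scaleC.bounded_linear_right, of T c]
  by (auto simp: bounded_clinear_def scaleC_scaleC mult.commute)

lemma bounded_clinear_id: "bounded_clinear (\<lambda>x. x)"
  by (simp add: bounded_clinear_def)

lemma bounded_clinear_0: "bounded_clinear (\<lambda>x. 0)"
  by (simp add: bounded_clinear_def)

lemma bounded_clinear_power: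
  assumes "bounded_clinear T" shows "bounded_clinear (T ^^ n)"
proof (induction n)
  case 0
  then show ?case by (simp add: bounded_clinear_id id_def)
next
  case (Suc n)
  then show ?case using bounded_clinear_comp[OF assms Suc] by (simp add: o_def)
qed

lemma bounded_clinear_eq_on_onb:
  assumes E: "is_onb E" and S: "bounded_clinear S" and T: "bounded_clinear T"
    and eq: "\<And>e. e \<in> E \<Longrightarrow> S e = T e"
  shows "S = T"
proof
  fix x
  have "((\<lambda>e. S (cinner e x *\<^sub>C e)) has_sum S x) E"
    by (rule has_sum_bounded_linear[OF bounded_clinear_bounded_linear[OF S] onb_expansion[OF E]])
  moreover have "((\<lambda>e. T (cinner e x *\<^sub>C e)) has_sum T x) E"
    by (rule has_sum_bounded_linear[OF bounded_clinear_bounded_linear[OF T] onb_expansion[OF E]])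
  then have "((\<lambda>e. S (cinner e x *\<^sub>C e)) has_sum T x) E"
    by (rule has_sum_cong[THEN iffD1, rotated])
      (simp add: bounded_clinear_scaleC[OF S] bounded_clinear_scaleC[OF T] eq)
  ultimately show "S x = T x" by (rule has_sum_unique)
qed

text \<open>A relation instead of an adjoint function, so that no general existence theorem is
  called for: the adjoints that occur are constructed from Hilbert-Schmidt operators or come from
  self-adjointness.\<close>

definition adjoint_pair ::
    "('a::complex_hilbert_space \<Rightarrow> 'a) \<Rightarrow> ('a \<Rightarrow> 'a) \<Rightarrow> bool"
  where "adjoint_pair S T \<longleftrightarrow> (\<forall>x y. cinner (S x) y = cinner x (T y))"

lemma adjoint_pairD: "adjoint_pair S T \<Longrightarrow> cinner (S x) y = cinner x (T y)"
  by (simp add: adjoint_pair_def)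

lemma adjoint_pair_sym: "adjoint_pair S T \<Longrightarrow> adjoint_pair T S"
  unfolding adjoint_pair_def by (metis cinner_commute)

lemma adjoint_pair_comp:
  "adjoint_pair S T \<Longrightarrow> adjoint_pair S' T' \<Longrightarrow> adjoint_pair (\<lambda>x. S (S' x)) (\<lambda>x. T' (T x))"
  by (simp add: adjoint_pair_def)

text \<open>Linearity follows by testing against all vectors. For the bound, the squared norm of
  \<open>S x\<close> is \<open>cinner x (T (S x))\<close>, and one factor \<open>norm (S x)\<close>
  is divided out.\<close>

lemma adjoint_pair_bounded:
  assumes T: "bounded_clinear T" and ST: "adjoint_pair S T"
  shows "bounded_clinear S"
proof -
  have TS: "adjoint_pair T S" by (rule adjoint_pair_sym[OF ST])
  obtain K where K: "K > 0" "\<forall>x. norm (T x) \<le> K * norm x"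
    using bounded_clinear_bound[OF T] by blast
  show ?thesis
  proof (rule bounded_clinearI)
    show "S (x + y) = S x + S y" for x y
      by (rule cinner_ext_right) (simp add: adjoint_pairD[OF TS, symmetric] cinner_add_right)
    show "S (c *\<^sub>C x) = c *\<^sub>C S x" for c x
      by (rule cinner_ext_right) (simp add: adjoint_pairD[OF TS, symmetric] cinner_scaleC_right)
    show "norm (S x) \<le> norm x * K" for x
    proof (cases "S x = 0")
      case True
      then show ?thesis using K(1) by simp
    next
      case False
      have "(norm (S x))\<^sup>2 = Re (cinner x (T (S x)))"
        by (simp add: Re_cinner_self[symmetric] adjoint_pairD[OF ST])
      also have "\<dots> \<le> norm x * norm (T (S x))"
        using complex_Re_le_cmod cinner_Cauchy_Schwarz by (rule order_trans)
      also have "\<dots> \<le> norm x * (K * norm (S x))"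
        using K(2) by (intro mult_left_mono) auto
      finally have "norm (S x) * norm (S x) \<le> (norm x * K) * norm (S x)"
        by (simp add: power2_eq_square mult_ac)
      with False show ?thesis by simp
    qed
  qed
qed

lemma self_adjoint_adjoint_pair: "self_adjoint T \<Longrightarrow> adjoint_pair T T"
  by (simp add: self_adjoint_def adjoint_pair_def)

lemma self_adjoint_bounded_clinear: "self_adjoint T \<Longrightarrow> bounded_clinear T"
  by (simp add: self_adjoint_def)

lemma self_adjointI: "bounded_clinear T \<Longrightarrow> adjoint_pair T T \<Longrightarrow> self_adjoint T"
  by (simp add: self_adjoint_def adjoint_pair_def)

lemma op_adjoint_self_adjoint:
  assumes "self_adjoint T" shows "op_adjoint T = T"
  unfolding op_adjoint_def
proof (rule the_equality)
  show "bounded_clinear T \<and> (\<forall>x y. cinner (T x) y = cinner x (T y))"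
    using assms by (simp add: self_adjoint_def)
  fix S assume S: "bounded_clinear S \<and> (\<forall>x y. cinner (S x) y = cinner x (T y))"
  show "S = T"
  proof
    fix x
    have "cinner z (S x) = cinner z (T x)" for z
      using S assms by (metis cinner_commute self_adjoint_def)
    then show "S x = T x" by (rule cinner_ext_right)
  qed
qed

text \<open>Polarization: since the quadratic form is real at \<open>x + y\<close>, the imaginary
  parts of the two mixed terms cancel. Replacing \<open>y\<close> by \<i> times \<open>y\<close>
  gives the matching statement for the real parts.\<close>

lemma positive_op_self_adjoint:
  assumes T: "positive_op T" shows "self_adjoint T"
proof -
  have bT: "bounded_clinear T" and real: "\<And>x. Im (cinner x (T x)) = 0"
    using T by (auto simp: positive_op_def less_eq_complex_def)
  have "cinner (T x) y = cinner x (T y)" for x y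
  proof -
    have 1: "Im (cinner x (T y)) = - Im (cinner y (T x))" for x y
      using real[of "x + y"] by (simp add: bounded_clinear_add[OF bT] cinner_add_left
          cinner_add_right real)
    have "Re (cinner x (T y)) = Re (cinner y (T x))"
      using 1[of x "\<i> *\<^sub>C y"] by (simp add: bounded_clinear_scaleC[OF bT] cinner_scaleC_right
          cinner_scaleC_left)
    with 1[of x y] have "cinner x (T y) = cnj (cinner y (T x))"
      by (simp add: complex_eq_iff)
    then show ?thesis by (simp add: cinner_commute[of "T x"])
  qed
  then show ?thesis using bT by (simp add: self_adjoint_def)
qed

section \<open>Hilbert-Schmidt operators\<close>

lemma hilbert_schmidt_bounded_clinear: "hilbert_schmidt T \<Longrightarrow> bounded_clinear T"
  by (simp add: hilbert_schmidt_def)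

text \<open>The adjoint is built from its coefficients \<open>cinner (T e) y\<close>, which are
  square summable because they are bounded by \<open>norm (T e) * norm y\<close>.\<close>

lemma exists_adjoint_of_summable:
  assumes E: "is_onb E" and T: "bounded_clinear T" and sq: "(\<lambda>e. (norm (T e))\<^sup>2) summable_on E"
  shows "\<exists>S. adjoint_pair S T"
proof -
  have "(\<lambda>e. cinner (T e) y *\<^sub>C e) summable_on E" for y
  proof (rule Riesz_Fischer[OF onb_orthonormal[OF E]])
    show "(\<lambda>e. (cmod (cinner (T e) y))\<^sup>2) summable_on E"
    proof (rule summable_on_comparison_test[OF summable_on_cmult_left[OF sq, of "(norm y)\<^sup>2"]])
      show "(cmod (cinner (T e) y))\<^sup>2 \<le> (norm (T e))\<^sup>2 * (norm y)\<^sup>2" for e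
        using power_mono[OF cinner_Cauchy_Schwarz, of "T e" y 2] by (simp add: power_mult_distrib)
    qed simp
  qed
  then have "\<forall>y. \<exists>z. ((\<lambda>e. cinner (T e) y *\<^sub>C e) has_sum z) E"
    by (simp add: summable_on_def)
  then obtain S where S: "\<And>y. ((\<lambda>e. cinner (T e) y *\<^sub>C e) has_sum S y) E"
    by metis
  have "cinner (S y) x = cinner y (T x)" for x y
  proof -
    have "((\<lambda>e. cinner (cinner (T e) y *\<^sub>C e) x) has_sum cinner (S y) x) E"
      by (rule has_sum_bounded_linear[OF cinner.bounded_linear_left S])
    then have "((\<lambda>e. cinner y (T e) * cinner e x) has_sum cinner (S y) x) E"
      by (simp add: cinner_scaleC_left cinner_commute[of y "T _", symmetric])
    moreover have "((\<lambda>e. cinner y (T (cinner e x *\<^sub>C e))) has_sum cinner y (T x)) E"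
      by (rule has_sum_bounded_linear[OF bounded_linear_compose[OF cinner.bounded_linear_right
              bounded_clinear_bounded_linear[OF T]] onb_expansion[OF E]])
    then have "((\<lambda>e. cinner y (T e) * cinner e x) has_sum cinner y (T x)) E"
      by (simp add: bounded_clinear_scaleC[OF T] cinner_scaleC_right mult.commute)
    ultimately show ?thesis by (rule has_sum_unique)
  qed
  then show ?thesis by (auto simp: adjoint_pair_def)
qed

text \<open>The matrix of squared moduli is nonnegative, so it may be summed in either order. By
  Parseval its sums in one direction are the squared norms of \<open>T e\<close> and in the other
  those of \<open>S e'\<close>. Allowing two bases is what later yields independence of the
  basis.\<close>

lemma
  assumes E: "is_onb E" and E': "is_onb E'" and ST: "adjoint_pair S T"
    and sq: "(\<lambda>e. (norm (T e))\<^sup>2) summable_on E"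
  shows matrix_square_summable: "(\<lambda>(e, e'). (cmod (cinner e' (T e)))\<^sup>2) summable_on E \<times> E'"
    and adjoint_square_has_sum:
      "((\<lambda>e'. (norm (S e'))\<^sup>2) has_sum (\<Sum>\<^sub>\<infinity>e\<in>E. (norm (T e))\<^sup>2)) E'"
proof -
  let ?f = "\<lambda>(e, e'). (cmod (cinner e' (T e)))\<^sup>2"
  have row: "((\<lambda>e'. ?f (e, e')) has_sum (norm (T e))\<^sup>2) E'" for e
    using Parseval_norm[OF E'] by simp
  show *: "?f summable_on E \<times> E'"
    by (rule summable_on_SigmaI[OF row sq]) simp
  have "(?f has_sum (\<Sum>\<^sub>\<infinity>e\<in>E. (norm (T e))\<^sup>2)) (E \<times> E')"
    by (rule has_sum_SigmaI[OF row has_sum_infsum[OF sq] *])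
  then have "((\<lambda>(e', e). ?f (e, e')) has_sum (\<Sum>\<^sub>\<infinity>e\<in>E. (norm (T e))\<^sup>2)) (E' \<times> E)"
    by (subst has_sum_swap) simp
  moreover have "((\<lambda>e. (\<lambda>(e', e). ?f (e, e')) (e', e)) has_sum (norm (S e'))\<^sup>2) E" for e'
    using Parseval_norm[OF E, of "S e'"]
    by (simp add: adjoint_pairD[OF ST, symmetric] cmod_cinner_commute[of "S e'"])
  ultimately show "((\<lambda>e'. (norm (S e'))\<^sup>2) has_sum (\<Sum>\<^sub>\<infinity>e\<in>E. (norm (T e))\<^sup>2)) E'"
    by (rule has_sum_SigmaD)
qed

lemma hilbert_schmidt_adjoint:
  assumes "hilbert_schmidt T"
  obtains S where "adjoint_pair S T" "hilbert_schmidt S"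
proof -
  obtain E where E: "is_onb E" and sq: "(\<lambda>e. (norm (T e))\<^sup>2) summable_on E"
    and T: "bounded_clinear T"
    using assms by (auto simp: hilbert_schmidt_def)
  obtain S where S: "adjoint_pair S T"
    using exists_adjoint_of_summable[OF E T sq] by blast
  then have "hilbert_schmidt S"
    using adjoint_square_has_sum[OF E E S sq] adjoint_pair_bounded[OF T S] E
    by (auto simp: hilbert_schmidt_def summable_on_def)
  with S show ?thesis by (rule that)
qed

text \<open>The definition grants one basis only. Passing to the adjoint and back moves the sum from
  that basis to an arbitrary one.\<close>

lemma hilbert_schmidt_summable:
  assumes T: "hilbert_schmidt T" and E: "is_onb E"
  shows "(\<lambda>e. (norm (T e))\<^sup>2) summable_on E"
proof -
  obtain S where S: "adjoint_pair S T" "hilbert_schmidt S"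
    using hilbert_schmidt_adjoint[OF T] by blast
  then obtain E' where E': "is_onb E'" "(\<lambda>e. (norm (S e))\<^sup>2) summable_on E'"
    by (auto simp: hilbert_schmidt_def)
  from adjoint_square_has_sum[OF E'(1) E adjoint_pair_sym[OF S(1)] E'(2)]
  show ?thesis by (auto simp: summable_on_def)
qed

lemma hilbert_schmidt_comp_left:
  assumes T: "hilbert_schmidt T" and X: "bounded_clinear X"
  shows "hilbert_schmidt (\<lambda>x. X (T x))"
proof -
  obtain E where E: "is_onb E" and sq: "(\<lambda>e. (norm (T e))\<^sup>2) summable_on E"
    using T by (auto simp: hilbert_schmidt_def)
  obtain K where K: "\<forall>x. norm (X x) \<le> K * norm x"
    using bounded_clinear_bound[OF X] by blast
  have "(\<lambda>e. (norm (X (T e)))\<^sup>2) summable_on E"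
  proof (rule summable_on_comparison_test[OF summable_on_cmult_right[OF sq, of "K\<^sup>2"]])
    show "(norm (X (T e)))\<^sup>2 \<le> K\<^sup>2 * (norm (T e))\<^sup>2" for e
      using power_mono[OF K[rule_format, of "T e"], of 2] by (simp add: power_mult_distrib)
  qed simp
  with E T X show ?thesis
    by (auto simp: hilbert_schmidt_def intro: bounded_clinear_comp)
qed

text \<open>The adjoint of \<open>T X\<close> is \<open>X' S\<close>, to which composition from the
  left applies.\<close>

lemma hilbert_schmidt_comp_right:
  fixes T :: "'a::complex_hilbert_space \<Rightarrow> 'a"
  assumes T: "hilbert_schmidt T" and X: "bounded_clinear X" and X': "adjoint_pair X' X"
  shows "hilbert_schmidt (\<lambda>x. T (X x))"
proof -
  obtain S where S: "adjoint_pair S T" "hilbert_schmidt S"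
    using hilbert_schmidt_adjoint[OF T] by blast
  have XS: "hilbert_schmidt (\<lambda>x. X' (S x))"
    by (rule hilbert_schmidt_comp_left[OF S(2) adjoint_pair_bounded[OF X X']])
  have adj: "adjoint_pair (\<lambda>x. T (X x)) (\<lambda>x. X' (S x))"
    using adjoint_pair_comp[OF X' S(1)] by (rule adjoint_pair_sym)
  obtain E :: "'a set" where E: "is_onb E" using T by (auto simp: hilbert_schmidt_def)
  show ?thesis
    unfolding hilbert_schmidt_def
    using E adjoint_square_has_sum[OF E E adj hilbert_schmidt_summable[OF XS E]]
      bounded_clinear_comp[OF hilbert_schmidt_bounded_clinear[OF T] X]
    by (auto simp: summable_on_def)
qed

section \<open>Traces of sums of products of Hilbert-Schmidt operators\<close>

text \<open>Both matrices are square summable, so the double sum of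
  \<open>cinner e (R e') * cinner e' (S e)\<close> converges absolutely; summing first over
  \<open>e'\<close> or first over \<open>e\<close> gives the two diagonals. With different bases the
  same fact covers both cyclicity and independence of the basis.\<close>

lemma trace_swap_has_sum:
  assumes R: "hilbert_schmidt R" and S: "hilbert_schmidt S" and E: "is_onb E" and E': "is_onb E'"
  shows "\<exists>s. ((\<lambda>e. cinner e (R (S e))) has_sum s) E \<and> ((\<lambda>e. cinner e (S (R e))) has_sum s) E'"
proof -
  obtain R' where R': "adjoint_pair R' R" using hilbert_schmidt_adjoint[OF R] by blast
  obtain S' where S': "adjoint_pair S' S" using hilbert_schmidt_adjoint[OF S] by blast
  let ?f = "\<lambda>(e, e'). cinner e (R e') * cinner e' (S e)"
  have 1: "(\<lambda>(e, e'). (cmod (cinner e (R e')))\<^sup>2) summable_on E \<times> E'"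
    using matrix_square_summable[OF E' E R' hilbert_schmidt_summable[OF R E']]
    by (subst summable_on_swap) simp
  have 2: "(\<lambda>(e, e'). (cmod (cinner e' (S e)))\<^sup>2) summable_on E \<times> E'"
    by (rule matrix_square_summable[OF E E' S' hilbert_schmidt_summable[OF S E]])
  have "?f summable_on E \<times> E'"
  proof (rule abs_summable_summable,
      rule Infinite_Sum.abs_summable_on_comparison_test'[OF summable_on_add[OF 1 2]])
    fix p
    have "u * v \<le> u\<^sup>2 + v\<^sup>2" for u v :: real
      using sum_squares_bound[of u v] zero_le_power2[of u] zero_le_power2[of v] by linarith
    then show "norm (?f p) \<le> (case p of (e, e') \<Rightarrow> (cmod (cinner e (R e')))\<^sup>2) +
        (case p of (e, e') \<Rightarrow> (cmod (cinner e' (S e)))\<^sup>2)"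
      by (auto simp: norm_mult split: prod.split)
  qed
  then obtain s where s: "(?f has_sum s) (E \<times> E')" by (auto simp: summable_on_def)
  have "((\<lambda>e'. ?f (e, e')) has_sum cinner e (R (S e))) E'" for e
    using Parseval[OF E', of "R' e" "S e"] by (simp add: adjoint_pairD[OF R'])
  then have "((\<lambda>e. cinner e (R (S e))) has_sum s) E"
    by (rule has_sum_SigmaD[OF s])
  moreover
  have s': "((\<lambda>(e', e). ?f (e, e')) has_sum s) (E' \<times> E)"
    using s by (subst has_sum_swap) simp
  have "((\<lambda>e. (\<lambda>(e', e). ?f (e, e')) (e', e)) has_sum cinner e' (S (R e'))) E" for e'
    using Parseval[OF E, of "S' e'" "R e'"] by (simp add: adjoint_pairD[OF S'] mult.commute)
  then have "((\<lambda>e. cinner e (S (R e))) has_sum s) E'"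
    by (rule has_sum_SigmaD[OF s'])
  ultimately show ?thesis by blast
qed

text \<open>Working with finite sums of products makes closure under addition immediate; a single
  product would require the polar decomposition.\<close>

inductive hs_product_sum :: "('a::complex_hilbert_space \<Rightarrow> 'a) \<Rightarrow> bool" where
  hs_prod: "hilbert_schmidt R \<Longrightarrow> hilbert_schmidt S \<Longrightarrow> hs_product_sum (\<lambda>x. R (S x))"
| hs_add: "hs_product_sum T \<Longrightarrow> hs_product_sum T' \<Longrightarrow> hs_product_sum (\<lambda>x. T x + T' x)"

lemma trace_class_hs_product_sum: "trace_class T \<Longrightarrow> hs_product_sum T"
  by (auto simp: trace_class_def o_def intro: hs_prod)

lemma hs_product_sum_comp_left:
  "hs_product_sum T \<Longrightarrow> bounded_clinear X \<Longrightarrow> hs_product_sum (\<lambda>x. X (T x))"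
proof (induction rule: hs_product_sum.induct)
  case (hs_prod R S)
  then show ?case
    using hs_product_sum.hs_prod[OF hilbert_schmidt_comp_left[OF hs_prod(1,3)] hs_prod(2)] by simp
next
  case (hs_add T T')
  then show ?case
    using hs_product_sum.hs_add[of "\<lambda>x. X (T x)" "\<lambda>x. X (T' x)"]
    by (simp add: bounded_clinear_add)
qed

lemma hs_product_sum_comp_right:
  "hs_product_sum T \<Longrightarrow> bounded_clinear X \<Longrightarrow> adjoint_pair X' X \<Longrightarrow> hs_product_sum (\<lambda>x. T (X x))"
proof (induction rule: hs_product_sum.induct)
  case (hs_prod R S)
  then show ?case
    using hs_product_sum.hs_prod[of R "\<lambda>x. S (X x)"] hilbert_schmidt_comp_right by blast
next
  case (hs_add T T')
  then show ?case
    using hs_product_sum.hs_add[of "\<lambda>x. T (X x)" "\<lambda>x. T' (X x)"] by simp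
qed

text \<open>Any Hilbert-Schmidt factor comes with a basis, so the choice inside
  \<open>op_trace\<close> is a genuine one.\<close>

lemma hs_product_sum_onb:
  assumes "hs_product_sum (T :: 'a::complex_hilbert_space \<Rightarrow> 'a)"
  shows "is_onb (SOME E :: 'a set. is_onb E)"
  using assms
proof (induction rule: hs_product_sum.induct)
  case (hs_prod R S)
  then show ?case by (auto simp: hilbert_schmidt_def intro: someI)
qed

text \<open>For one product, comparing with \<open>S R\<close> in a fixed basis \<open>E0\<close>
  shows that the sum over \<open>E\<close> does not depend on \<open>E\<close>. The induction
  carries one value \<open>s\<close> for all bases, a form that survives addition.\<close>

lemma hs_product_sum_has_trace:
  fixes T :: "'a::complex_hilbert_space \<Rightarrow> 'a"
  assumes "hs_product_sum T" "is_onb E"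
  shows "((\<lambda>e. cinner e (T e)) has_sum op_trace T) E"
proof -
  have "\<exists>s. \<forall>E. is_onb E \<longrightarrow> ((\<lambda>e. cinner e (T e)) has_sum s) E"
    using assms(1)
  proof (induction rule: hs_product_sum.induct)
    case (hs_prod R S)
    then obtain E0 :: "'a set" where E0: "is_onb E0" by (auto simp: hilbert_schmidt_def)
    have "((\<lambda>e. cinner e (R (S e))) has_sum (\<Sum>\<^sub>\<infinity>e\<in>E0. cinner e (S (R e)))) E"
      if "is_onb E" for E
      using trace_swap_has_sum[OF hs_prod that E0] by (auto simp: infsumI)
    then show ?case by blast
  next
    case (hs_add T T')
    then obtain s s' where
      "\<forall>E. is_onb E \<longrightarrow> ((\<lambda>e. cinner e (T e)) has_sum s) E"
      "\<forall>E. is_onb E \<longrightarrow> ((\<lambda>e. cinner e (T' e)) has_sum s') E" by blast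
    then have "\<forall>E. is_onb E \<longrightarrow> ((\<lambda>e. cinner e (T e + T' e)) has_sum (s + s')) E"
      by (auto simp: cinner_add_right intro: has_sum_add)
    then show ?case by blast
  qed
  then obtain s where s: "\<And>E. is_onb E \<Longrightarrow> ((\<lambda>e. cinner e (T e)) has_sum s) E" by blast
  then have "op_trace T = s"
    unfolding op_trace_def using hs_product_sum_onb[OF assms(1)] by (simp add: infsumI)
  with s assms(2) show ?thesis by simp
qed

lemma op_trace_add:
  assumes "hs_product_sum T" "hs_product_sum T'"
  shows "op_trace (\<lambda>x. T x + T' x) = op_trace T + op_trace T'"
proof -
  note E = hs_product_sum_onb[OF assms(1)]
  have "((\<lambda>e. cinner e (T e + T' e)) has_sum op_trace T + op_trace T') (SOME E. is_onb E)"
    unfolding cinner_add_right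
    by (intro has_sum_add hs_product_sum_has_trace assms E)
  then show ?thesis
    using hs_product_sum_has_trace[OF hs_add[OF assms] E] by (simp add: has_sum_unique)
qed

text \<open>Two swaps of Hilbert-Schmidt factors: \<open>(X R) S\<close> has the trace of
  \<open>S (X R)\<close>, which read as \<open>(S X) R\<close> has the trace of
  \<open>R (S X)\<close>. In this way a merely bounded \<open>X\<close> can be moved around.\<close>

lemma op_trace_cyclic:
  assumes "hs_product_sum T" "bounded_clinear X" "adjoint_pair X' X"
  shows "op_trace (\<lambda>x. X (T x)) = op_trace (\<lambda>x. T (X x))"
  using assms
proof (induction rule: hs_product_sum.induct)
  case (hs_prod R S)
  have XR: "hilbert_schmidt (\<lambda>x. X (R x))" and SX: "hilbert_schmidt (\<lambda>x. S (X x))"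
    using hs_prod by (blast intro: hilbert_schmidt_comp_left hilbert_schmidt_comp_right)+
  have p1: "hs_product_sum (\<lambda>x. X (R (S x)))" and p2: "hs_product_sum (\<lambda>x. R (S (X x)))"
    using hs_product_sum.hs_prod[OF XR hs_prod(2)] hs_product_sum.hs_prod[OF hs_prod(1) SX] by simp_all
  note E = hs_product_sum_onb[OF p1]
  from trace_swap_has_sum[OF XR hs_prod(2) E E]
  have "op_trace (\<lambda>x. X (R (S x))) = (\<Sum>\<^sub>\<infinity>e\<in>(SOME E. is_onb E). cinner e (S (X (R e))))"
    using hs_product_sum_has_trace[OF p1 E] by (metis has_sum_unique infsumI)
  also from trace_swap_has_sum[OF hs_prod(1) SX E E]
  have "\<dots> = op_trace (\<lambda>x. R (S (X x)))"
    using hs_product_sum_has_trace[OF p2 E] by (metis has_sum_unique infsumI)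
  finally show ?case .
next
  case (hs_add T T')
  then show ?case
    by (simp add: bounded_clinear_add op_trace_add hs_product_sum_comp_left
        hs_product_sum_comp_right[OF _ hs_add(5,6)])
qed

section \<open>Uniform tail estimates and strong limits under the trace\<close>

lemma norm_has_sum_le:
  fixes f :: "'b \<Rightarrow> 'a::real_normed_vector"
  assumes "(f has_sum s) A" and "\<And>F. finite F \<Longrightarrow> F \<subseteq> A \<Longrightarrow> norm (sum f F) \<le> \<epsilon>"
  shows "norm s \<le> \<epsilon>"
proof (rule tendsto_upperbound)
  show "((\<lambda>F. norm (sum f F)) \<longlongrightarrow> norm s) (finite_subsets_at_top A)"
    using assms(1) unfolding has_sum_def by (rule tendsto_norm)
  show "\<forall>\<^sub>F F in finite_subsets_at_top A. norm (sum f F) \<le> \<epsilon>"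
    by (rule eventually_finite_subsets_at_top_weakI) (rule assms(2))
qed simp

lemma sum_mult_le_sqrt:
  fixes a b :: "'b \<Rightarrow> real"
  assumes "(\<Sum>i\<in>F. (a i)\<^sup>2) \<le> A\<^sup>2" "(\<Sum>i\<in>F. (b i)\<^sup>2) \<le> B\<^sup>2" "A \<ge> 0" "B \<ge> 0"
  shows "(\<Sum>i\<in>F. \<bar>a i * b i\<bar>) \<le> A * B"
proof -
  have "(\<Sum>i\<in>F. \<bar>a i * b i\<bar>) \<le> L2_set a F * L2_set b F"
    using L2_set_mult_ineq[of a b F] by (simp add: abs_mult)
  also have "\<dots> \<le> A * B"
    using assms by (intro mult_mono) (auto simp: L2_set_def intro: real_le_lsqrt sum_nonneg)
  finally show ?thesis .
qed

definition self_adjoint_contraction :: "('a::complex_hilbert_space \<Rightarrow> 'a) \<Rightarrow> bool"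
  where "self_adjoint_contraction U \<longleftrightarrow> self_adjoint U \<and> (\<forall>x. norm (U x) \<le> norm x)"

text \<open>Cauchy-Schwarz separates \<open>R' e\<close> from \<open>S (U e)\<close>. The first
  factor has small tails; the second is bounded independently of \<open>U\<close>, since the adjoint
  of \<open>S U\<close> is \<open>U S'\<close> and the contraction \<open>U\<close> does not
  increase the Hilbert-Schmidt norm of \<open>S'\<close>.\<close>

lemma hs_product_sum_uniform_tails:
  assumes "hs_product_sum T" "is_onb E" "\<epsilon> > 0"
  shows "\<exists>F0. finite F0 \<and> F0 \<subseteq> E \<and>
    (\<forall>U F. self_adjoint_contraction U \<longrightarrow> finite F \<longrightarrow> F \<subseteq> E - F0 \<longrightarrow> (\<Sum>e\<in>F. cmod (cinner e (T (U e)))) \<le> \<epsilon>)"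
  using assms(1,3)
proof (induction arbitrary: \<epsilon> rule: hs_product_sum.induct)
  case (hs_prod R S)
  note E = assms(2)
  obtain R' where R': "adjoint_pair R' R" "hilbert_schmidt R'"
    using hilbert_schmidt_adjoint[OF hs_prod(1)] by blast
  obtain S' where S': "adjoint_pair S' S" "hilbert_schmidt S'"
    using hilbert_schmidt_adjoint[OF hs_prod(2)] by blast
  note sqS = hilbert_schmidt_summable[OF S'(2) E]
  define B where "B = sqrt (\<Sum>\<^sub>\<infinity>e\<in>E. (norm (S' e))\<^sup>2)"
  have B: "B \<ge> 0" "B\<^sup>2 = (\<Sum>\<^sub>\<infinity>e\<in>E. (norm (S' e))\<^sup>2)"
    unfolding B_def by (simp_all add: infsum_nonneg)
  have SU: "(\<Sum>e\<in>F. (norm (S (U e)))\<^sup>2) \<le> B\<^sup>2"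
    if "self_adjoint_contraction U" and F: "finite F" "F \<subseteq> E" for U F
  proof -
    have U: "bounded_clinear U" "adjoint_pair U U" "\<forall>x. norm (U x) \<le> norm x"
      using that(1) by (simp_all add: self_adjoint_contraction_def self_adjoint_bounded_clinear
          self_adjoint_adjoint_pair)
    have US: "hilbert_schmidt (\<lambda>x. U (S' x))"
      by (rule hilbert_schmidt_comp_left[OF S'(2) U(1)])
    have "adjoint_pair (\<lambda>x. S (U x)) (\<lambda>x. U (S' x))"
      using adjoint_pair_comp[OF U(2) S'(1)] by (rule adjoint_pair_sym)
    from adjoint_square_has_sum[OF E E this hilbert_schmidt_summable[OF US E]]
    have "(\<Sum>e\<in>F. (norm (S (U e)))\<^sup>2) \<le> (\<Sum>\<^sub>\<infinity>e\<in>E. (norm (U (S' e)))\<^sup>2)"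
      by (rule finite_sum_le_has_sum) (use F in auto)
    also have "\<dots> \<le> B\<^sup>2"
      unfolding B(2)
      by (rule infsum_mono[OF hilbert_schmidt_summable[OF US E] sqS]) (use U(3) in \<open>simp add: power_mono\<close>)
    finally show ?thesis .
  qed
  \<comment> \<open>Adding 1 avoids a division by zero when \<open>B = 0\<close>.\<close>
  define \<delta> where "\<delta> = \<epsilon> / (B + 1)"
  have \<delta>: "\<delta> > 0" "\<delta> * B \<le> \<epsilon>"
    using B(1) hs_prod(3) by (auto simp: \<delta>_def field_simps)
  then have "\<delta>\<^sup>2 > 0" by simp
  from nonneg_summable_vanishing_tails[OF hilbert_schmidt_summable[OF R'(2) E] _ this]
  obtain F0 where F0: "finite F0" "F0 \<subseteq> E"
      "\<forall>F. finite F \<and> F \<subseteq> E - F0 \<longrightarrow> (\<Sum>e\<in>F. (norm (R' e))\<^sup>2) \<le> \<delta>\<^sup>2"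
    by auto
  have "(\<Sum>e\<in>F. cmod (cinner e (R (S (U e))))) \<le> \<epsilon>"
    if U: "self_adjoint_contraction U"
      and F: "finite F" "F \<subseteq> E - F0" for U F
  proof -
    have "(\<Sum>e\<in>F. cmod (cinner e (R (S (U e))))) \<le> (\<Sum>e\<in>F. \<bar>norm (R' e) * norm (S (U e))\<bar>)"
      by (intro sum_mono) (simp add: adjoint_pairD[OF R'(1), symmetric] cinner_Cauchy_Schwarz)
    also have "\<dots> \<le> \<delta> * B"
      using F F0(3) \<delta>(1) B(1) SU[OF U F(1)] by (intro sum_mult_le_sqrt) auto
    finally show ?thesis using \<delta>(2) by linarith
  qed
  with F0(1,2) show ?case by blast
next
  case (hs_add T T')
  from hs_add.prems have h: "\<epsilon> / 2 > 0" by simp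
  from hs_add.IH(1)[OF h] obtain F1 where F1: "finite F1" "F1 \<subseteq> E"
    "\<forall>U F. self_adjoint_contraction U \<longrightarrow> finite F \<longrightarrow> F \<subseteq> E - F1 \<longrightarrow> (\<Sum>e\<in>F. cmod (cinner e (T (U e)))) \<le> \<epsilon> / 2" by blast
  from hs_add.IH(2)[OF h] obtain F2 where F2: "finite F2" "F2 \<subseteq> E"
    "\<forall>U F. self_adjoint_contraction U \<longrightarrow> finite F \<longrightarrow> F \<subseteq> E - F2 \<longrightarrow> (\<Sum>e\<in>F. cmod (cinner e (T' (U e)))) \<le> \<epsilon> / 2" by blast
  have "(\<Sum>e\<in>F. cmod (cinner e (T (U e) + T' (U e)))) \<le> \<epsilon>"
    if U: "self_adjoint_contraction U"
      and F: "finite F" "F \<subseteq> E - (F1 \<union> F2)" for U F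
  proof -
    have "(\<Sum>e\<in>F. cmod (cinner e (T (U e) + T' (U e)))) \<le>
        (\<Sum>e\<in>F. cmod (cinner e (T (U e)))) + (\<Sum>e\<in>F. cmod (cinner e (T' (U e))))"
      unfolding sum.distrib[symmetric] cinner_add_right by (intro sum_mono norm_triangle_ineq)
    also have "\<dots> \<le> \<epsilon> / 2 + \<epsilon> / 2"
      by (intro add_mono F1(3)[rule_format] F2(3)[rule_format]) (use U F in auto)
    finally show ?thesis by simp
  qed
  then show ?case
    using F1(1,2) F2(1,2) by (intro exI[of _ "F1 \<union> F2"] conjI allI impI) simp_all
qed

text \<open>The tails are small uniformly in \<open>n\<close>, so only a finite sum remains, for
  which strong convergence suffices.\<close>

lemma op_trace_comp_tendsto_0:
  fixes T :: "'a::complex_hilbert_space \<Rightarrow> 'a"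
  assumes T: "hs_product_sum T"
    and U: "\<And>n. self_adjoint_contraction (U n)"
    and lim: "\<And>x. (\<lambda>n. T (U n x)) \<longlonglongrightarrow> 0"
  shows "(\<lambda>n. op_trace (\<lambda>x. T (U n x))) \<longlonglongrightarrow> 0"
proof (rule tendstoI)
  fix \<epsilon> :: real assume \<epsilon>: "\<epsilon> > 0"
  define E where "E = (SOME E :: 'a set. is_onb E)"
  have E: "is_onb E" unfolding E_def by (rule hs_product_sum_onb[OF T])
  from \<epsilon> have "\<epsilon> / 2 > 0" by simp
  from hs_product_sum_uniform_tails[OF T E this]
  obtain F0 where F0: "finite F0" "F0 \<subseteq> E"
    "\<forall>U F. self_adjoint_contraction U \<longrightarrow> finite F \<longrightarrow> F \<subseteq> E - F0 \<longrightarrow> (\<Sum>e\<in>F. cmod (cinner e (T (U e)))) \<le> \<epsilon> / 2" by blast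
  have "(\<lambda>n. \<Sum>e\<in>F0. cinner e (T (U n e))) \<longlonglongrightarrow> (\<Sum>e\<in>F0. cinner e 0)"
    by (intro tendsto_sum cinner.tendsto tendsto_const lim)
  then have "\<forall>\<^sub>F n in sequentially. cmod (\<Sum>e\<in>F0. cinner e (T (U n e))) < \<epsilon> / 2"
    using tendstoD[OF _ \<open>\<epsilon> / 2 > 0\<close>] by (fastforce simp: cinner.zero_right)
  then show "\<forall>\<^sub>F n in sequentially. dist (op_trace (\<lambda>x. T (U n x))) 0 < \<epsilon>"
  proof eventually_elim
    case (elim n)
    let ?f = "\<lambda>e. cinner e (T (U n e))"
    have "(?f has_sum op_trace (\<lambda>x. T (U n x))) E"
      using U[of n] by (intro hs_product_sum_has_trace hs_product_sum_comp_right[OF T] E)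
        (auto simp: self_adjoint_contraction_def self_adjoint_bounded_clinear
          intro: self_adjoint_adjoint_pair)
    then have "(?f has_sum op_trace (\<lambda>x. T (U n x)) - sum ?f F0) (E - F0)"
      using F0 by (intro has_sum_Diff has_sum_finite) auto
    then have "cmod (op_trace (\<lambda>x. T (U n x)) - sum ?f F0) \<le> \<epsilon> / 2"
    proof (rule norm_has_sum_le)
      fix F assume F: "finite F" "F \<subseteq> E - F0"
      have "cmod (sum ?f F) \<le> (\<Sum>e\<in>F. cmod (?f e))" by (rule norm_sum)
      also have "\<dots> \<le> \<epsilon> / 2" using F0(3) U F by blast
      finally show "cmod (sum ?f F) \<le> \<epsilon> / 2" .
    qed
    then show ?case
      using elim norm_triangle_sub[of "op_trace (\<lambda>x. T (U n x))" "sum ?f F0"] by simp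
  qed
qed

text \<open>The cross term contributes \<open>- 2 * c * (norm (B x))\<^sup>2\<close>, and by the
  choice of \<open>c\<close> the quadratic term gives back at most half of it. The explicit loss is
  what forces \<open>B\<close> to vanish along the powers of this contraction.\<close>

lemma norm_op_minus_square_le:
  assumes B: "self_adjoint B" and M: "\<And>x. norm (B x) \<le> M * norm x" and cM: "c * M\<^sup>2 = 1"
  shows "(norm (x - c *\<^sub>R B (B x)))\<^sup>2 \<le> (norm x)\<^sup>2 - c * (norm (B x))\<^sup>2"
proof -
  have "Re (cinner x (c *\<^sub>R B (B x))) = c * (norm (B x))\<^sup>2"
    by (simp add: cinner.scaleR_right Re_cinner_self[symmetric]
        adjoint_pairD[OF self_adjoint_adjoint_pair[OF B]])
  moreover have "(norm (B (B x)))\<^sup>2 \<le> M\<^sup>2 * (norm (B x))\<^sup>2"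
    using power_mono[OF M[of "B x"], of 2] by (simp add: power_mult_distrib)
  then have "c\<^sup>2 * (norm (B (B x)))\<^sup>2 \<le> c\<^sup>2 * (M\<^sup>2 * (norm (B x))\<^sup>2)"
    by (rule mult_left_mono) simp
  moreover have "c\<^sup>2 * (M\<^sup>2 * (norm (B x))\<^sup>2) = c * (c * M\<^sup>2) * (norm (B x))\<^sup>2"
    by (simp add: power2_eq_square)
  ultimately show ?thesis
    unfolding norm_diff_sq by (simp add: power_mult_distrib cM)
qed

text \<open>For \<open>C\<^sup>* = - C\<close> the trace of \<open>C B\<close> is formally imaginary by cyclicity, but \<open>C\<close> itself need not
  be trace class. Writing \<open>1 = U\<^sup>n + c B\<^sup>2 V\<^sub>n\<close> with \<open>U = 1 - c B\<^sup>2\<close>, the second part contributes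
  the trace of \<open>(B C B) (B V\<^sub>n)\<close>, where cyclicity is available, and \<open>B U\<^sup>n \<rightarrow> 0\<close> strongly.\<close>

lemma Re_op_trace_skew_adjoint_comp:
  assumes B: "self_adjoint B" and C: "bounded_clinear C"
    and skew: "\<And>x y. cinner (C x) y = - cinner x (C y)"
    and T: "hs_product_sum (\<lambda>x. C (B x))"
  shows "Re (op_trace (\<lambda>x. C (B x))) = 0"
proof -
  note bB = self_adjoint_bounded_clinear[OF B] and aB = self_adjoint_adjoint_pair[OF B]
  note E = hs_product_sum_onb[OF T]
  obtain M where M: "M > 0" "\<forall>x. norm (B x) \<le> M * norm x"
    using bounded_clinear_bound[OF bB] by blast
  define c where "c = 1 / M\<^sup>2"
  have c: "c > 0" "c * M\<^sup>2 = 1" using M(1) by (simp_all add: c_def)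
  define U where "U = (\<lambda>x. x - c *\<^sub>R B (B x))"
  have U_sq: "(norm (U x))\<^sup>2 \<le> (norm x)\<^sup>2 - c * (norm (B x))\<^sup>2" for x
    unfolding U_def by (rule norm_op_minus_square_le[OF B M(2)[rule_format] c(2)])
  have "norm (U x) \<le> norm x" for x
  proof (rule power2_le_imp_le)
    have "0 \<le> c * (norm (B x))\<^sup>2" using c(1) by simp
    then show "(norm (U x))\<^sup>2 \<le> (norm x)\<^sup>2" using U_sq[of x] by linarith
  qed simp
  moreover have bU: "bounded_clinear U"
    unfolding U_def scaleR_scaleC
    by (rule bounded_clinear_minus[OF bounded_clinear_id
          bounded_clinear_scale[OF bounded_clinear_comp[OF bB bB]]])
  moreover have aU: "adjoint_pair U U"
    unfolding U_def adjoint_pair_def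
    by (simp add: cinner.diff_left cinner.diff_right cinner.scaleR_left cinner.scaleR_right
        adjoint_pairD[OF aB])
  ultimately have U: "self_adjoint_contraction U"
    by (simp add: self_adjoint_contraction_def self_adjointI)
  have Un: "self_adjoint_contraction (U ^^ n)" for n
  proof (induction n)
    case 0
    then show ?case
      by (simp add: self_adjoint_contraction_def self_adjoint_def bounded_clinear_id id_def)
  next
    case (Suc n)
    have "self_adjoint (U ^^ Suc n)"
    proof (rule self_adjointI[OF bounded_clinear_power[OF bU]])
      have "adjoint_pair (\<lambda>x. U ((U ^^ n) x)) (\<lambda>x. (U ^^ n) (U x))"
        using Suc by (intro adjoint_pair_comp[OF aU] self_adjoint_adjoint_pair)
          (simp add: self_adjoint_contraction_def)
      moreover have "(\<lambda>x. U ((U ^^ n) x)) = U ^^ Suc n" by (simp add: fun_eq_iff)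
      moreover have "(\<lambda>x. (U ^^ n) (U x)) = U ^^ Suc n"
        by (simp only: fun_eq_iff funpow_Suc_right o_apply simp_thms)
      ultimately show "adjoint_pair (U ^^ Suc n) (U ^^ Suc n)" by (simp only:)
    qed
    moreover have "norm ((U ^^ Suc n) x) \<le> norm x" for x
    proof -
      have "norm (U ((U ^^ n) x)) \<le> norm ((U ^^ n) x)"
        using U by (simp add: self_adjoint_contraction_def)
      also have "\<dots> \<le> norm x" using Suc by (simp add: self_adjoint_contraction_def)
      finally show ?thesis by simp
    qed
    ultimately show ?case by (simp add: self_adjoint_contraction_def del: funpow.simps)
  qed
  have BU: "B (U x) = U (B x)" for x
    by (simp add: U_def bounded_clinear_diff[OF bB] scaleR_scaleC bounded_clinear_scaleC[OF bB])
  have BUn: "B ((U ^^ n) x) = (U ^^ n) (B x)" for n x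
    by (induction n) (simp_all add: BU)
  have lim: "(\<lambda>n. B ((U ^^ n) x)) \<longlonglongrightarrow> 0" for x
  proof -
    let ?a = "\<lambda>n. (norm ((U ^^ n) x))\<^sup>2"
    \<comment> \<open>The squared norms along the orbit decrease to a limit, so their consecutive
      differences tend to zero and take \<open>B ((U ^^ n) x)\<close> with them.\<close>
    have step: "c * (norm (B ((U ^^ n) x)))\<^sup>2 \<le> ?a n - ?a (Suc n)" for n
      using U_sq[of "(U ^^ n) x"] by simp
    have "?a (Suc n) \<le> ?a n" for n
    proof -
      have "0 \<le> c * (norm (B ((U ^^ n) x)))\<^sup>2" using c(1) by simp
      with step[of n] show ?thesis by linarith
    qed
    then have "decseq ?a" by (rule decseq_SucI)
    then obtain L where L: "?a \<longlonglongrightarrow> L"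
      by (rule decseq_convergent[of ?a 0]) auto
    have "(\<lambda>n. ?a n - ?a (Suc n)) \<longlonglongrightarrow> L - L"
      by (rule tendsto_diff[OF L LIMSEQ_Suc[OF L]])
    then have diff: "(\<lambda>n. ?a n - ?a (Suc n)) \<longlonglongrightarrow> 0" by simp
    have "(\<lambda>n. c * (norm (B ((U ^^ n) x)))\<^sup>2) \<longlonglongrightarrow> 0"
    proof (rule tendsto_sandwich[OF _ _ tendsto_const diff])
      show "\<forall>\<^sub>F n in sequentially. 0 \<le> c * (norm (B ((U ^^ n) x)))\<^sup>2" using c(1) by simp
      show "\<forall>\<^sub>F n in sequentially. c * (norm (B ((U ^^ n) x)))\<^sup>2 \<le> ?a n - ?a (Suc n)"
        by (rule always_eventually, rule allI, rule step)
    qed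
    from tendsto_real_sqrt[OF tendsto_mult_left[OF this, of "1 / c"]]
    have "(\<lambda>n. norm (B ((U ^^ n) x))) \<longlonglongrightarrow> 0"
      using c(1) by simp
    then show ?thesis by (rule tendsto_norm_zero_cancel)
  qed
  define V where "V = (\<lambda>n x. \<Sum>k<n. (U ^^ k) x)"
  have bV: "bounded_clinear (V n)" for n
    unfolding V_def
    by (induction n)
      (simp_all add: bounded_clinear_0 bounded_clinear_plus bounded_clinear_power[OF bU])
  have aV: "adjoint_pair (V n) (V n)" for n
    unfolding V_def adjoint_pair_def cinner.sum_left cinner.sum_right
    using Un by (auto simp: self_adjoint_contraction_def self_adjoint_def)
  have BV: "B (V n x) = V n (B x)" for n x
    unfolding V_def
    by (simp add: BUn linear_sum[OF bounded_linear.linear[OF bounded_clinear_bounded_linear[OF bB]]])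
  \<comment> \<open>Geometric series: \<open>V n\<close> sums the powers of \<open>U\<close> below
    \<open>n\<close>, and \<open>c\<close> times the square of \<open>B\<close> is
    \<open>1 - U\<close>, so everything telescopes.\<close>
  have split: "(U ^^ n) x + c *\<^sub>R B (B (V n x)) = x" for n x
  proof (induction n)
    case 0
    then show ?case by (simp add: V_def bounded_clinear_zero[OF bB])
  next
    case (Suc n)
    have "(U ^^ Suc n) x = (U ^^ n) x - c *\<^sub>R B (B ((U ^^ n) x))"
      by (simp add: U_def)
    moreover have "V (Suc n) x = V n x + (U ^^ n) x" by (simp add: V_def)
    ultimately have "(U ^^ Suc n) x + c *\<^sub>R B (B (V (Suc n) x)) =
        (U ^^ n) x + c *\<^sub>R B (B (V n x))"
      by (simp only: bounded_clinear_add[OF bB] scaleR_right_distrib) simp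
    with Suc show ?case by (simp only:)
  qed
  define K where "K = (\<lambda>x. B (C (B x)))"
  have K: "hs_product_sum K" unfolding K_def by (rule hs_product_sum_comp_left[OF T bB])
  have skewK: "cinner (K x) y = - cinner x (K y)" for x y
    unfolding K_def by (simp add: adjoint_pairD[OF aB] skew)
  \<comment> \<open>\<open>K\<close> is skew-adjoint and \<open>?Y\<close> self-adjoint, so the
    adjoint of \<open>K ?Y\<close> is \<open>- ?Y K\<close>. Cyclicity, legitimate because
    \<open>K\<close> is a sum of Hilbert-Schmidt products, shows that the trace is minus its own
    conjugate.\<close>
  have imag: "Re (op_trace (\<lambda>x. K (B (V n x)))) = 0" for n
  proof -
    let ?Y = "\<lambda>x. B (V n x)"
    have bY: "bounded_clinear ?Y" by (rule bounded_clinear_comp[OF bB bV])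
    have aY: "adjoint_pair ?Y ?Y"
      using adjoint_pair_comp[OF aB aV[of n]] by (simp add: BV)
    have "((\<lambda>e. cinner e (K (?Y e))) has_sum op_trace (\<lambda>x. K (?Y x))) (SOME E. is_onb E)"
      by (rule hs_product_sum_has_trace[OF hs_product_sum_comp_right[OF K bY aY] E])
    then have "((\<lambda>e. - cnj (cinner e (K (?Y e)))) has_sum - cnj (op_trace (\<lambda>x. K (?Y x))))
        (SOME E. is_onb E)"
      by (intro has_sum_uminusI) simp
    moreover have "- cnj (cinner e (K (?Y e))) = cinner e (?Y (K e))" for e
      by (simp add: cinner_commute[symmetric] skewK adjoint_pairD[OF aY])
    ultimately have "((\<lambda>e. cinner e (?Y (K e))) has_sum - cnj (op_trace (\<lambda>x. K (?Y x))))
        (SOME E. is_onb E)" by simp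
    moreover have "((\<lambda>e. cinner e (?Y (K e))) has_sum op_trace (\<lambda>x. ?Y (K x))) (SOME E. is_onb E)"
      by (rule hs_product_sum_has_trace[OF hs_product_sum_comp_left[OF K bY] E])
    ultimately have "op_trace (\<lambda>x. ?Y (K x)) = - cnj (op_trace (\<lambda>x. K (?Y x)))"
      by (rule has_sum_unique[rotated])
    then have "op_trace (\<lambda>x. K (?Y x)) = - cnj (op_trace (\<lambda>x. K (?Y x)))"
      by (simp add: op_trace_cyclic[OF K bY aY])
    from arg_cong[OF this, of Re] show ?thesis by simp
  qed
  have eq: "Re (op_trace (\<lambda>x. C (B x))) = Re (op_trace (\<lambda>x. C (B ((U ^^ n) x))))" for n
  proof -
    \<comment> \<open>In \<open>?T2\<close> there are three factors \<open>B\<close>: the rightmost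
      is cycled to the left of \<open>C\<close> and forms \<open>K\<close> with the one next to
      \<open>C\<close>, while the middle one stays with \<open>V n\<close>.\<close>
    let ?T1 = "\<lambda>x. C (B ((U ^^ n) x))" and ?T2 = "\<lambda>x. C (B (B (V n (B x))))"
    have t1: "hs_product_sum ?T1"
      using Un[of n] by (intro hs_product_sum_comp_right[OF T bounded_clinear_power[OF bU]])
        (auto simp: self_adjoint_contraction_def intro: self_adjoint_adjoint_pair)
    have bY: "bounded_clinear (\<lambda>x. B (V n x))" by (rule bounded_clinear_comp[OF bB bV])
    have aY: "adjoint_pair (\<lambda>x. B (V n x)) (\<lambda>x. B (V n x))"
      using adjoint_pair_comp[OF aB aV[of n]] by (simp add: BV)
    have t: "hs_product_sum (\<lambda>x. C (B (B (V n x))))"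
      by (rule hs_product_sum_comp_right[OF T bY aY])
    have t2: "hs_product_sum ?T2"
      by (rule hs_product_sum_comp_right[OF t bB aB])
    have "op_trace ?T2 = op_trace (\<lambda>x. K (B (V n x)))"
      unfolding K_def by (rule op_trace_cyclic[OF t bB aB, symmetric])
    then have re0: "Re (op_trace ?T2) = 0" using imag by simp
    have bs: "bounded_clinear (\<lambda>x. complex_of_real c *\<^sub>C x)"
      by (intro bounded_clinear_scale bounded_clinear_id)
    have t3: "hs_product_sum (\<lambda>x. complex_of_real c *\<^sub>C ?T2 x)"
      by (rule hs_product_sum_comp_left[OF t2 bs])
    have "C (B x) = ?T1 x + complex_of_real c *\<^sub>C ?T2 x" for x
      by (subst split[of n x, symmetric]) (simp add: bounded_clinear_add[OF bB] bounded_clinear_add[OF C]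
          scaleR_scaleC bounded_clinear_scaleC[OF bB] bounded_clinear_scaleC[OF C] BV)
    then have "(\<lambda>x. C (B x)) = (\<lambda>x. ?T1 x + complex_of_real c *\<^sub>C ?T2 x)" by (rule ext)
    from arg_cong[OF this, of op_trace]
    have "op_trace (\<lambda>x. C (B x)) = op_trace ?T1 + op_trace (\<lambda>x. complex_of_real c *\<^sub>C ?T2 x)"
      using op_trace_add[OF t1 t3] by (rule trans)
    moreover have "op_trace (\<lambda>x. complex_of_real c *\<^sub>C ?T2 x) = complex_of_real c * op_trace ?T2"
      unfolding op_trace_def cinner_scaleC_right by (rule infsum_cmult_right')
    ultimately show ?thesis using re0 by simp
  qed
  have "(\<lambda>n. Re (op_trace (\<lambda>x. C (B ((U ^^ n) x))))) \<longlonglongrightarrow> Re 0"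
  proof (intro tendsto_Re op_trace_comp_tendsto_0[OF T Un])
    show "(\<lambda>n. C (B ((U ^^ n) x))) \<longlonglongrightarrow> 0" for x
      using bounded_linear.tendsto[OF bounded_clinear_bounded_linear[OF C] lim[of x]]
      by (simp add: bounded_clinear_zero[OF C])
  qed
  then have "(\<lambda>n::nat. Re (op_trace (\<lambda>x. C (B x)))) \<longlonglongrightarrow> 0"
    by (simp only: eq[symmetric] complex.sel zero_complex.sel)
  then show ?thesis by (simp add: LIMSEQ_const_iff)
qed

section \<open>Spectral theorem\<close>

lemma compact_bounded_combinations:
  assumes "finite F"
  shows "\<exists>K. compact K \<and>
    (\<forall>c. (\<forall>e\<in>F. cmod (c e) \<le> 1) \<longrightarrow> (\<Sum>e\<in>F. c e *\<^sub>C (v e :: 'a::complex_hilbert_space)) \<in> K)"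
  using assms
proof induction
  case empty
  then show ?case by (intro exI[of _ "{0}"]) simp
next
  case (insert u F)
  then obtain K where K: "compact K"
    "\<forall>c. (\<forall>e\<in>F. cmod (c e) \<le> 1) \<longrightarrow> (\<Sum>e\<in>F. c e *\<^sub>C v e) \<in> K" by blast
  let ?D = "(\<lambda>a. a *\<^sub>C v u) ` cball 0 1"
  have "compact ?D"
    by (rule compact_continuous_image[OF linear_continuous_on[OF scaleC.bounded_linear_left]
          compact_cball])
  then have "compact {x + y |x y. x \<in> ?D \<and> y \<in> K}"
    using K(1) by (rule compact_sums)
  moreover have "(\<Sum>e\<in>insert u F. c e *\<^sub>C v e) \<in> {x + y |x y. x \<in> ?D \<and> y \<in> K}"
    if "\<forall>e\<in>insert u F. cmod (c e) \<le> 1" for c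
  proof -
    have "c u *\<^sub>C v u \<in> ?D" using that by auto
    moreover have "(\<Sum>e\<in>F. c e *\<^sub>C v e) \<in> K" using K(2) that by simp
    ultimately show ?thesis using insert(1,2) by auto
  qed
  ultimately show ?case by blast
qed

text \<open>The expansion of \<open>x\<close> is cut off at a finite \<open>F\<close>. Coefficients
  of vectors in the unit ball have modulus at most 1, which confines the truncation to a compact
  set; Bessel and Cauchy-Schwarz bound the remainder by the Hilbert-Schmidt tail.\<close>

lemma hilbert_schmidt_approx:
  fixes S :: "'a::complex_hilbert_space \<Rightarrow> 'a"
  assumes S: "hilbert_schmidt S" and \<epsilon>: "\<epsilon> > 0"
  shows "\<exists>K. compact K \<and> (\<forall>x. norm x \<le> 1 \<longrightarrow> (\<exists>y\<in>K. dist (S x) y \<le> \<epsilon>))"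
proof -
  obtain E :: "'a set" where E: "is_onb E" using S by (auto simp: hilbert_schmidt_def)
  note oE = onb_orthonormal[OF E]
  have bS: "bounded_clinear S" by (rule hilbert_schmidt_bounded_clinear[OF S])
  from \<epsilon> have "\<epsilon>\<^sup>2 > 0" by simp
  from nonneg_summable_vanishing_tails[OF hilbert_schmidt_summable[OF S E] _ this]
  obtain F where F: "finite F" "F \<subseteq> E"
      "\<forall>J. finite J \<and> J \<subseteq> E - F \<longrightarrow> (\<Sum>e\<in>J. (norm (S e))\<^sup>2) \<le> \<epsilon>\<^sup>2"
    by auto
  obtain K where K: "compact K"
    "\<forall>c. (\<forall>e\<in>F. cmod (c e) \<le> 1) \<longrightarrow> (\<Sum>e\<in>F. c e *\<^sub>C S e) \<in> K"
    using compact_bounded_combinations[OF F(1), of S] by blast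
  have "\<exists>y\<in>K. dist (S x) y \<le> \<epsilon>" if x: "norm x \<le> 1" for x
  proof
    let ?f = "\<lambda>e. cinner e x *\<^sub>C S e"
    have "cmod (cinner e x) \<le> 1" if "e \<in> F" for e
      using cinner_Cauchy_Schwarz[of e x] onb_norm[OF E, of e] x that F(2) by auto
    then show "sum ?f F \<in> K" using K(2)[rule_format, of "\<lambda>e. cinner e x"] by simp
    have "(?f has_sum S x) E"
      using has_sum_bounded_linear[OF bounded_clinear_bounded_linear[OF bS] onb_expansion[OF E, of x]]
      by (simp add: bounded_clinear_scaleC[OF bS])
    then have "(?f has_sum S x - sum ?f F) (E - F)"
      using F by (intro has_sum_Diff has_sum_finite) auto
    then show "dist (S x) (sum ?f F) \<le> \<epsilon>"
      unfolding dist_norm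
    proof (rule norm_has_sum_le)
      fix J assume J: "finite J" "J \<subseteq> E - F"
      have "(\<Sum>e\<in>J. (cmod (cinner e x))\<^sup>2) \<le> (norm x)\<^sup>2"
        using J by (intro Bessel_finite[OF oE]) auto
      also have "\<dots> \<le> 1\<^sup>2" using x by (intro power_mono) auto
      finally have "(\<Sum>e\<in>J. \<bar>cmod (cinner e x) * norm (S e)\<bar>) \<le> 1 * \<epsilon>"
        using J F(3) \<epsilon> by (intro sum_mult_le_sqrt) auto
      moreover have "norm (sum ?f J) \<le> (\<Sum>e\<in>J. norm (?f e))" by (rule norm_sum)
      ultimately show "norm (sum ?f J) \<le> \<epsilon>" by simp
    qed
  qed
  with K(1) show ?thesis by blast
qed

lemma hilbert_schmidt_compact:
  fixes S :: "'a::complex_hilbert_space \<Rightarrow> 'a"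
  assumes S: "hilbert_schmidt S"
  shows "compact (closure (S ` cball 0 1))"
  unfolding compact_eq_totally_bounded
proof (intro conjI allI impI)
  show "complete (closure (S ` cball 0 1))" by (simp add: complete_eq_closed)
  fix \<epsilon> :: real assume \<epsilon>: "\<epsilon> > 0"
  \<comment> \<open>One third each for passing to the closure, for approximation by
    \<open>K\<close>, and for the finite net of \<open>K\<close>.\<close>
  then have \<epsilon>3: "\<epsilon> / 3 > 0" by simp
  obtain K where K: "compact K" "\<forall>x. norm x \<le> 1 \<longrightarrow> (\<exists>y\<in>K. dist (S x) y \<le> \<epsilon> / 3)"
    using hilbert_schmidt_approx[OF S \<epsilon>3] by blast
  obtain k where k: "finite k" "K \<subseteq> (\<Union>x\<in>k. ball x (\<epsilon> / 3))"
    using K(1) \<epsilon>3 unfolding compact_eq_totally_bounded by blast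
  have "closure (S ` cball 0 1) \<subseteq> (\<Union>x\<in>k. ball x \<epsilon>)"
  proof
    fix z assume "z \<in> closure (S ` cball 0 1)"
    then obtain v where v: "v \<in> S ` cball 0 1" "dist v z < \<epsilon> / 3"
      using \<epsilon>3 unfolding closure_approachable by blast
    then obtain x where x: "norm x \<le> 1" "dist (S x) z < \<epsilon> / 3" by auto
    obtain y where y: "y \<in> K" "dist (S x) y \<le> \<epsilon> / 3" using K(2) x(1) by blast
    obtain w where w: "w \<in> k" "dist w y < \<epsilon> / 3" using k(2) y(1) by auto
    have "dist w z \<le> dist w y + dist y (S x) + dist (S x) z"
      using dist_triangle[of w z y] dist_triangle[of y z "S x"] by linarith
    then have "dist w z < \<epsilon>" using x(2) y(2) w(2) by (simp add: dist_commute)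
    with w(1) show "z \<in> (\<Union>x\<in>k. ball x \<epsilon>)" by auto
  qed
  with k(1) show "\<exists>k. finite k \<and> closure (S ` cball 0 1) \<subseteq> (\<Union>x\<in>k. ball x \<epsilon>)" by blast
qed

text \<open>The sequential form is the one that extracts a limit from a maximizing sequence.\<close>

definition compact_op :: "('a::complex_hilbert_space \<Rightarrow> 'a) \<Rightarrow> bool"
  where "compact_op T \<longleftrightarrow> (\<forall>x::nat \<Rightarrow> 'a. (\<forall>n. norm (x n) \<le> 1) \<longrightarrow>
    (\<exists>l r. strict_mono r \<and> (\<lambda>n. T (x (r n))) \<longlonglongrightarrow> l))"

lemma trace_class_compact_op:
  assumes "trace_class T" shows "compact_op T"
  unfolding compact_op_def
proof (intro allI impI)
  obtain R S where RS: "hilbert_schmidt R" "hilbert_schmidt S" "T = R \<circ> S"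
    using assms by (auto simp: trace_class_def)
  fix x :: "nat \<Rightarrow> 'a" assume x: "\<forall>n. norm (x n) \<le> 1"
  have "S (x n) \<in> closure (S ` cball 0 1)" for n
    using x closure_subset by fastforce
  then obtain l r where r: "strict_mono r" "((\<lambda>n. S (x n)) \<circ> r) \<longlonglongrightarrow> l"
    using seq_compactE[OF compact_imp_seq_compact[OF hilbert_schmidt_compact[OF RS(2)]],
        of "\<lambda>n. S (x n)"] by metis
  have "(\<lambda>n. R (S (x (r n)))) \<longlonglongrightarrow> R l"
    using bounded_linear.tendsto[OF bounded_clinear_bounded_linear[OF
          hilbert_schmidt_bounded_clinear[OF RS(1)]] r(2)] by (simp add: o_def)
  then have "(\<lambda>n. T (x (r n))) \<longlonglongrightarrow> R l" by (simp add: RS(3))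
  with r(1) show "\<exists>l r. strict_mono r \<and> (\<lambda>n. T (x (r n))) \<longlonglongrightarrow> l" by blast
qed

text \<open>The vector in \<open>pos\<close> is one gradient step from \<open>x\<close>; expanding
  the form there and bounding the last term by \<open>K\<close> gives the inequality. Positivity is
  asked at this single vector so that the lemma also serves operators that are positive only on an
  invariant subspace.\<close>

lemma norm_sq_le_quadratic_form:
  assumes P: "self_adjoint P" and K: "K > 0" "\<And>y. norm (P y) \<le> K * norm y"
    and pos: "0 \<le> Re (cinner (x - (1 / K) *\<^sub>R P x) (P (x - (1 / K) *\<^sub>R P x)))"
  shows "(norm (P x))\<^sup>2 \<le> K * Re (cinner x (P x))"
proof -
  note bP = self_adjoint_bounded_clinear[OF P] and aP = self_adjoint_adjoint_pair[OF P]
  have PR: "P (r *\<^sub>R y) = r *\<^sub>R P y" for r y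
    by (simp add: scaleR_scaleC bounded_clinear_scaleC[OF bP])
  have "Re (cinner (P x) (P (P x))) \<le> norm (P x) * norm (P (P x))"
    using complex_Re_le_cmod cinner_Cauchy_Schwarz by (rule order_trans)
  also have "\<dots> \<le> norm (P x) * (K * norm (P x))" by (intro mult_left_mono K) simp
  finally have 1: "Re (cinner (P x) (P (P x))) \<le> K * (norm (P x))\<^sup>2"
    by (simp add: power2_eq_square mult_ac)
  have 2: "cinner x (P (P x)) = of_real ((norm (P x))\<^sup>2)"
    using adjoint_pairD[OF aP, of x "P x"] by (simp add: cinner_self)
  have "0 \<le> Re (cinner x (P x)) - 2 * (1 / K) * (norm (P x))\<^sup>2
      + (1 / K) * ((1 / K) * Re (cinner (P x) (P (P x))))"
    using pos by (simp add: bounded_clinear_diff[OF bP] PR cinner.diff_left cinner.diff_right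
        cinner.scaleR_left cinner.scaleR_right 2 cinner_self diff_divide_distrib
        del: of_real_power)
  also have "\<dots> \<le> Re (cinner x (P x)) - 2 * (1 / K) * (norm (P x))\<^sup>2
      + (1 / K) * ((1 / K) * (K * (norm (P x))\<^sup>2))"
    using K(1) 1 by (intro add_left_mono mult_left_mono) auto
  also have "\<dots> = Re (cinner x (P x)) - (norm (P x))\<^sup>2 / K"
    using K(1) by (simp add: field_simps)
  finally show ?thesis using K(1) by (simp add: field_simps)
qed

text \<open>Variational principle on the orthogonal complement \<open>M\<close> of \<open>F\<close>,
  which \<open>T\<close> preserves because \<open>F\<close> consists of eigenvectors. The supremum
  \<open>m\<close> of the quadratic form on the unit ball of \<open>M\<close> is the eigenvalue, and
  compactness turns a maximizing sequence into an eigenvector. If \<open>T\<close> vanishes on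
  \<open>M\<close>, the vector \<open>x0\<close> itself serves.\<close>

lemma exists_eigenvector_orthogonal:
  fixes T :: "'a::complex_hilbert_space \<Rightarrow> 'a"
  assumes T: "positive_op T" and comp: "compact_op T"
    and F: "\<And>e. e \<in> F \<Longrightarrow> \<exists>\<mu>. T e = \<mu> *\<^sub>R e"
    and x0: "x0 \<noteq> 0" "\<forall>e\<in>F. cinner e x0 = 0"
  shows "\<exists>u \<mu>. norm u = 1 \<and> (\<forall>e\<in>F. cinner e u = 0) \<and> T u = \<mu> *\<^sub>R u"
proof -
  define M where "M = {x. \<forall>e\<in>F. cinner e x = 0}"
  have saT: "self_adjoint T" by (rule positive_op_self_adjoint[OF T])
  note bT = self_adjoint_bounded_clinear[OF saT] and aT = self_adjoint_adjoint_pair[OF saT]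
  have TR: "T (r *\<^sub>R y) = r *\<^sub>R T y" for r y
    by (simp add: scaleR_scaleC bounded_clinear_scaleC[OF bT])
  have pos: "0 \<le> Re (cinner y (T y))" for y
    using T by (auto simp: positive_op_def less_eq_complex_def)
  have MT: "T x \<in> M" if "x \<in> M" for x
    unfolding M_def
  proof safe
    fix e assume e: "e \<in> F"
    then obtain \<mu> where "T e = \<mu> *\<^sub>R e" using F by blast
    then show "cinner e (T x) = 0"
      using that e by (simp add: M_def adjoint_pairD[OF aT, symmetric] cinner.scaleR_left)
  qed
  have M_scale: "r *\<^sub>R x \<in> M" if "x \<in> M" for r x
    using that by (auto simp: M_def cinner.scaleR_right)
  have M_diff: "x - y \<in> M" if "x \<in> M" "y \<in> M" for x y
    using that by (auto simp: M_def cinner.diff_right)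
  have normalize: ?thesis if u: "u \<in> M" "u \<noteq> 0" "T u = \<mu> *\<^sub>R u" for u \<mu>
  proof (intro exI conjI)
    show "norm ((1 / norm u) *\<^sub>R u) = 1" using u(2) by simp
    show "\<forall>e\<in>F. cinner e ((1 / norm u) *\<^sub>R u) = 0" using M_scale[OF u(1)] by (simp add: M_def)
    show "T ((1 / norm u) *\<^sub>R u) = \<mu> *\<^sub>R ((1 / norm u) *\<^sub>R u)" using u(3) by (simp add: TR)
  qed
  show ?thesis
  proof (cases "\<forall>x\<in>M. T x = 0")
    case True
    then show ?thesis using normalize[of x0 0] x0 by (simp add: M_def)
  next
    case False
    then obtain x1 where x1: "x1 \<in> M" "T x1 \<noteq> 0" by blast
    obtain K where K: "K > 0" "\<forall>x. norm (T x) \<le> K * norm x"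
      using bounded_clinear_bound[OF bT] by blast
    define A where "A = (\<lambda>x. Re (cinner x (T x))) ` {x\<in>M. norm x \<le> 1}"
    have form_le: "Re (cinner x (T x)) \<le> K * (norm x)\<^sup>2" for x
    proof -
      have "Re (cinner x (T x)) \<le> norm x * norm (T x)"
        using complex_Re_le_cmod cinner_Cauchy_Schwarz by (rule order_trans)
      also have "\<dots> \<le> norm x * (K * norm x)" using K(2) by (intro mult_left_mono) auto
      finally show ?thesis by (simp add: power2_eq_square mult_ac)
    qed
    have bdd: "bdd_above A"
      unfolding A_def
    proof (rule bdd_aboveI2)
      fix x assume "x \<in> {x \<in> M. norm x \<le> 1}"
      then have "(norm x)\<^sup>2 \<le> 1" by (simp add: power_le_one)
      then have "K * (norm x)\<^sup>2 \<le> K * 1" using K(1) by (intro mult_left_mono) auto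
      with form_le[of x] show "Re (cinner x (T x)) \<le> K" by simp
    qed
    have "A \<noteq> {}" unfolding A_def by (auto simp: M_def cinner.zero_right intro!: exI[of _ 0])
    define m where "m = Sup A"
    have form_m: "Re (cinner z (T z)) \<le> m * (norm z)\<^sup>2" if "z \<in> M" for z
    proof (cases "z = 0")
      case True
      then show ?thesis by (simp add: cinner.zero_left)
    next
      case False
      have "Re (cinner ((1 / norm z) *\<^sub>R z) (T ((1 / norm z) *\<^sub>R z))) \<in> A"
        unfolding A_def using M_scale[OF that] False by (intro imageI) auto
      then have "Re (cinner ((1 / norm z) *\<^sub>R z) (T ((1 / norm z) *\<^sub>R z))) \<le> m"
        unfolding m_def by (rule cSup_upper[OF _ bdd])
      then show ?thesis
        using False by (simp add: TR cinner.scaleR_left cinner.scaleR_right field_simps power2_eq_square)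
    qed
    \<comment> \<open>Positivity of \<open>m\<close> allows division by it and later excludes a zero
      limit vector.\<close>
    have m: "m > 0"
    proof -
      have "0 < (norm (T x1))\<^sup>2" using x1(2) by simp
      also have "\<dots> \<le> K * Re (cinner x1 (T x1))"
        using K(2) pos by (intro norm_sq_le_quadratic_form[OF saT K(1)]) auto
      also have "\<dots> \<le> K * (m * (norm x1)\<^sup>2)"
        using K(1) form_m[OF x1(1)] by (intro mult_left_mono) auto
      finally have "0 < K * (m * (norm x1)\<^sup>2)" .
      then show ?thesis
        using K(1) by (auto simp: zero_less_mult_iff)
    qed
    \<comment> \<open>By the choice of \<open>m\<close> this operator has a nonnegative form on
      \<open>M\<close>, and the form is nearly zero on the maximizing sequence, so
      \<open>P (x n)\<close> tends to zero.\<close>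
    define P where "P = (\<lambda>x. m *\<^sub>R x - T x)"
    have bP: "bounded_clinear P"
      unfolding P_def scaleR_scaleC
      by (rule bounded_clinear_minus[OF bounded_clinear_scale[OF bounded_clinear_id] bT])
    have aP: "adjoint_pair P P"
      by (simp add: adjoint_pair_def P_def cinner.diff_left cinner.diff_right cinner.scaleR_left
          cinner.scaleR_right adjoint_pairD[OF aT])
    have saP: "self_adjoint P" by (rule self_adjointI[OF bP aP])
    have formP: "Re (cinner z (P z)) = m * (norm z)\<^sup>2 - Re (cinner z (T z))" for z
      by (simp add: P_def cinner.diff_right cinner.scaleR_right cinner_self del: of_real_power)
    obtain L where L: "L > 0" "\<forall>x. norm (P x) \<le> L * norm x"
      using bounded_clinear_bound[OF bP] by blast
    have MP: "P x \<in> M" if "x \<in> M" for x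
      unfolding P_def using that by (intro M_diff M_scale MT)
    have "\<exists>x\<in>M. norm x \<le> 1 \<and> m - 1 / real (Suc n) < Re (cinner x (T x))" for n
    proof -
      have "m - 1 / real (Suc n) < Sup A" by (simp add: m_def)
      then show ?thesis
        using less_cSup_iff[OF \<open>A \<noteq> {}\<close> bdd] by (auto simp: A_def)
    qed
    then have "\<forall>n. \<exists>x. x \<in> M \<and> norm x \<le> 1 \<and> m - 1 / real (Suc n) < Re (cinner x (T x))" by blast
    from choice[OF this]
    obtain x where "\<forall>n. x n \<in> M \<and> norm (x n) \<le> 1 \<and>
        m - 1 / real (Suc n) < Re (cinner (x n) (T (x n)))" ..
    then have x: "\<And>n. x n \<in> M" "\<And>n. norm (x n) \<le> 1"
        "\<And>n. m - 1 / real (Suc n) < Re (cinner (x n) (T (x n)))"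
      by blast+
    have Px: "(norm (P (x n)))\<^sup>2 \<le> L * (1 / real (Suc n))" for n
    proof -
      have "(norm (P (x n)))\<^sup>2 \<le> L * Re (cinner (x n) (P (x n)))"
      proof (rule norm_sq_le_quadratic_form[OF saP L(1) L(2)[rule_format]])
        have "x n - (1 / L) *\<^sub>R P (x n) \<in> M" using x(1) by (intro M_diff M_scale MP)
        from form_m[OF this]
        show "0 \<le> Re (cinner (x n - (1 / L) *\<^sub>R P (x n)) (P (x n - (1 / L) *\<^sub>R P (x n))))"
          by (simp add: formP)
      qed
      also have "Re (cinner (x n) (P (x n))) \<le> 1 / real (Suc n)"
      proof -
        have "m * (norm (x n))\<^sup>2 \<le> m * 1"
          using m x(2)[of n] by (intro mult_left_mono) (auto simp: power_le_one)
        then show ?thesis using x(3)[of n] by (simp add: formP)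
      qed
      finally show ?thesis using L(1) by simp
    qed
    have to0: "(\<lambda>n. 1 / real (Suc n)) \<longlonglongrightarrow> 0"
      by (rule LIMSEQ_Suc[OF lim_1_over_n])
    from tendsto_mult_left[OF this, of L]
    have bound0: "(\<lambda>n. L * (1 / real (Suc n))) \<longlonglongrightarrow> 0" by simp
    have "(\<lambda>n. (norm (P (x n)))\<^sup>2) \<longlonglongrightarrow> 0"
    proof (rule tendsto_sandwich[OF _ _ tendsto_const bound0])
      show "\<forall>\<^sub>F n in sequentially. (norm (P (x n)))\<^sup>2 \<le> L * (1 / real (Suc n))"
        by (rule always_eventually, rule allI, rule Px)
    qed simp
    from tendsto_real_sqrt[OF this] have P0: "(\<lambda>n. P (x n)) \<longlonglongrightarrow> 0"
      by (simp add: tendsto_norm_zero_iff)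
    from comp[unfolded compact_op_def, rule_format, of x, OF x(2)]
    obtain l r where r: "strict_mono r" "(\<lambda>n. T (x (r n))) \<longlonglongrightarrow> l" by blast
    have "(\<lambda>n. P (x (r n))) \<longlonglongrightarrow> 0"
      using LIMSEQ_subseq_LIMSEQ[OF P0 r(1)] by (simp add: o_def)
    \<comment> \<open>Since \<open>m *\<^sub>R x = P x + T x\<close>, convergence of both terms on
      the right gives convergence of the subsequence itself.\<close>
    from tendsto_scaleR[OF tendsto_const[of "1 / m"] tendsto_add[OF this r(2)]]
    have xl: "(\<lambda>n. x (r n)) \<longlonglongrightarrow> (1 / m) *\<^sub>R l"
      using m by (simp add: P_def)
    define u where "u = (1 / m) *\<^sub>R l"
    have "(\<lambda>n. T (x (r n))) \<longlonglongrightarrow> T u"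
      unfolding u_def by (rule bounded_linear.tendsto[OF bounded_clinear_bounded_linear[OF bT] xl])
    with r(2) have "T u = l" by (rule LIMSEQ_unique[rotated])
    then have Tu: "T u = m *\<^sub>R u" using m by (simp add: u_def)
    have uM: "u \<in> M"
      unfolding M_def
    proof safe
      fix e assume "e \<in> F"
      then have "cinner e (x (r n)) = 0" for n using x(1) by (simp add: M_def)
      moreover have "(\<lambda>n. cinner e (x (r n))) \<longlonglongrightarrow> cinner e u"
        unfolding u_def by (intro cinner.tendsto tendsto_const xl)
      ultimately show "cinner e u = 0" by (simp add: LIMSEQ_const_iff)
    qed
    have "m \<le> Re (cinner u (T u))"
    proof (rule LIMSEQ_le)
      have "(\<lambda>n. 1 / real (Suc (r n))) \<longlonglongrightarrow> 0"
        using LIMSEQ_subseq_LIMSEQ[OF to0 r(1)] by (simp add: o_def)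
      from tendsto_diff[OF tendsto_const[of m] this]
      show "(\<lambda>n. m - 1 / real (Suc (r n))) \<longlonglongrightarrow> m" by simp
      show "(\<lambda>n. Re (cinner (x (r n)) (T (x (r n))))) \<longlonglongrightarrow> Re (cinner u (T u))"
        unfolding \<open>T u = l\<close> unfolding u_def by (intro tendsto_Re cinner.tendsto xl r(2))
      show "\<exists>N. \<forall>n\<ge>N. m - 1 / real (Suc (r n)) \<le> Re (cinner (x (r n)) (T (x (r n))))"
        using x(3)[THEN less_imp_le] by blast
    qed
    then have "u \<noteq> 0" using m by (auto simp: cinner.zero_left)
    then show ?thesis by (rule normalize[OF uM _ Tu])
  qed
qed

text \<open>Zorn's lemma on orthonormal sets of eigenvectors. If a maximal one were not a basis, the
  eigenvector found in its orthogonal complement would extend it.\<close>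

theorem positive_trace_class_eigenbasis:
  fixes T :: "'a::complex_hilbert_space \<Rightarrow> 'a"
  assumes T: "positive_op T" and tc: "trace_class T"
  obtains E \<mu> where "is_onb E" "\<forall>e\<in>E. T e = \<mu> e *\<^sub>R e"
proof -
  note comp = trace_class_compact_op[OF tc]
  let ?\<A> = "{F. orthonormal F \<and> (\<forall>e\<in>F. \<exists>\<mu>. T e = \<mu> *\<^sub>R e)}"
  have "\<exists>M\<in>?\<A>. \<forall>X\<in>?\<A>. M \<subseteq> X \<longrightarrow> X = M"
  proof (rule subset_Zorn_nonempty)
    have "{} \<in> ?\<A>" by (simp add: orthonormal_def)
    then show "?\<A> \<noteq> {}" by blast
    fix \<C> assume ne: "\<C> \<noteq> {}" and ch: "subset.chain ?\<A> \<C>"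
    have "cinner e e' = 0" if e: "e \<in> \<Union>\<C>" "e' \<in> \<Union>\<C>" "e \<noteq> e'" for e e'
    proof -
      from e obtain X Y where XY: "e \<in> X" "X \<in> \<C>" "e' \<in> Y" "Y \<in> \<C>" by blast
      then have "X \<subseteq> Y \<or> Y \<subseteq> X" using ch by (simp add: subset_chain_def)
      then obtain Z where Z: "e \<in> Z" "e' \<in> Z" "Z \<in> \<C>" using XY by blast
      then have "orthonormal Z" using ch by (auto simp: subset_chain_def)
      with Z e(3) show ?thesis by (simp add: orthonormal_def)
    qed
    moreover have "norm e = 1 \<and> (\<exists>\<mu>. T e = \<mu> *\<^sub>R e)" if "e \<in> \<Union>\<C>" for e
    proof -
      from that obtain X where X: "e \<in> X" "X \<in> \<C>" by blast
      then have "X \<in> ?\<A>" using ch by (auto simp: subset_chain_def)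
      with X(1) show ?thesis by (simp add: orthonormal_def)
    qed
    ultimately show "\<Union>\<C> \<in> ?\<A>" by (simp add: orthonormal_def)
  qed
  then obtain E where "E \<in> ?\<A>" and max: "\<forall>X\<in>?\<A>. E \<subseteq> X \<longrightarrow> X = E" ..
  then have E: "orthonormal E" "\<forall>e\<in>E. \<exists>\<mu>. T e = \<mu> *\<^sub>R e" by simp_all
  have "x = 0" if x: "\<forall>e\<in>E. cinner e x = 0" for x
  proof (rule ccontr)
    assume "x \<noteq> 0"
    from exists_eigenvector_orthogonal[OF T comp bspec[OF E(2)] this x]
    obtain u \<mu> where u: "norm u = 1" "\<forall>e\<in>E. cinner e u = 0" "T u = \<mu> *\<^sub>R u"
      by blast
    have "\<forall>e\<in>E. cinner u e = 0" using u(2) cinner_eq_zero_commute by blast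
    then have "orthonormal (insert u E)"
      using E(1) u(1,2) by (auto simp: orthonormal_def)
    moreover have "\<forall>e\<in>insert u E. \<exists>\<mu>. T e = \<mu> *\<^sub>R e" using E(2) u(3) by blast
    ultimately have "insert u E \<in> ?\<A>" by simp
    from bspec[OF max this] have "insert u E = E" by (simp add: subset_insertI)
    then have "u \<in> E" by (metis insertI1)
    then have "cinner u u = 0" using u(2) by blast
    with u(1) show False by (simp add: cinner_self)
  qed
  then have "is_onb E" using E(1) by (simp add: is_onb_iff)
  moreover from bchoice[OF E(2)] obtain \<mu> where "\<forall>e\<in>E. T e = \<mu> e *\<^sub>R e" ..
  ultimately show ?thesis by (rule that)
qed

section \<open>Diagonal operators, spectrum and functional calculus\<close>

lemma cinner_diagonal:
  assumes E: "is_onb E" and S: "bounded_clinear S" and d: "\<And>e. e \<in> E \<Longrightarrow> S e = d e *\<^sub>C e"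
    and e: "e \<in> E"
  shows "cinner e (S x) = d e * cinner e x"
proof -
  have "((\<lambda>e. S (cinner e x *\<^sub>C e)) has_sum S x) E"
    by (rule has_sum_bounded_linear[OF bounded_clinear_bounded_linear[OF S] onb_expansion[OF E]])
  moreover have "S (cinner e x *\<^sub>C e) = (d e * cinner e x) *\<^sub>C e" if "e \<in> E" for e
    by (simp add: bounded_clinear_scaleC[OF S] d[OF that] scaleC_scaleC mult.commute)
  ultimately have "((\<lambda>e. (d e * cinner e x) *\<^sub>C e) has_sum S x) E"
    by (simp cong: has_sum_cong)
  from cinner_has_sum_orthonormal[OF onb_orthonormal[OF E] this e] show ?thesis .
qed

lemma norm_le_of_coefficients:
  assumes E: "is_onb E" and K: "K \<ge> 0" "\<And>e. e \<in> E \<Longrightarrow> cmod (cinner e y) \<le> K * cmod (cinner e x)"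
  shows "norm y \<le> K * norm x"
proof (rule power2_le_imp_le)
  show "(norm y)\<^sup>2 \<le> (K * norm x)\<^sup>2"
    unfolding power_mult_distrib
  proof (rule has_sum_mono[OF Parseval_norm[OF E] has_sum_cmult_right[OF Parseval_norm[OF E]]])
    fix e assume "e \<in> E"
    from power_mono[OF K(2)[OF this], of 2]
    show "(cmod (cinner e y))\<^sup>2 \<le> K\<^sup>2 * (cmod (cinner e x))\<^sup>2" by (simp add: power_mult_distrib)
  qed
qed (use K(1) in simp)

lemma norm_diagonal_le:
  assumes E: "is_onb E" and S: "bounded_clinear S" and d: "\<And>e. e \<in> E \<Longrightarrow> S e = d e *\<^sub>C e"
    and K: "K \<ge> 0" "\<And>e. e \<in> E \<Longrightarrow> cmod (d e) \<le> K"
  shows "norm (S x) \<le> K * norm x"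
proof (rule norm_le_of_coefficients[OF E K(1)])
  fix e assume "e \<in> E"
  then show "cmod (cinner e (S x)) \<le> K * cmod (cinner e x)"
    using K(2) by (simp add: cinner_diagonal[OF E S d] norm_mult mult_right_mono)
qed

lemma exists_diagonal:
  fixes d :: "'a::complex_hilbert_space \<Rightarrow> complex"
  assumes E: "is_onb E" and K: "\<And>e. e \<in> E \<Longrightarrow> cmod (d e) \<le> K"
  shows "\<exists>S. bounded_clinear S \<and> (\<forall>e\<in>E. S e = d e *\<^sub>C e)"
proof -
  note oE = onb_orthonormal[OF E]
  \<comment> \<open>For empty \<open>E\<close> the bound \<open>K\<close> may be negative.\<close>
  define K' where "K' = max K 0"
  have K': "K' \<ge> 0" "\<And>e. e \<in> E \<Longrightarrow> cmod (d e) \<le> K'" using K by (auto simp: K'_def le_max_iff_disj)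
  have "\<exists>y. ((\<lambda>e. (d e * cinner e x) *\<^sub>C e) has_sum y) E" for x
  proof -
    have "(\<lambda>e. (cmod (d e * cinner e x))\<^sup>2) summable_on E"
    proof (rule summable_on_comparison_test[OF summable_on_cmult_right[OF Bessel_summable[OF oE]]])
      fix e assume "e \<in> E"
      from mult_right_mono[OF power_mono[OF K'(2)[OF this], of 2], of "(cmod (cinner e x))\<^sup>2"]
      show "(cmod (d e * cinner e x))\<^sup>2 \<le> K'\<^sup>2 * (cmod (cinner e x))\<^sup>2"
        by (simp add: norm_mult power_mult_distrib)
    qed simp
    from Riesz_Fischer[OF oE this] show ?thesis by (simp add: summable_on_def)
  qed
  then have "\<forall>x. \<exists>y. ((\<lambda>e. (d e * cinner e x) *\<^sub>C e) has_sum y) E" ..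
  from choice[OF this] obtain S where "\<forall>x. ((\<lambda>e. (d e * cinner e x) *\<^sub>C e) has_sum S x) E" ..
  then have coeff: "cinner e (S x) = d e * cinner e x" if "e \<in> E" for e x
    using cinner_has_sum_orthonormal[where c = "\<lambda>e. d e * cinner e x", OF oE _ that] by blast
  have "bounded_clinear S"
  proof (rule bounded_clinearI)
    show "S (x + y) = S x + S y" for x y
      by (rule onb_ext[OF E]) (simp add: coeff cinner_add_right distrib_left)
    show "S (c *\<^sub>C x) = c *\<^sub>C S x" for c x
      by (rule onb_ext[OF E]) (simp add: coeff cinner_scaleC_right)
    show "norm (S x) \<le> norm x * K'" for x
      unfolding mult.commute[of _ K']
      by (rule norm_le_of_coefficients[OF E K'(1)]) (simp add: coeff norm_mult mult_right_mono K'(2))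
  qed
  moreover have "S e = d e *\<^sub>C e" if "e \<in> E" for e
    by (rule onb_ext[OF E]) (use that in \<open>simp add: coeff cinner_scaleC_right cinner_orthonormal[OF oE]\<close>)
  ultimately show ?thesis by blast
qed

text \<open>Off the closure the numbers \<open>1 / (\<mu> e - z)\<close> are bounded, so the
  diagonal inverse exists. Conversely an inverse with bound \<open>K\<close> keeps every
  \<open>\<mu> e\<close> at distance at least \<open>1 / K\<close> from \<open>z\<close>.\<close>

lemma op_spectrum_diagonal:
  assumes E: "is_onb E" and T: "bounded_clinear T" and \<mu>: "\<And>e. e \<in> E \<Longrightarrow> T e = \<mu> e *\<^sub>C e"
  shows "op_spectrum T = closure (\<mu> ` E)"
proof (intro equalityI subsetI)
  fix z assume z: "z \<in> op_spectrum T"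
  show "z \<in> closure (\<mu> ` E)"
  proof (rule ccontr)
    assume "z \<notin> closure (\<mu> ` E)"
    then obtain \<delta> where \<delta>: "\<delta> > 0" "\<forall>w\<in>\<mu> ` E. \<not> dist w z < \<delta>"
      unfolding closure_approachable by blast
    have ge: "cmod (\<mu> e - z) \<ge> \<delta>" if "e \<in> E" for e
      using \<delta>(2) that by (auto simp: dist_norm)
    have "cmod (1 / (\<mu> e - z)) \<le> 1 / \<delta>" if "e \<in> E" for e
      using ge[OF that] \<delta>(1) by (simp add: norm_divide frac_le)
    from exists_diagonal[where d = "\<lambda>e. 1 / (\<mu> e - z)", OF E this]
    obtain S where S: "bounded_clinear S" "\<forall>e\<in>E. S e = (1 / (\<mu> e - z)) *\<^sub>C e" by blast
    have bTz: "bounded_clinear (\<lambda>x. T x - z *\<^sub>C x)"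
      by (rule bounded_clinear_minus[OF T bounded_clinear_scale[OF bounded_clinear_id]])
    have ne: "\<mu> e - z \<noteq> 0" if "e \<in> E" for e using ge[OF that] \<delta>(1) by auto
    have Te: "T e - z *\<^sub>C e = (\<mu> e - z) *\<^sub>C e" if "e \<in> E" for e
      by (simp add: \<mu>[OF that] scaleC.diff_left)
    have 1: "(\<lambda>x. S (T x - z *\<^sub>C x)) = (\<lambda>x. x)"
    proof (rule bounded_clinear_eq_on_onb[OF E bounded_clinear_comp[OF S(1) bTz] bounded_clinear_id])
      show "S (T e - z *\<^sub>C e) = e" if "e \<in> E" for e
        using S(2) that ne[OF that]
        by (simp add: Te bounded_clinear_scaleC[OF S(1)] scaleC_scaleC)
    qed
    have 2: "(\<lambda>x. T (S x) - z *\<^sub>C S x) = (\<lambda>x. x)"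
    proof (rule bounded_clinear_eq_on_onb[OF E bounded_clinear_comp[OF bTz S(1)] bounded_clinear_id])
      show "T (S e) - z *\<^sub>C S e = e" if "e \<in> E" for e
      proof -
        have "T (S e) - z *\<^sub>C S e = (1 / (\<mu> e - z)) *\<^sub>C (T e - z *\<^sub>C e)"
          using S(2) that by (simp add: bounded_clinear_scaleC[OF T] scaleC.diff_right scaleC_scaleC
              mult.commute)
        then show ?thesis using ne[OF that] by (simp add: Te[OF that] scaleC_scaleC)
      qed
    qed
    have "bounded_clinear S \<and> (\<forall>x. S (T x - z *\<^sub>C x) = x) \<and> (\<forall>x. T (S x) - z *\<^sub>C S x = x)"
      using S(1) fun_cong[OF 1] fun_cong[OF 2] by simp
    then show False using z by (auto simp: op_spectrum_def)
  qed
next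
  fix z assume z: "z \<in> closure (\<mu> ` E)"
  show "z \<in> op_spectrum T"
    unfolding op_spectrum_def
  proof (rule CollectI, rule notI, elim exE conjE)
    fix S assume S: "bounded_clinear S" "\<forall>x. S (T x - z *\<^sub>C x) = x"
    obtain K where K: "K > 0" "\<forall>x. norm (S x) \<le> K * norm x"
      using bounded_clinear_bound[OF S(1)] by blast
    have "1 / K > 0" using K(1) by simp
    then obtain w where "w \<in> \<mu> ` E" "dist w z < 1 / K"
      using z unfolding closure_approachable by blast
    then obtain e where e: "e \<in> E" "cmod (\<mu> e - z) < 1 / K" by (auto simp: dist_norm)
    have "e = S ((\<mu> e - z) *\<^sub>C e)"
      using S(2)[rule_format, of e] by (simp add: \<mu>[OF e(1)] scaleC.diff_left)
    then have "norm e \<le> K * norm ((\<mu> e - z) *\<^sub>C e)" using K(2) by metis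
    then have "1 \<le> K * cmod (\<mu> e - z)" using onb_norm[OF E e(1)] by simp
    with e(2) K(1) show False by (simp add: field_simps)
  qed
qed

section \<open>Polynomials of an operator and the continuous functional calculus\<close>

lemma funpow_eigenvector:
  assumes T: "bounded_clinear T" and e: "T e = \<mu> *\<^sub>R e"
  shows "(T ^^ n) e = \<mu> ^ n *\<^sub>R e"
  by (induction n)
    (simp_all add: scaleR_scaleC bounded_clinear_scaleC[OF T] e[unfolded scaleR_scaleC] scaleC_scaleC
      mult.commute)

lemma poly_op_eigenvector:
  assumes "bounded_clinear T" "T e = \<mu> *\<^sub>R e"
  shows "poly_op p T e = poly p \<mu> *\<^sub>R e"
  unfolding poly_op_def by (simp add: funpow_eigenvector[OF assms] poly_altdef scaleR_sum_left)

lemma bounded_clinear_sum: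
  assumes "\<And>i. i \<in> I \<Longrightarrow> bounded_clinear (F i)"
  shows "bounded_clinear (\<lambda>x. \<Sum>i\<in>I. F i x)"
  using assms
  by (induction I rule: infinite_finite_induct)
    (simp_all add: bounded_clinear_0 bounded_clinear_plus)

lemma bounded_clinear_poly_op:
  assumes "bounded_clinear T" shows "bounded_clinear (poly_op p T)"
  unfolding poly_op_def scaleR_scaleC
  by (rule bounded_clinear_sum, rule bounded_clinear_scale, rule bounded_clinear_power, rule assms)

lemma Stone_Weierstrass_real_poly:
  fixes f :: "real \<Rightarrow> real"
  assumes K: "compact K" and f: "continuous_on K f" and \<epsilon>: "\<epsilon> > 0"
  shows "\<exists>p. \<forall>t\<in>K. \<bar>f t - poly p t\<bar> < \<epsilon>"
proof -
  obtain g where g: "real_polynomial_function g" "\<forall>t\<in>K. \<bar>f t - g t\<bar> < \<epsilon>"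
    using Stone_Weierstrass_real_polynomial_function[OF K f \<epsilon>] by metis
  obtain a n where a: "g = (\<lambda>x. \<Sum>i\<le>n. a i * x ^ i)"
    using g(1) unfolding real_polynomial_function_iff_sum by blast
  have "poly (\<Sum>i\<le>n. monom (a i) i) t = g t" for t
    by (simp add: a poly_sum poly_monom)
  with g(2) show ?thesis by (intro exI[of _ "\<Sum>i\<le>n. monom (a i) i"]) simp
qed

text \<open>Both existence and uniqueness behind the \<open>THE\<close> in \<open>fun_calc\<close>
  are required. The real spectrum is compact, so polynomials approximate \<open>f\<close> uniformly
  on it, and the norm of a diagonal operator is controlled by its entries. Any competing limit is
  tested on an eigenvector, where \<open>poly (p n) (\<mu> e)\<close> tends to
  \<open>f (\<mu> e)\<close>.\<close>

lemma
  fixes T :: "'a::complex_hilbert_space \<Rightarrow> 'a"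
  assumes E: "is_onb E" and T: "bounded_clinear T" and \<mu>: "\<And>e. e \<in> E \<Longrightarrow> T e = \<mu> e *\<^sub>R e"
    and f: "continuous_on {t. complex_of_real t \<in> op_spectrum T} f"
  shows bounded_clinear_fun_calc: "bounded_clinear (fun_calc f T)"
    and fun_calc_eigenvector: "e \<in> E \<Longrightarrow> fun_calc f T e = f (\<mu> e) *\<^sub>R e"
proof -
  define K where "K = {t. complex_of_real t \<in> op_spectrum T}"
  have spec: "op_spectrum T = closure ((\<lambda>e. complex_of_real (\<mu> e)) ` E)"
    by (rule op_spectrum_diagonal[OF E T]) (simp add: \<mu> scaleR_scaleC)
  have \<mu>K: "\<mu> e \<in> K" if "e \<in> E" for e
    unfolding K_def spec using that by (intro CollectI closure_subset[THEN subsetD] imageI)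
  obtain M where M: "M > 0" "\<forall>x. norm (T x) \<le> M * norm x"
    using bounded_clinear_bound[OF T] by blast
  have "\<bar>\<mu> e\<bar> \<le> M" if "e \<in> E" for e
    using M(2)[rule_format, of e] by (simp add: \<mu>[OF that] onb_norm[OF E that])
  then have "(\<lambda>e. complex_of_real (\<mu> e)) ` E \<subseteq> cball 0 M" by auto
  then have "op_spectrum T \<subseteq> cball 0 M"
    unfolding spec by (rule closure_minimal) simp
  then have "K \<subseteq> cball 0 M" by (auto simp: K_def)
  then have "bounded K" by (rule bounded_subset[OF bounded_cball])
  moreover have "closed K"
  proof -
    have "closed (complex_of_real -` op_spectrum T)"
      unfolding spec by (intro continuous_closed_vimage closed_closure) simp
    then show ?thesis by (simp add: K_def vimage_def)
  qed
  ultimately have K: "compact K" by (simp add: compact_eq_bounded_closed)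
  have fK: "continuous_on K f" using f by (simp add: K_def)
  obtain L where L: "\<forall>t\<in>K. \<bar>f t\<bar> \<le> L"
    using compact_imp_bounded[OF compact_continuous_image[OF fK K]] by (auto simp: bounded_iff)
  have "cmod (complex_of_real (f (\<mu> e))) \<le> L" if "e \<in> E" for e
    using L \<mu>K[OF that] by simp
  from exists_diagonal[where d = "\<lambda>e. complex_of_real (f (\<mu> e))", OF E this]
  obtain S where S: "bounded_clinear S" "\<forall>e\<in>E. S e = complex_of_real (f (\<mu> e)) *\<^sub>C e" by blast
  have "\<forall>n. \<exists>p. \<forall>t\<in>K. \<bar>f t - poly p t\<bar> < 1 / real (Suc n)"
    by (rule allI, rule Stone_Weierstrass_real_poly[OF K fK]) simp
  from choice[OF this]
  obtain p where p: "\<forall>n. \<forall>t\<in>K. \<bar>f t - poly (p n) t\<bar> < 1 / real (Suc n)" ..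
  have to0: "(\<lambda>n. 1 / real (Suc n)) \<longlonglongrightarrow> 0"
    by (rule LIMSEQ_Suc[OF lim_1_over_n])
  have ulim: "uniform_limit K (\<lambda>n t. poly (p n) t) f sequentially"
  proof (rule uniform_limitI)
    fix \<epsilon> :: real assume "\<epsilon> > 0"
    from order_tendstoD(2)[OF to0 this]
    show "\<forall>\<^sub>F n in sequentially. \<forall>t\<in>K. dist (poly (p n) t) (f t) < \<epsilon>"
    proof eventually_elim
      case (elim n)
      then show ?case
        using p[rule_format, of _ n] by (fastforce simp: dist_real_def abs_minus_commute)
    qed
  qed
  have le: "onorm (\<lambda>x. poly_op (p n) T x - S x) \<le> 1 / real (Suc n)" for n
  proof (rule onorm_bound)
    show "norm (poly_op (p n) T x - S x) \<le> 1 / real (Suc n) * norm x" for x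
    proof (rule norm_diagonal_le[where d = "\<lambda>e. complex_of_real (poly (p n) (\<mu> e) - f (\<mu> e))",
          OF E bounded_clinear_minus[OF bounded_clinear_poly_op[OF T] S(1)]])
      fix e assume e: "e \<in> E"
      show "poly_op (p n) T e - S e = complex_of_real (poly (p n) (\<mu> e) - f (\<mu> e)) *\<^sub>C e"
        using S(2) e by (simp add: poly_op_eigenvector[OF T \<mu>[OF e]] scaleR_scaleC scaleC.diff_left)
      show "cmod (complex_of_real (poly (p n) (\<mu> e) - f (\<mu> e))) \<le> 1 / real (Suc n)"
        using p[rule_format, OF \<mu>K[OF e], of n]
        by (simp add: abs_minus_commute del: of_real_diff of_nat_Suc)
    qed simp
  qed simp
  have "(\<lambda>n. onorm (\<lambda>x. poly_op (p n) T x - S x)) \<longlonglongrightarrow> 0"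
  proof (rule tendsto_sandwich[OF _ _ tendsto_const to0])
    show "\<forall>\<^sub>F n in sequentially. 0 \<le> onorm (\<lambda>x. poly_op (p n) T x - S x)"
      by (intro always_eventually allI onorm_pos_le bounded_clinear_bounded_linear
          bounded_clinear_minus[OF bounded_clinear_poly_op[OF T] S(1)])
    show "\<forall>\<^sub>F n in sequentially. onorm (\<lambda>x. poly_op (p n) T x - S x) \<le> 1 / real (Suc n)"
      by (intro always_eventually allI le)
  qed
  then have S_lim: "bounded_clinear S \<and> (\<exists>p. uniform_limit K (\<lambda>n t. poly (p n) t) f sequentially \<and>
      (\<lambda>n. onorm (\<lambda>x. poly_op (p n) T x - S x)) \<longlonglongrightarrow> 0)"
    using S(1) ulim by blast
  have uniq: "S' = S" if S': "bounded_clinear S'" and "\<exists>p. uniform_limit K (\<lambda>n t. poly (p n) t) f sequentially \<and>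
      (\<lambda>n. onorm (\<lambda>x. poly_op (p n) T x - S' x)) \<longlonglongrightarrow> 0" for S'
  proof (rule bounded_clinear_eq_on_onb[OF E S' S(1)])
    fix e assume e: "e \<in> E"
    from that(2) obtain q where q: "uniform_limit K (\<lambda>n t. poly (q n) t) f sequentially"
      "(\<lambda>n. onorm (\<lambda>x. poly_op (q n) T x - S' x)) \<longlonglongrightarrow> 0" by blast
    have le: "norm (poly_op (q n) T e - S' e) \<le> onorm (\<lambda>x. poly_op (q n) T x - S' x)" for n
      using onorm[OF bounded_clinear_bounded_linear[OF bounded_clinear_minus[OF
            bounded_clinear_poly_op[OF T, of "q n"] S']], of e]
      by (simp add: onb_norm[OF E e])
    have "(\<lambda>n. poly_op (q n) T e - S' e) \<longlonglongrightarrow> 0"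
      by (rule Lim_null_comparison[OF always_eventually q(2)], rule allI, rule le)
    moreover have "(\<lambda>n. poly_op (q n) T e - S' e) \<longlonglongrightarrow> f (\<mu> e) *\<^sub>R e - S' e"
      unfolding poly_op_eigenvector[OF T \<mu>[OF e]]
      by (intro tendsto_diff tendsto_scaleR tendsto_const tendsto_uniform_limitI[OF q(1) \<mu>K[OF e]])
    ultimately have "f (\<mu> e) *\<^sub>R e - S' e = 0" by (rule LIMSEQ_unique[rotated])
    then show "S' e = S e" using S(2) e by (simp add: scaleR_scaleC)
  qed
  have "fun_calc f T = S"
    unfolding fun_calc_def K_def[symmetric]
    by (rule the_equality, rule S_lim, rule uniq) blast+
  with S show "bounded_clinear (fun_calc f T)"
    and "e \<in> E \<Longrightarrow> fun_calc f T e = f (\<mu> e) *\<^sub>R e"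
    by (simp_all add: scaleR_scaleC)
qed

lemma self_adjoint_diagonal:
  assumes E: "is_onb E" and S: "bounded_clinear S" and d: "\<And>e. e \<in> E \<Longrightarrow> S e = d e *\<^sub>R e"
  shows "self_adjoint S"
proof -
  have d': "S e = complex_of_real (d e) *\<^sub>C e" if "e \<in> E" for e
    using d[OF that] by (simp add: scaleR_scaleC)
  have coeff: "cinner e (S x) = complex_of_real (d e) * cinner e x" if "e \<in> E" for e x
    by (rule cinner_diagonal[OF E S d' that])
  have "cinner (S x) y = cinner x (S y)" for x y
  proof (rule has_sum_unique[OF _ Parseval[OF E]])
    have "cinner (S x) e * cinner e y = cinner x e * cinner e (S y)" if "e \<in> E" for e
      using coeff[OF that] cinner_commute[of "S x" e] cinner_commute[of x e] by simp
    then show "((\<lambda>e. cinner x e * cinner e (S y)) has_sum cinner (S x) y) E"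
      using Parseval[OF E, of "S x" y] by (simp cong: has_sum_cong)
  qed
  with S show ?thesis by (simp add: self_adjoint_def)
qed

section \<open>Rearrangement of the correlation sum\<close>

text \<open>The sum over pairs on the right converges absolutely, whereas the sum over \<open>e'\<close> inside \<open>r e\<close>
  and the sum over \<open>e\<close> cannot in general be interchanged. Truncating \<open>\<phi>\<close> from below at a level
  \<open>t > f0\<close> leaves finitely many nonzero values, for which symmetrization is legitimate; both sides
  then converge dominatedly as \<open>t\<close> decreases to \<open>f0\<close>.\<close>

lemma symmetrized_sum:
  fixes \<phi> \<gamma> :: "'b \<Rightarrow> real" and c :: "'b \<Rightarrow> 'b \<Rightarrow> real"
  assumes sym: "\<And>e e'. c e e' = c e' e"
    and low: "\<And>e. e \<in> E \<Longrightarrow> \<phi> e \<ge> f0"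
    and fin: "\<And>\<epsilon>. \<epsilon> > 0 \<Longrightarrow> finite {e\<in>E. \<phi> e \<ge> f0 + \<epsilon>}"
    and row: "\<And>e. e \<in> E \<Longrightarrow> ((\<lambda>e'. (\<gamma> e - \<gamma> e') * c e e') has_sum r e) E"
    and pairs: "(\<lambda>(e, e'). (\<phi> e - \<phi> e') * ((\<gamma> e - \<gamma> e') * c e e')) summable_on E \<times> E"
    and sm: "(\<lambda>e. (\<phi> e - f0) * r e) summable_on E"
  shows "(\<Sum>\<^sub>\<infinity>e\<in>E. (\<phi> e - f0) * r e) =
    (\<Sum>\<^sub>\<infinity>(e, e')\<in>E \<times> E. (\<phi> e - \<phi> e') * ((\<gamma> e - \<gamma> e') * c e e')) / 2"
proof -
  \<comment> \<open>Positive parts, unlike a sharp cutoff, are 1-Lipschitz in \<open>\<phi>\<close>;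
    this lets the original pair sum dominate the truncated ones.\<close>
  define s where "s = (\<lambda>n e. max (\<phi> e - (f0 + 1 / real (Suc n))) 0)"
  have s_fin: "finite {e\<in>E. s n e \<noteq> 0}" for n
    by (rule finite_subset[OF _ fin[of "1 / real (Suc n)"]]) (auto simp: s_def max_def)
  let ?w = "\<lambda>n (e, e'). (s n e - s n e') * ((\<gamma> e - \<gamma> e') * c e e')"
  have finite_level: "(\<Sum>\<^sub>\<infinity>e\<in>E. s n e * r e) = infsum (?w n) (E \<times> E) / 2" for n
  proof -
    let ?g = "\<lambda>(e, e'). s n e * ((\<gamma> e - \<gamma> e') * c e e')"
    have "(\<lambda>p. norm (?g p)) summable_on E \<times> E"
    proof (rule summable_on_SigmaI)
      fix e assume e: "e \<in> E"
      have "(\<lambda>e'. norm ((\<gamma> e - \<gamma> e') * c e e')) summable_on E"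
        by (rule summable_on_iff_abs_summable_on_real[THEN iffD1, OF has_sum_imp_summable[OF row[OF e]]])
      from has_sum_cmult_right[OF has_sum_infsum[OF this], of "\<bar>s n e\<bar>"]
      show "((\<lambda>e'. norm (?g (e, e'))) has_sum
          \<bar>s n e\<bar> * (\<Sum>\<^sub>\<infinity>e'\<in>E. norm ((\<gamma> e - \<gamma> e') * c e e'))) E"
        by (simp add: abs_mult)
    next
      have "{e\<in>E. \<bar>s n e\<bar> * (\<Sum>\<^sub>\<infinity>e'\<in>E. norm ((\<gamma> e - \<gamma> e') * c e e')) \<noteq> 0} \<subseteq> {e\<in>E. s n e \<noteq> 0}"
        by auto
      from finite_subset[OF this s_fin]
      show "(\<lambda>e. \<bar>s n e\<bar> * (\<Sum>\<^sub>\<infinity>e'\<in>E. norm ((\<gamma> e - \<gamma> e') * c e e'))) summable_on E"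
        by (rule finite_nonzero_values_imp_summable_on)
    qed simp
    then have g: "?g summable_on E \<times> E" by (rule abs_summable_summable)
    have gr: "((\<lambda>e'. ?g (e, e')) has_sum s n e * r e) E" if "e \<in> E" for e
      using has_sum_cmult_right[OF row[OF that], of "s n e"] by simp
    have "((\<lambda>e. s n e * r e) has_sum infsum ?g (E \<times> E)) E"
      by (rule has_sum_SigmaD[OF has_sum_infsum[OF g] gr])
    then have 1: "(\<Sum>\<^sub>\<infinity>e\<in>E. s n e * r e) = infsum ?g (E \<times> E)" by (rule infsumI)
    have "(?g has_sum infsum ?g (E \<times> E)) (E \<times> E)" by (rule has_sum_infsum[OF g])
    moreover from this have "((\<lambda>(e, e'). ?g (e', e)) has_sum infsum ?g (E \<times> E)) (E \<times> E)"
      by (subst has_sum_swap) simp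
    ultimately have "((\<lambda>p. ?g p + (\<lambda>(e, e'). ?g (e', e)) p) has_sum
        infsum ?g (E \<times> E) + infsum ?g (E \<times> E)) (E \<times> E)"
      by (rule has_sum_add)
    \<comment> \<open>Swapping the pair flips the sign of \<open>\<gamma> e - \<gamma> e'\<close>
      and keeps \<open>c\<close>, so the two copies combine to the difference
      \<open>s n e - s n e'\<close>.\<close>
    moreover have "(\<lambda>p. ?g p + (\<lambda>(e, e'). ?g (e', e)) p) = ?w n"
    proof
      fix p show "?g p + (\<lambda>(e, e'). ?g (e', e)) p = ?w n p"
        using sym[of "fst p" "snd p"] by (simp add: case_prod_beta algebra_simps)
    qed
    ultimately have "(?w n has_sum infsum ?g (E \<times> E) + infsum ?g (E \<times> E)) (E \<times> E)" by simp
    then show ?thesis using 1 by (simp add: infsumI)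
  qed
  have to0: "(\<lambda>n. 1 / real (Suc n)) \<longlonglongrightarrow> 0"
    by (rule LIMSEQ_Suc[OF lim_1_over_n])
  have s_lim: "(\<lambda>n. s n e) \<longlonglongrightarrow> \<phi> e - f0" if "e \<in> E" for e
  proof -
    have "(\<lambda>n. s n e) \<longlonglongrightarrow> max (\<phi> e - (f0 + 0)) 0"
      unfolding s_def by (intro tendsto_max tendsto_diff tendsto_add tendsto_const to0)
    then show ?thesis using low[OF that] by simp
  qed
  have s_bound: "\<bar>s n e\<bar> \<le> \<phi> e - f0" if "e \<in> E" for n e
    using low[OF that] by (simp add: s_def max_def)
  have s_lip: "\<bar>s n e - s n e'\<bar> \<le> \<bar>\<phi> e - \<phi> e'\<bar>" for n e e'
    by (simp add: s_def max_def)
  have "(\<lambda>n. \<Sum>\<^sub>\<infinity>e\<in>E. s n e * r e) \<longlonglongrightarrow> (\<Sum>\<^sub>\<infinity>e\<in>E. (\<phi> e - f0) * r e)"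
  proof (rule tendsto_infsum_dominated)
    show "(\<lambda>e. norm ((\<phi> e - f0) * r e)) summable_on E"
      by (rule summable_on_iff_abs_summable_on_real[THEN iffD1, OF sm])
    show "norm (s n e * r e) \<le> norm ((\<phi> e - f0) * r e)" if "e \<in> E" for n e
      using mult_right_mono[OF s_bound[OF that], of "\<bar>r e\<bar>" n] low[OF that] by (simp add: abs_mult)
    show "(\<lambda>n. s n e * r e) \<longlonglongrightarrow> (\<phi> e - f0) * r e" if "e \<in> E" for e
      by (rule tendsto_mult[OF s_lim[OF that] tendsto_const])
  qed
  moreover have "(\<lambda>n. infsum (?w n) (E \<times> E)) \<longlonglongrightarrow>
      (\<Sum>\<^sub>\<infinity>(e, e')\<in>E \<times> E. (\<phi> e - \<phi> e') * ((\<gamma> e - \<gamma> e') * c e e'))"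
  proof (rule tendsto_infsum_dominated)
    show "(\<lambda>p. norm ((\<lambda>(e, e'). (\<phi> e - \<phi> e') * ((\<gamma> e - \<gamma> e') * c e e')) p)) summable_on E \<times> E"
      by (rule summable_on_iff_abs_summable_on_real[THEN iffD1, OF pairs])
    show "norm (?w n p) \<le> norm ((\<lambda>(e, e'). (\<phi> e - \<phi> e') * ((\<gamma> e - \<gamma> e') * c e e')) p)" for n p
      using mult_right_mono[OF s_lip, of "\<bar>(\<gamma> (fst p) - \<gamma> (snd p)) * c (fst p) (snd p)\<bar>"]
      by (simp add: case_prod_beta abs_mult)
    show "(\<lambda>n. ?w n p) \<longlonglongrightarrow> (\<lambda>(e, e'). (\<phi> e - \<phi> e') * ((\<gamma> e - \<gamma> e') * c e e')) p" if "p \<in> E \<times> E" for p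
    proof -
      have "(\<lambda>n. s n (fst p) - s n (snd p)) \<longlonglongrightarrow> (\<phi> (fst p) - f0) - (\<phi> (snd p) - f0)"
        using that by (intro tendsto_diff s_lim) auto
      from tendsto_mult[OF this tendsto_const[of "(\<gamma> (fst p) - \<gamma> (snd p)) * c (fst p) (snd p)"]]
      show ?thesis by (simp add: case_prod_beta)
    qed
  qed
  then have "(\<lambda>n. \<Sum>\<^sub>\<infinity>e\<in>E. s n e * r e) \<longlonglongrightarrow>
      (\<Sum>\<^sub>\<infinity>(e, e')\<in>E \<times> E. (\<phi> e - \<phi> e') * ((\<gamma> e - \<gamma> e') * c e e')) / 2"
    unfolding finite_level by (rule tendsto_divide[OF _ tendsto_const]) simp_all
  ultimately show ?thesis by (rule LIMSEQ_unique)
qed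

section \<open>Cauchy-Schwarz for weighted unordered sums\<close>

lemma quadratic_nonneg_discriminant:
  fixes X Y Z :: real
  assumes "X \<ge> 0" and nonneg: "\<And>s. 0 \<le> X * s\<^sup>2 + 2 * Y * s + Z"
  shows "Y\<^sup>2 \<le> X * Z"
proof (cases "X = 0")
  case True
  have "Y = 0"
  proof (rule ccontr)
    assume "Y \<noteq> 0"
    \<comment> \<open>At this point the linear function takes the value -1.\<close>
    with nonneg[of "- (Z + 1) / (2 * Y)"] True show False by (simp add: field_simps)
  qed
  with True show ?thesis by simp
next
  case False
  with \<open>X \<ge> 0\<close> have X: "X > 0" by simp
  have "X * (- Y / X)\<^sup>2 + 2 * Y * (- Y / X) + Z = Z - Y\<^sup>2 / X"
    using X by (simp add: power2_eq_square field_simps)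
  with nonneg[of "- Y / X"] have "Y\<^sup>2 / X \<le> Z" by linarith
  with X show ?thesis by (simp add: field_simps)
qed

text \<open>Here \<open>c\<close> is dominated by the product of \<open>a\<close> and
  \<open>b\<close> instead of being equal to it, because it will be the real part of a product of
  complex matrix entries. Pointwise, the quadratic in \<open>s\<close> is at least
  \<open>(\<bar>s\<bar> * \<bar>a x\<bar> - \<bar>b x\<bar>)\<^sup>2\<close>.\<close>

lemma weighted_Cauchy_Schwarz:
  fixes w a b c :: "'b \<Rightarrow> real"
  assumes w: "\<And>x. x \<in> A \<Longrightarrow> w x \<ge> 0" and c: "\<And>x. x \<in> A \<Longrightarrow> \<bar>c x\<bar> \<le> \<bar>a x\<bar> * \<bar>b x\<bar>"
    and X: "((\<lambda>x. w x * (a x)\<^sup>2) has_sum X) A" and Z: "((\<lambda>x. w x * (b x)\<^sup>2) has_sum Z) A"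
  shows "(\<lambda>x. w x * c x) summable_on A" and "(\<Sum>\<^sub>\<infinity>x\<in>A. w x * c x)\<^sup>2 \<le> X * Z"
proof -
  show sm: "(\<lambda>x. w x * c x) summable_on A"
  proof (rule abs_summable_summable, rule Infinite_Sum.abs_summable_on_comparison_test')
    show "(\<lambda>x. w x * (a x)\<^sup>2 + w x * (b x)\<^sup>2) summable_on A"
      using has_sum_add[OF X Z] by (rule has_sum_imp_summable)
    fix x assume x: "x \<in> A"
    have "2 * (\<bar>a x\<bar> * \<bar>b x\<bar>) \<le> (a x)\<^sup>2 + (b x)\<^sup>2" "0 \<le> \<bar>a x\<bar> * \<bar>b x\<bar>"
      using sum_squares_bound[of "\<bar>a x\<bar>" "\<bar>b x\<bar>"] by simp_all
    with c[OF x] have "\<bar>c x\<bar> \<le> (a x)\<^sup>2 + (b x)\<^sup>2" by linarith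
    from mult_left_mono[OF this w[OF x]]
    show "norm (w x * c x) \<le> w x * (a x)\<^sup>2 + w x * (b x)\<^sup>2"
      using w[OF x] by (simp add: abs_mult distrib_left)
  qed
  show "(\<Sum>\<^sub>\<infinity>x\<in>A. w x * c x)\<^sup>2 \<le> X * Z"
  proof (rule quadratic_nonneg_discriminant)
    show "X \<ge> 0" by (rule has_sum_nonneg[OF X]) (simp add: w)
    fix s :: real
    have "((\<lambda>x. s\<^sup>2 * (w x * (a x)\<^sup>2) + 2 * s * (w x * c x) + w x * (b x)\<^sup>2) has_sum
        s\<^sup>2 * X + 2 * s * (\<Sum>\<^sub>\<infinity>x\<in>A. w x * c x) + Z) A"
      by (intro has_sum_add has_sum_cmult_right X Z has_sum_infsum sm)
    moreover have "0 \<le> s\<^sup>2 * (w x * (a x)\<^sup>2) + 2 * s * (w x * c x) + w x * (b x)\<^sup>2" if x: "x \<in> A" for x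
    proof -
      have "\<bar>s * c x\<bar> \<le> \<bar>s\<bar> * (\<bar>a x\<bar> * \<bar>b x\<bar>)"
        unfolding abs_mult by (intro mult_left_mono c[OF x]) simp
      then have "- (s * c x) \<le> \<bar>s\<bar> * (\<bar>a x\<bar> * \<bar>b x\<bar>)" by linarith
      moreover have "(\<bar>s\<bar> * \<bar>a x\<bar> - \<bar>b x\<bar>)\<^sup>2 = s\<^sup>2 * (a x)\<^sup>2 - 2 * (\<bar>s\<bar> * (\<bar>a x\<bar> * \<bar>b x\<bar>)) + (b x)\<^sup>2"
        by (simp add: power2_diff power_mult_distrib)
      ultimately have "0 \<le> s\<^sup>2 * (a x)\<^sup>2 + 2 * (s * c x) + (b x)\<^sup>2"
        using zero_le_power2[of "\<bar>s\<bar> * \<bar>a x\<bar> - \<bar>b x\<bar>"] by linarith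
      from mult_nonneg_nonneg[OF w[OF x] this] show ?thesis by (simp add: algebra_simps)
    qed
    ultimately have "0 \<le> s\<^sup>2 * X + 2 * s * (\<Sum>\<^sub>\<infinity>x\<in>A. w x * c x) + Z"
      by (rule has_sum_nonneg)
    then show "0 \<le> X * s\<^sup>2 + 2 * (\<Sum>\<^sub>\<infinity>x\<in>A. w x * c x) * s + Z"
      by (simp add: mult_ac)
  qed
qed

section \<open>Operator monotone functions\<close>

lemma mat_adjoint_one: "mat_adjoint (1\<^sub>m n :: complex mat) = 1\<^sub>m n"
  by (rule eq_matI) (auto simp: mat_adjoint_def mat_of_rows_def)

lemma spectral_mat_one: "spectral_mat n (1\<^sub>m n) d = mat_diag n (\<lambda>i. complex_of_real (d i))"
  by (simp add: spectral_mat_def mat_adjoint_one left_mult_one_mat[OF mat_diag_dim]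
      right_mult_one_mat[OF mat_diag_dim])

lemma unitary_mat_one: "unitary_mat n (1\<^sub>m n)"
  by (simp add: unitary_mat_def mat_adjoint_one)

lemma loewner_le_diag_one:
  "loewner_le 1 (mat_diag 1 (\<lambda>i. complex_of_real (a i))) (mat_diag 1 (\<lambda>i. complex_of_real (b i)))
    \<longleftrightarrow> a 0 \<le> b 0"
proof -
  have form: "((mat_diag 1 (\<lambda>i. complex_of_real (b i)) - mat_diag 1 (\<lambda>i. complex_of_real (a i))) *\<^sub>v v) \<bullet>c v
      = complex_of_real ((b 0 - a 0) * (cmod (v $ 0))\<^sup>2)" if "v \<in> carrier_vec 1" for v
  proof -
    have "((mat_diag 1 (\<lambda>i. complex_of_real (b i)) - mat_diag 1 (\<lambda>i. complex_of_real (a i))) *\<^sub>v v) \<bullet>c v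
      = complex_of_real (b 0 - a 0) * (v $ 0 * cnj (v $ 0))"
      using that by (simp add: scalar_prod_def mult_mat_vec_def mat_diag_def)
    then show ?thesis by (simp only: complex_norm_square[symmetric] of_real_mult)
  qed
  show ?thesis
  proof
    assume le: "loewner_le 1 (mat_diag 1 (\<lambda>i. complex_of_real (a i))) (mat_diag 1 (\<lambda>i. complex_of_real (b i)))"
    have v: "vec 1 (\<lambda>_. 1 :: complex) \<in> carrier_vec 1" by simp
    from bspec[OF le[unfolded loewner_le_def] v, unfolded form[OF v]]
    show "a 0 \<le> b 0" by (simp add: less_eq_complex_def)
  next
    assume "a 0 \<le> b 0"
    then show "loewner_le 1 (mat_diag 1 (\<lambda>i. complex_of_real (a i))) (mat_diag 1 (\<lambda>i. complex_of_real (b i)))"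
      unfolding loewner_le_def by (auto simp: form less_eq_complex_def simp del: One_nat_def)
  qed
qed

text \<open>On matrices of order 1 the Loewner order is the order of the reals.\<close>

lemma operator_monotone_on_mono:
  assumes f: "operator_monotone_on D f" and ab: "a \<in> D" "b \<in> D" "a \<le> b"
  shows "f a \<le> f b"
proof -
  let ?a = "\<lambda>_::nat. a" and ?b = "\<lambda>_::nat. b"
  have "loewner_le 1 (spectral_mat 1 (1\<^sub>m 1) ?a) (spectral_mat 1 (1\<^sub>m 1) ?b)"
    using ab(3) by (simp only: spectral_mat_one loewner_le_diag_one)
  then have "loewner_le 1 (spectral_mat 1 (1\<^sub>m 1) (f \<circ> ?a)) (spectral_mat 1 (1\<^sub>m 1) (f \<circ> ?b))"
    using f[unfolded operator_monotone_on_def, THEN conjunct2, rule_format,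
        of 1 "1\<^sub>m 1" "1\<^sub>m 1" ?a ?b] ab unitary_mat_one by blast
  then show ?thesis by (simp only: spectral_mat_one loewner_le_diag_one o_apply)
qed

section \<open>Skew information and correlation in an eigenbasis\<close>

text \<open>For infinite \<open>E\<close> the witness is \<open>f 0\<close>. The eigenvalues are
  nonnegative with finite sum, so only finitely many exceed a given bound; hence \<open>0\<close>
  lies in the spectrum, monotonicity gives the lower bound, and continuity at \<open>0\<close> gives
  finiteness.\<close>

lemma lower_limit_point_of_spectrum:
  fixes T :: "'a::complex_hilbert_space \<Rightarrow> 'a" and f :: "real \<Rightarrow> real"
  assumes T: "positive_op T" and tc: "trace_class T"
    and E: "is_onb E" and \<mu>: "\<And>e. e \<in> E \<Longrightarrow> T e = \<mu> e *\<^sub>R e"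
    and D: "op_spectrum T \<subseteq> complex_of_real ` D" and \<mu>D: "\<And>e. e \<in> E \<Longrightarrow> \<mu> e \<in> D"
    and cont: "continuous_on D f" and mono: "\<And>s t. s \<in> D \<Longrightarrow> t \<in> D \<Longrightarrow> s \<le> t \<Longrightarrow> f s \<le> f t"
  shows "\<exists>f0. (\<forall>e\<in>E. f (\<mu> e) \<ge> f0) \<and> (\<forall>\<epsilon>>0. finite {e\<in>E. f (\<mu> e) \<ge> f0 + \<epsilon>})"
proof (cases "finite E")
  case True
  \<comment> \<open>Inserting 0 keeps the minimum meaningful for empty \<open>E\<close>.\<close>
  have "Min (insert 0 ((\<lambda>e. f (\<mu> e)) ` E)) \<le> f (\<mu> e)" if "e \<in> E" for e
    using True that by (intro Min_le) auto
  then show ?thesis using True by (intro exI[of _ "Min (insert 0 ((\<lambda>e. f (\<mu> e)) ` E))"]) auto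
next
  case False
  have bT: "bounded_clinear T" using T by (simp add: positive_op_def)
  have form: "cinner e (T e) = complex_of_real (\<mu> e)" if "e \<in> E" for e
    using onb_norm[OF E that] by (simp add: \<mu>[OF that] cinner.scaleR_right cinner_self scaleR_conv_of_real)
  have \<mu>_nonneg: "\<mu> e \<ge> 0" if "e \<in> E" for e
  proof -
    have "0 \<le> cinner e (T e)" using T by (simp add: positive_op_def)
    then show ?thesis by (simp add: form[OF that] less_eq_complex_def)
  qed
  have "((\<lambda>e. Re (cinner e (T e))) has_sum Re (op_trace T)) E"
    by (rule has_sum_Re[OF hs_product_sum_has_trace[OF trace_class_hs_product_sum[OF tc] E]])
  then have "(\<mu> has_sum Re (op_trace T)) E"
    by (rule has_sum_cong[THEN iffD1, rotated]) (simp add: form)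
  then have sm: "\<mu> summable_on E" by (rule has_sum_imp_summable)
  have fin: "finite {e\<in>E. \<mu> e \<ge> \<epsilon>}" if "\<epsilon> > 0" for \<epsilon>
    by (rule summable_imp_finite_ge[OF sm \<mu>_nonneg that])
  have "0 \<in> closure ((\<lambda>e. complex_of_real (\<mu> e)) ` E)"
    unfolding closure_approachable
  proof (intro allI impI)
    fix \<epsilon> :: real assume "\<epsilon> > 0"
    then have "{e\<in>E. \<mu> e \<ge> \<epsilon>} \<noteq> E" using fin False by metis
    then obtain e where "e \<in> E" "\<mu> e < \<epsilon>" by fastforce
    then show "\<exists>y\<in>(\<lambda>e. complex_of_real (\<mu> e)) ` E. dist y 0 < \<epsilon>"
      using \<mu>_nonneg by (intro bexI[of _ "complex_of_real (\<mu> e)"]) auto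
  qed
  moreover have "op_spectrum T = closure ((\<lambda>e. complex_of_real (\<mu> e)) ` E)"
    by (rule op_spectrum_diagonal[OF E bT]) (simp add: \<mu> scaleR_scaleC)
  ultimately have "0 \<in> complex_of_real ` D" using D by blast
  then have D0: "0 \<in> D" by auto
  have "finite {e\<in>E. f (\<mu> e) \<ge> f 0 + \<epsilon>}" if \<epsilon>: "\<epsilon> > 0" for \<epsilon>
  proof -
    obtain \<delta> where \<delta>: "\<delta> > 0" "\<forall>t\<in>D. dist t 0 < \<delta> \<longrightarrow> dist (f t) (f 0) < \<epsilon>"
      using cont D0 \<epsilon> unfolding continuous_on_iff by blast
    have "{e\<in>E. f (\<mu> e) \<ge> f 0 + \<epsilon>} \<subseteq> {e\<in>E. \<mu> e \<ge> \<delta>}"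
    proof (rule subsetI, rule ccontr)
      fix e assume e: "e \<in> {e\<in>E. f (\<mu> e) \<ge> f 0 + \<epsilon>}" and "e \<notin> {e\<in>E. \<mu> e \<ge> \<delta>}"
      then have "dist (\<mu> e) 0 < \<delta>" using \<mu>_nonneg[of e] by (auto simp: dist_real_def)
      then have "dist (f (\<mu> e)) (f 0) < \<epsilon>" using \<delta>(2) \<mu>D e by blast
      then show False using e by (auto simp: dist_real_def)
    qed
    then show ?thesis using fin[OF \<delta>(1)] by (rule finite_subset)
  qed
  moreover have "f (\<mu> e) \<ge> f 0" if "e \<in> E" for e
    by (rule mono[OF D0 \<mu>D[OF that] \<mu>_nonneg[OF that]])
  ultimately show ?thesis by blast
qed

text \<open>A multiple of the identity commutes with the linear map \<open>X\<close> and
  cancels.\<close>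

lemma commutator_centered:
  assumes "bounded_clinear X"
  shows "commutator X (centered \<rho> H) = (\<lambda>v. X (H v) - H (X v))"
  by (rule ext) (simp add: commutator_def centered_def bounded_clinear_diff[OF assms]
      bounded_clinear_scaleC[OF assms])

lemma self_adjoint_commutator_skew:
  assumes "self_adjoint X" "self_adjoint H"
  shows "cinner (X (H v) - H (X v)) w = - cinner v (X (H w) - H (X w))"
  using assms by (simp add: self_adjoint_def cinner.diff_left cinner.diff_right)

lemma bounded_clinear_commutator:
  assumes "self_adjoint X" "self_adjoint H"
  shows "bounded_clinear (\<lambda>v. X (H v) - H (X v))"
  using assms[THEN self_adjoint_bounded_clinear]
  by (intro bounded_clinear_minus) (auto intro: bounded_clinear_comp)

lemma commutator_coeff:
  assumes X: "self_adjoint X" and H: "self_adjoint H"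
    and d: "X e = d *\<^sub>R e" and d': "X e' = d' *\<^sub>R e'"
  shows "cinner e (X (H e') - H (X e')) = complex_of_real (d - d') * cinner e (H e')"
proof -
  have "cinner e (X (H e')) = cinner (X e) (H e')"
    using X by (simp add: self_adjoint_def)
  moreover have "H (X e') = d' *\<^sub>R H e'"
    by (simp add: d' scaleR_scaleC bounded_clinear_scaleC[OF self_adjoint_bounded_clinear[OF H]])
  ultimately show ?thesis
    by (simp add: d cinner.diff_right cinner.scaleR_left cinner.scaleR_right scaleR_conv_of_real
        left_diff_distrib)
qed

text \<open>The factors \<i> produce a sign that skewness of \<open>CF\<close> absorbs, so the
  diagonal entry at \<open>e\<close> is \<open>cinner (CF e) (CG e)\<close>, which Parseval expands
  into real terms. By \<open>pos\<close> these are nonnegative, so summability of the rows followed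
  by the trace gives the double sum.\<close>

lemma
  fixes \<rho> H :: "'a::complex_hilbert_space \<Rightarrow> 'a" and f g :: "real \<Rightarrow> real"
  defines "F \<equiv> fun_calc f \<rho>" and "G \<equiv> fun_calc g \<rho>"
  assumes E: "is_onb E" and F: "self_adjoint F" and G: "self_adjoint G" and H: "self_adjoint H"
    and \<phi>: "\<And>e. e \<in> E \<Longrightarrow> F e = \<phi> e *\<^sub>R e" and \<gamma>: "\<And>e. e \<in> E \<Longrightarrow> G e = \<gamma> e *\<^sub>R e"
    and pos: "\<And>e e'. e \<in> E \<Longrightarrow> e' \<in> E \<Longrightarrow> (\<phi> e - \<phi> e') * (\<gamma> e - \<gamma> e') \<ge> 0"
    and tc: "trace_class (skew_op f g \<rho> H)"
  shows skew_op_has_sum: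
      "((\<lambda>(e, e'). (\<phi> e - \<phi> e') * (\<gamma> e - \<gamma> e') * (cmod (cinner e (H e')))\<^sup>2) has_sum
      Re (op_trace (skew_op f g \<rho> H))) (E \<times> E)"
    and Im_op_trace_skew_op: "Im (op_trace (skew_op f g \<rho> H)) = 0"
proof -
  let ?w = "\<lambda>(e, e'). (\<phi> e - \<phi> e') * (\<gamma> e - \<gamma> e') * (cmod (cinner e (H e')))\<^sup>2"
  let ?S = "skew_op f g \<rho> H"
  define CF where "CF = (\<lambda>v. F (H v) - H (F v))"
  define CG where "CG = (\<lambda>v. G (H v) - H (G v))"
  have bF: "bounded_clinear F" and bG: "bounded_clinear G"
    using F G by (simp_all add: self_adjoint_bounded_clinear)
  have bCF: "bounded_clinear CF" unfolding CF_def by (rule bounded_clinear_commutator[OF F H])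
  have skewF: "cinner (CF v) w = - cinner v (CF w)" for v w
    unfolding CF_def by (rule self_adjoint_commutator_skew[OF F H])
  have S: "?S v = - CF (CG v)" for v
  proof -
    have "?S v = \<i> *\<^sub>C CF (\<i> *\<^sub>C CG v)"
      using bF bG unfolding F_def G_def
      by (simp add: skew_op_def commutator_centered CF_def CG_def F_def G_def)
    also have "\<dots> = (-1) *\<^sub>C CF (CG v)"
      by (simp add: bounded_clinear_scaleC[OF bCF] scaleC_scaleC)
    also have "\<dots> = - CF (CG v)" using scaleR_scaleC[of "-1" "CF (CG v)"] by simp
    finally show ?thesis .
  qed
  have inner: "((\<lambda>e'. complex_of_real (?w (e, e'))) has_sum cinner e (?S e)) E" if e: "e \<in> E" for e
  proof -
    have eq1: "cinner e (?S e) = cinner (CF e) (CG e)"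
      by (simp add: S skewF cinner_minus_right)
    have eq2: "cinner (CF e) e' * cinner e' (CG e) = complex_of_real (?w (e, e'))"
      if e': "e' \<in> E" for e'
    proof -
      have 1: "cinner (CF e) e' = - (complex_of_real (\<phi> e - \<phi> e') * cinner e (H e'))"
        unfolding skewF unfolding CF_def commutator_coeff[OF F H \<phi>[OF e] \<phi>[OF e']] ..
      have 2: "cinner e' (CG e) = complex_of_real (\<gamma> e' - \<gamma> e) * cinner e' (H e)"
        unfolding CG_def by (rule commutator_coeff[OF G H \<gamma>[OF e'] \<gamma>[OF e]])
      have 3: "cinner e' (H e) = cnj (cinner e (H e'))"
        using H cinner_commute[of e' "H e"] by (simp add: self_adjoint_def)
      have "cinner (CF e) e' * cinner e' (CG e) =
          complex_of_real ((\<phi> e - \<phi> e') * (\<gamma> e - \<gamma> e')) * (cinner e (H e') * cnj (cinner e (H e')))"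
        unfolding 1 2 3 by (simp add: algebra_simps)
      then show ?thesis
        by (simp only: complex_norm_square[symmetric] of_real_mult[symmetric] prod.case)
    qed
    show ?thesis
      unfolding eq1 by (rule has_sum_cong[THEN iffD1, OF eq2 Parseval[OF E]])
  qed
  have row: "((\<lambda>e'. ?w (e, e')) has_sum Re (cinner e (?S e))) E"
    and row_Im: "Im (cinner e (?S e)) = 0" if e: "e \<in> E" for e
  proof -
    show "((\<lambda>e'. ?w (e, e')) has_sum Re (cinner e (?S e))) E"
      using has_sum_Re[OF inner[OF e]] by simp
    have "((\<lambda>e'. 0::real) has_sum Im (cinner e (?S e))) E"
      using has_sum_Im[OF inner[OF e]] by simp
    then show "Im (cinner e (?S e)) = 0" by (rule has_sum_unique) simp
  qed
  have tr: "((\<lambda>e. cinner e (?S e)) has_sum op_trace ?S) E"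
    by (rule hs_product_sum_has_trace[OF trace_class_hs_product_sum[OF tc] E])
  note trR = has_sum_Re[OF tr]
  have sm: "?w summable_on E \<times> E"
    by (rule summable_on_SigmaI[OF row has_sum_imp_summable[OF trR]]) (use pos in auto)
  show "(?w has_sum Re (op_trace ?S)) (E \<times> E)"
    by (rule has_sum_SigmaI[OF row trR sm])
  have "((\<lambda>e. Im (cinner e (?S e))) has_sum Im (op_trace ?S)) E" by (rule has_sum_Im[OF tr])
  then have "((\<lambda>e. 0::real) has_sum Im (op_trace ?S)) E"
    by (rule has_sum_cong[THEN iffD1, rotated]) (simp add: row_Im)
  then show "Im (op_trace ?S) = 0" by (rule has_sum_unique) simp
qed

lemma hilbert_schmidt_finite_diagonal:
  assumes E: "is_onb E" and P: "bounded_clinear P" and fin: "finite {e\<in>E. P e \<noteq> 0}"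
  shows "hilbert_schmidt P"
proof -
  have "{e\<in>E. (norm (P e))\<^sup>2 \<noteq> 0} \<subseteq> {e\<in>E. P e \<noteq> 0}" by auto
  from finite_nonzero_values_imp_summable_on[OF finite_subset[OF this fin]]
  show ?thesis using E P by (auto simp: hilbert_schmidt_def)
qed

text \<open>Away from finitely many eigenvalues \<open>F\<close> is boundedly invertible, so \<open>X\<close> is recovered from \<open>F X\<close>
  up to an operator of finite rank.\<close>

lemma hs_product_sum_cancel_diagonal:
  fixes F X :: "'a::complex_hilbert_space \<Rightarrow> 'a"
  assumes E: "is_onb E" and F: "bounded_clinear F" and \<phi>: "\<And>e. e \<in> E \<Longrightarrow> F e = \<phi> e *\<^sub>R e"
    and \<delta>: "\<delta> > 0" and fin: "finite {e\<in>E. \<bar>\<phi> e\<bar> < \<delta>}"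
    and X: "bounded_clinear X" "adjoint_pair X' X" and FX: "hs_product_sum (\<lambda>x. F (X x))"
  shows "hs_product_sum X"
proof -
  define h where "h = (\<lambda>e. if \<bar>\<phi> e\<bar> < \<delta> then 0 else 1 / \<phi> e)"
  define z where "z = (\<lambda>e. if \<bar>\<phi> e\<bar> < \<delta> then 1 else (0::real))"
  have "cmod (complex_of_real (h e)) \<le> 1 / \<delta>" for e
    using \<delta> by (auto simp: h_def norm_divide intro!: frac_le)
  from exists_diagonal[where d = "\<lambda>e. complex_of_real (h e)", OF E this]
  obtain R where R: "bounded_clinear R" "\<forall>e\<in>E. R e = complex_of_real (h e) *\<^sub>C e" by blast
  have "cmod (complex_of_real (z e)) \<le> 1" for e by (simp add: z_def)
  from exists_diagonal[where d = "\<lambda>e. complex_of_real (z e)", OF E this]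
  obtain P where P: "bounded_clinear P" "\<forall>e\<in>E. P e = complex_of_real (z e) *\<^sub>C e" by blast
  have "{e\<in>E. P e \<noteq> 0} \<subseteq> {e\<in>E. \<bar>\<phi> e\<bar> < \<delta>}" using P(2) by (auto simp: z_def split: if_splits)
  then have hsP: "hilbert_schmidt P"
    by (intro hilbert_schmidt_finite_diagonal[OF E P(1)] finite_subset[OF _ fin])
  \<comment> \<open>\<open>P\<close> is idempotent; writing it twice exhibits the finite-rank
    remainder as a product of two Hilbert-Schmidt operators.\<close>
  have "(\<lambda>x. R (F x) + P (P x)) = (\<lambda>x. x)"
  proof (rule bounded_clinear_eq_on_onb[OF E _ bounded_clinear_id])
    show "bounded_clinear (\<lambda>x. R (F x) + P (P x))"
      by (rule bounded_clinear_plus[OF bounded_clinear_comp[OF R(1) F] bounded_clinear_comp[OF P(1) P(1)]])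
    fix e assume e: "e \<in> E"
    have "R (F e) + P (P e) = complex_of_real (\<phi> e * h e + z e * z e) *\<^sub>C e"
      using R P e by (simp add: \<phi> scaleR_scaleC bounded_clinear_scaleC scaleC_scaleC scaleC_add_left)
    moreover have "\<phi> e * h e + z e * z e = 1" using \<delta> by (auto simp: h_def z_def)
    ultimately show "R (F e) + P (P e) = e" by simp
  qed
  from fun_cong[OF this] have "X = (\<lambda>x. R (F (X x)) + P (P (X x)))" by auto
  moreover have "hs_product_sum (\<lambda>x. R (F (X x)) + P (P (X x)))"
    by (intro hs_add hs_product_sum_comp_left[OF FX R(1)]
        hs_prod[OF hsP hilbert_schmidt_comp_right[OF hsP X]])
  ultimately show ?thesis by simp
qed

text \<open>The two correlation operators differ by \<open>F C B\<close> with \<open>C\<close> the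
  commutator of \<open>G\<close> and \<open>A\<close>; moving \<open>F\<close> onto \<open>e\<close>
  produces the factor \<open>\<phi> e\<close>. The shift by \<open>f0\<close> is harmless because
  the multiple of the real diagonal of \<open>C B\<close> that it subtracts sums to zero.\<close>

lemma correlation_has_sum:
  fixes \<rho> A B :: "'a::complex_hilbert_space \<Rightarrow> 'a" and f g :: "real \<Rightarrow> real"
  defines "F \<equiv> fun_calc f \<rho>" and "G \<equiv> fun_calc g \<rho>"
  assumes E: "is_onb E" and F: "self_adjoint F" and G: "self_adjoint G"
    and A: "self_adjoint A" and B: "self_adjoint B"
    and \<phi>: "\<And>e. e \<in> E \<Longrightarrow> F e = \<phi> e *\<^sub>R e"
    and low: "\<And>e. e \<in> E \<Longrightarrow> \<phi> e \<ge> f0" and fin: "\<And>\<epsilon>. \<epsilon> > 0 \<Longrightarrow> finite {e\<in>E. \<phi> e \<ge> f0 + \<epsilon>}"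
    and tc1: "trace_class (corr_op1 f g \<rho> A B)" and tc2: "trace_class (corr_op2 f g \<rho> A B)"
  shows "((\<lambda>e. (\<phi> e - f0) * Re (cinner e (G (A (B e)) - A (G (B e))))) has_sum
    Re (correlation f g \<rho> A B)) E"
proof -
  let ?u = "\<lambda>e. Re (cinner e (G (A (B e)) - A (G (B e))))"
  define C where "C = (\<lambda>v. G (A v) - A (G v))"
  have bF: "bounded_clinear F" and bB: "bounded_clinear B"
    using F B by (simp_all add: self_adjoint_bounded_clinear)
  have bC: "bounded_clinear C" unfolding C_def by (rule bounded_clinear_commutator[OF G A])
  have skew: "cinner (C v) w = - cinner v (C w)" for v w
    unfolding C_def by (rule self_adjoint_commutator_skew[OF G A])
  let ?T1 = "corr_op1 f g \<rho> A B" and ?T2 = "corr_op2 f g \<rho> A B"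
  have t1: "hs_product_sum ?T1" and t2: "hs_product_sum ?T2"
    using tc1 tc2 by (simp_all add: trace_class_hs_product_sum)
  have T: "?T1 v - ?T2 v = F (C (B v))" for v
    unfolding corr_op1_def corr_op2_def op_adjoint_self_adjoint[OF A] F_def[symmetric] G_def[symmetric]
    by (simp add: C_def bounded_clinear_diff[OF bF])
  from has_sum_add[OF hs_product_sum_has_trace[OF t1 E]
      has_sum_uminusI[OF hs_product_sum_has_trace[OF t2 E]]]
  have "((\<lambda>e. cinner e (?T1 e) - cinner e (?T2 e)) has_sum correlation f g \<rho> A B) E"
    by (simp add: correlation_def)
  then have "((\<lambda>e. cinner e (F (C (B e)))) has_sum correlation f g \<rho> A B) E"
    by (simp add: cinner.diff_right[symmetric] T)
  then have "((\<lambda>e. Re (cinner e (F (C (B e))))) has_sum Re (correlation f g \<rho> A B)) E"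
    by (rule has_sum_Re)
  moreover have "Re (cinner e (F (C (B e)))) = \<phi> e * ?u e" if "e \<in> E" for e
  proof -
    have "cinner e (F (C (B e))) = cinner (F e) (C (B e))"
      using F by (simp add: self_adjoint_def)
    then show ?thesis by (simp add: \<phi>[OF that] cinner.scaleR_left C_def)
  qed
  ultimately have corr: "((\<lambda>e. \<phi> e * ?u e) has_sum Re (correlation f g \<rho> A B)) E"
    by (simp cong: has_sum_cong)
  have "((\<lambda>e. f0 * ?u e) has_sum 0) E"
  proof (cases "f0 = 0")
    case False
    \<comment> \<open>For positive \<open>f0\<close> the lower bound excludes such \<open>e\<close>;
      for negative \<open>f0\<close> the right side is \<open>- \<bar>f0\<bar> / 2\<close>. In both
      cases the exceptional set falls under \<open>fin\<close>.\<close>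
    have "\<phi> e \<ge> f0 + \<bar>f0\<bar> / 2" if "e \<in> E" "\<bar>\<phi> e\<bar> < \<bar>f0\<bar> / 2" for e
      using low[OF that(1)] that(2) by arith
    then have "{e\<in>E. \<bar>\<phi> e\<bar> < \<bar>f0\<bar> / 2} \<subseteq> {e\<in>E. \<phi> e \<ge> f0 + \<bar>f0\<bar> / 2}" by auto
    moreover have "finite {e\<in>E. \<phi> e \<ge> f0 + \<bar>f0\<bar> / 2}" by (rule fin) (use False in simp)
    ultimately have small: "finite {e\<in>E. \<bar>\<phi> e\<bar> < \<bar>f0\<bar> / 2}" by (rule finite_subset)
    have "adjoint_pair (\<lambda>v. - C v) C"
      by (simp add: adjoint_pair_def cinner.minus_left skew)
    from adjoint_pair_comp[OF self_adjoint_adjoint_pair[OF B] this]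
    have adj: "adjoint_pair (\<lambda>v. B (- C v)) (\<lambda>v. C (B v))" .
    have bm: "bounded_clinear (\<lambda>x. (-1) *\<^sub>C x :: 'a)"
      by (rule bounded_clinear_scale[OF bounded_clinear_id])
    have "(-1) *\<^sub>C x = - (x :: 'a)" for x using scaleR_scaleC[of "-1" x] by simp
    then have FX: "hs_product_sum (\<lambda>v. F (C (B v)))"
      using hs_add[OF t1 hs_product_sum_comp_left[OF t2 bm]] by (simp add: T)
    have tr: "hs_product_sum (\<lambda>v. C (B v))"
      by (rule hs_product_sum_cancel_diagonal[OF E bF \<phi> _ small bounded_clinear_comp[OF bC bB] adj FX])
        (use False in simp_all)
    have "((\<lambda>e. Re (cinner e (C (B e)))) has_sum Re (op_trace (\<lambda>v. C (B v)))) E"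
      by (rule has_sum_Re[OF hs_product_sum_has_trace[OF tr E]])
    then have "(?u has_sum 0) E"
      unfolding Re_op_trace_skew_adjoint_comp[OF B bC skew tr] by (simp add: C_def)
    from has_sum_cmult_right[OF this, of f0] show ?thesis by simp
  qed simp
  from has_sum_add[OF corr has_sum_uminusI[OF this]] show ?thesis
    by (simp add: left_diff_distrib)
qed

text \<open>Parseval inserts the basis between the commutator and \<open>x\<close>; skewness moves
  the commutator to the other side and back. With \<open>x = B e\<close> this is the row sum to be
  symmetrized.\<close>

lemma correlation_row_has_sum:
  assumes E: "is_onb E" and G: "self_adjoint G" and A: "self_adjoint A"
    and \<gamma>: "\<And>e. e \<in> E \<Longrightarrow> G e = \<gamma> e *\<^sub>R e" and e: "e \<in> E"
  shows "((\<lambda>e'. (\<gamma> e - \<gamma> e') * Re (cinner e (A e') * cinner e' x)) has_sum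
    Re (cinner e (G (A x) - A (G x)))) E"
proof -
  define C where "C = (\<lambda>v. G (A v) - A (G v))"
  have skew: "cinner (C v) w = - cinner v (C w)" for v w
    unfolding C_def by (rule self_adjoint_commutator_skew[OF G A])
  have "((\<lambda>e'. - (cinner (C e) e' * cinner e' x)) has_sum - cinner (C e) x) E"
    by (rule has_sum_uminusI[OF Parseval[OF E]])
  then have "((\<lambda>e'. cinner e (C e') * cinner e' x) has_sum cinner e (C x)) E"
    by (simp add: skew)
  from has_sum_Re[OF this]
  have "((\<lambda>e'. Re (cinner e (C e') * cinner e' x)) has_sum Re (cinner e (C x))) E" .
  moreover have "Re (cinner e (C e') * cinner e' x) =
      (\<gamma> e - \<gamma> e') * Re (cinner e (A e') * cinner e' x)" if "e' \<in> E" for e'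
    unfolding C_def commutator_coeff[OF G A \<gamma>[OF e] \<gamma>[OF that]] mult.assoc
    by (simp del: of_real_diff)
  ultimately have "((\<lambda>e'. (\<gamma> e - \<gamma> e') * Re (cinner e (A e') * cinner e' x)) has_sum
      Re (cinner e (C x))) E"
    by (simp cong: has_sum_cong)
  then show ?thesis by (simp only: C_def)
qed

theorem theorem4p3:
  fixes f g :: "real \<Rightarrow> real" and D :: "real set"
    and \<rho> A B :: "'a::complex_hilbert_space \<Rightarrow> 'a"
  assumes "operator_monotone_on D f" and "operator_monotone_on D g"
    and "monotonic_pair D f g"
    and "density_operator \<rho>"
    and "op_spectrum \<rho> \<subseteq> complex_of_real ` D"
    and "self_adjoint A" and "self_adjoint B"
    and "trace_class (skew_op f g \<rho> A)" and "trace_class (skew_op f g \<rho> B)"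
    and "trace_class (corr_op1 f g \<rho> A B)" and "trace_class (corr_op2 f g \<rho> A B)"
  shows "skew_information f g \<rho> A * skew_information f g \<rho> B
    \<ge> complex_of_real (\<bar>Re (correlation f g \<rho> A B)\<bar>\<^sup>2)"
proof -
  note A = \<open>self_adjoint A\<close> and B = \<open>self_adjoint B\<close>
  have pos: "positive_op \<rho>" and tc: "trace_class \<rho>"
    using assms(4) by (simp_all add: density_operator_def)
  have b\<rho>: "bounded_clinear \<rho>" using pos by (simp add: positive_op_def)
  obtain E \<mu> where E: "is_onb E" and "\<forall>e\<in>E. \<rho> e = \<mu> e *\<^sub>R e"
    by (rule positive_trace_class_eigenbasis[OF pos tc])
  then have \<mu>: "\<rho> e = \<mu> e *\<^sub>R e" if "e \<in> E" for e using that by blast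
  have "op_spectrum \<rho> = closure ((\<lambda>e. complex_of_real (\<mu> e)) ` E)"
    by (rule op_spectrum_diagonal[OF E b\<rho>]) (simp add: \<mu> scaleR_scaleC)
  from order_trans[OF closure_subset assms(5)[unfolded this]]
  have "(\<lambda>e. complex_of_real (\<mu> e)) ` E \<subseteq> complex_of_real ` D" .
  then have \<mu>D: "\<mu> e \<in> D" if "e \<in> E" for e using that by auto
  have sub: "{t. complex_of_real t \<in> op_spectrum \<rho>} \<subseteq> D" using assms(5) by auto
  have cf: "continuous_on D f" and cg: "continuous_on D g"
    using assms(1,2) by (simp_all add: operator_monotone_on_def)
  let ?F = "fun_calc f \<rho>" and ?G = "fun_calc g \<rho>"
  define \<phi> where "\<phi> = (\<lambda>e. f (\<mu> e))"
  define \<gamma> where "\<gamma> = (\<lambda>e. g (\<mu> e))"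
  have F_eig: "?F e = \<phi> e *\<^sub>R e" and G_eig: "?G e = \<gamma> e *\<^sub>R e" if "e \<in> E" for e
    using fun_calc_eigenvector[OF E b\<rho> \<mu> continuous_on_subset[OF cf sub] that]
      fun_calc_eigenvector[OF E b\<rho> \<mu> continuous_on_subset[OF cg sub] that]
    by (simp_all add: \<phi>_def \<gamma>_def)
  have F: "self_adjoint ?F"
    by (rule self_adjoint_diagonal[OF E bounded_clinear_fun_calc[OF E b\<rho> \<mu>
            continuous_on_subset[OF cf sub]] F_eig])
  have G: "self_adjoint ?G"
    by (rule self_adjoint_diagonal[OF E bounded_clinear_fun_calc[OF E b\<rho> \<mu>
            continuous_on_subset[OF cg sub]] G_eig])
  have w: "(\<phi> e - \<phi> e') * (\<gamma> e - \<gamma> e') \<ge> 0" if "e \<in> E" "e' \<in> E" for e e'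
    using assms(3) \<mu>D[OF that(1)] \<mu>D[OF that(2)] by (simp add: monotonic_pair_def \<phi>_def \<gamma>_def)
  from lower_limit_point_of_spectrum[OF pos tc E \<mu> assms(5) \<mu>D cf operator_monotone_on_mono[OF assms(1)]]
  have "\<exists>f0. (\<forall>e\<in>E. \<phi> e \<ge> f0) \<and> (\<forall>\<epsilon>>0. finite {e\<in>E. \<phi> e \<ge> f0 + \<epsilon>})"
    by (simp only: \<phi>_def)
  then obtain f0 where f0: "\<forall>e\<in>E. \<phi> e \<ge> f0" "\<forall>\<epsilon>>0. finite {e\<in>E. \<phi> e \<ge> f0 + \<epsilon>}"
    by (elim exE conjE)

  \<comment> \<open>Exchanging \<open>e\<close> and \<open>e'\<close> conjugates the complex
    product, because \<open>A\<close> and \<open>B\<close> are self-adjoint; the real part is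
    therefore symmetric.\<close>
  define c where "c = (\<lambda>e e'. Re (cinner e (A e') * cinner e' (B e)))"
  let ?w = "\<lambda>p. (\<phi> (fst p) - \<phi> (snd p)) * (\<gamma> (fst p) - \<gamma> (snd p))"
  let ?a = "\<lambda>p. cmod (cinner (fst p) (A (snd p)))"
  let ?b = "\<lambda>p. cmod (cinner (fst p) (B (snd p)))"
  define X where "X = Re (op_trace (skew_op f g \<rho> A))"
  define Z where "Z = Re (op_trace (skew_op f g \<rho> B))"
  note skewA = skew_op_has_sum[OF E F G A F_eig G_eig w assms(8)]
    Im_op_trace_skew_op[OF E F G A F_eig G_eig w assms(8)]
  note skewB = skew_op_has_sum[OF E F G B F_eig G_eig w assms(9)]
    Im_op_trace_skew_op[OF E F G B F_eig G_eig w assms(9)]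
  have sumA: "((\<lambda>p. ?w p * (?a p)\<^sup>2) has_sum X) (E \<times> E)"
    using skewA(1) by (simp add: case_prod_unfold X_def)
  have sumB: "((\<lambda>p. ?w p * (?b p)\<^sup>2) has_sum Z) (E \<times> E)"
    using skewB(1) by (simp add: case_prod_unfold Z_def)
  have adj: "cinner v (H u) = cnj (cinner u (H v))" if "self_adjoint H" for H and u v :: 'a
    using that cinner_commute[of v "H u"] by (simp add: self_adjoint_def)
  have sym: "c e e' = c e' e" for e e'
    unfolding c_def adj[OF A, of e e'] adj[OF B, of e' e] by simp
  have c_le: "\<bar>c (fst p) (snd p)\<bar> \<le> \<bar>?a p\<bar> * \<bar>?b p\<bar>" for p
  proof -
    have "\<bar>c (fst p) (snd p)\<bar> \<le> cmod (cinner (fst p) (A (snd p)) * cinner (snd p) (B (fst p)))"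
      unfolding c_def by (rule abs_Re_le_cmod)
    also have "\<dots> = ?a p * ?b p"
      by (simp add: norm_mult adj[OF B, of "snd p" "fst p"])
    finally show ?thesis by simp
  qed
  have w': "?w p \<ge> 0" if "p \<in> E \<times> E" for p using w that by auto
  \<comment> \<open>Used twice: its summability part licenses the symmetrization, its inequality is
    the final estimate.\<close>
  note CS = weighted_Cauchy_Schwarz[where c = "\<lambda>p. c (fst p) (snd p)", OF w' c_le sumA sumB]

  have corr: "((\<lambda>e. (\<phi> e - f0) * Re (cinner e (?G (A (B e)) - A (?G (B e))))) has_sum
      Re (correlation f g \<rho> A B)) E"
    by (rule correlation_has_sum[OF E F G A B F_eig _ _ assms(10,11)]) (use f0 in auto)
  have "Re (correlation f g \<rho> A B) =
      (\<Sum>\<^sub>\<infinity>e\<in>E. (\<phi> e - f0) * Re (cinner e (?G (A (B e)) - A (?G (B e)))))"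
    using corr by (rule infsumI[symmetric])
  also have "\<dots> = (\<Sum>\<^sub>\<infinity>(e, e')\<in>E \<times> E. (\<phi> e - \<phi> e') * ((\<gamma> e - \<gamma> e') * c e e')) / 2"
  proof (rule symmetrized_sum[OF sym])
    show "((\<lambda>e'. (\<gamma> e - \<gamma> e') * c e e') has_sum Re (cinner e (?G (A (B e)) - A (?G (B e))))) E"
      if "e \<in> E" for e
      unfolding c_def by (rule correlation_row_has_sum[OF E G A G_eig that])
    show "(\<lambda>(e, e'). (\<phi> e - \<phi> e') * ((\<gamma> e - \<gamma> e') * c e e')) summable_on E \<times> E"
      using CS(1) by (simp add: case_prod_unfold mult.assoc)
    show "(\<lambda>e. (\<phi> e - f0) * Re (cinner e (?G (A (B e)) - A (?G (B e))))) summable_on E"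
      using corr by (rule has_sum_imp_summable)
  qed (use f0 in auto)
  finally have double: "2 * Re (correlation f g \<rho> A B) = (\<Sum>\<^sub>\<infinity>p\<in>E \<times> E. ?w p * c (fst p) (snd p))"
    by (simp add: case_prod_unfold mult.assoc)
  \<comment> \<open>The factor 2 from symmetrization matches the two factors \<open>1 / 2\<close> in
    the skew informations.\<close>
  have "(2 * Re (correlation f g \<rho> A B))\<^sup>2 \<le> X * Z"
    unfolding double by (rule CS(2))
  then have "(Re (correlation f g \<rho> A B))\<^sup>2 \<le> X / 2 * (Z / 2)"
    by (simp add: power_mult_distrib)
  \<comment> \<open>The order on complex numbers also compares imaginary parts, so both skew
    informations must be shown to be real.\<close>
  moreover have skew: "skew_information f g \<rho> A = complex_of_real (X / 2)"
    and skew': "skew_information f g \<rho> B = complex_of_real (Z / 2)"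
    using skewA(2) skewB(2)
    by (simp_all add: skew_information_def X_def Z_def complex_eq_iff)
  ultimately show ?thesis
    unfolding skew skew' by (simp add: less_eq_complex_def)
qed

end
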